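(* Let $d\in\mathbb{N}$ and let $\xi,\xi_1,\xi_2,\ldots$ be i.i.d. random variables in $\mathbb{R}^d$ with $\mathbb{E}\|\xi\|<\infty$, $\mathbb{E}\xi=0$ and $\mathbb{E}[\|\xi\|^2]<\infty$. Let $\Sigma:=\mathbb{E}[\xi\xi^{\top}]$, $S_0:=0$, $S_n:=\sum_{i=1}^n\xi_i$, $G_0:=0$ and $G_n:=\frac1n\sum_{i=1}^nS_i$ for $n\ge1$. Then, as $n\to\infty$, as elements of $(\mathcal{D}_0^d,\rho_S)$, $$\frac1{\sqrt n}\big(G_{\lfloor nt\rfloor}\big)_{t\in[0,1]}\Rightarrow\mathcal{GP}(0,K),$$ where $\mathcal{GP}(0,K)$ is a Gaussian process with mean $0$ and the symmetric covariance function $K$ defined by $$K(t_1,t_2)=\begin{cases}t_1\Sigma(3t_2-t_1)/(6t_2),&\text{for }0<t_1\le t_2;\\ t_2\Sigma/3,&\text{for }t_1=0,\ t_2\neq0;\\ 0,&\text{for }t_1=t_2=0.\end{cases}$$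
   Context: $\|\cdot\|$ is the Euclidean norm on $\mathbb{R}^d$; vectors are column vectors and $\top$ denotes transpose. $\mathcal{D}_0^d$ is the set of right-continuous functions $f:[0,1]\to\mathbb{R}^d$ with left-hand limits and $f(0)=0$. $\rho_S$ is the Skorokhod metric $\rho_S(f,g):=\inf_{\lambda\in\Lambda}\max\{\|\lambda-I\|_\infty,\|f-g\circ\lambda\|_\infty\}$, where $\Lambda$ is the set of strictly increasing continuous maps of $[0,1]$ onto itself, $I$ is the identity on $[0,1]$, and $\|\cdot\|_\infty$ is the supremum norm. Weak convergence $X_n\Rightarrow X$ of random elements of a metric space $S$ (with its Borel $\sigma$-algebra) means $\mathbb{E}f(X_n)\to\mathbb{E}f(X)$ for all bounded continuous $f:S\to\mathbb{R}$. A Gaussian process is an $\mathbb{R}^d$-valued process indexed by $t\in[0,1]$ whose finite-dimensional distributions are multivariate normal; its covariance function at $(t_1,t_2)$ is the $d\times d$ matrix of covariances between its values at times $t_1$ and $t_2$. Symmetric means that the values of $K$ for $t_1>t_2$ are obtained by interchanging the roles of $t_1$ and $t_2$.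
   Formalization: The printed value K(0,t)=tΣ/3 for t≠0 is impossible unless Σ=0, since paths in D_0^d vanish at time 0 and so have zero covariance with every other time; the formal statement takes K(0,t)=K(t,0)=0 and keeps K unchanged at all other arguments. *)

theory Defs
  imports "HOL-Probability.Probability"
begin

section \<open>The Skorokhod space\<close>

definition cadlag :: "(real \<Rightarrow> 'b::topological_space) \<Rightarrow> bool" where
  "cadlag f \<longleftrightarrow>
     (\<forall>t\<in>{0..<1}. (f \<longlongrightarrow> f t) (at_right t)) \<and>
     (\<forall>t\<in>{0<..1}. \<exists>l. (f \<longlongrightarrow> l) (at_left t))"

text \<open>Functions on the unit interval are represented by extensional functions, so that two elements
  of the type are equal as soon as they agree on the unit interval.\<close>

typedef (overloaded) 'd cadlag0 =
    "{f :: real \<Rightarrow> real ^ 'd::finite. f \<in> extensional {0..1} \<and> cadlag f \<and> f 0 = 0}"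
  morphisms path_of Abs_cadlag0
proof -
  have "cadlag (restrict (\<lambda>_. 0 :: real ^ 'd) {0..1})"
    unfolding cadlag_def
  proof (intro conjI ballI exI)
    fix t :: real assume t: "t \<in> {0..<1}"
    have "\<forall>\<^sub>F s in at_right t. restrict (\<lambda>_. 0 :: real ^ 'd) {0..1} s = 0"
      using eventually_mono[OF eventually_at_right_real[of t 1]] t by auto
    then show "(restrict (\<lambda>_. 0 :: real ^ 'd) {0..1} \<longlongrightarrow> restrict (\<lambda>_. 0) {0..1} t) (at_right t)"
      using t by (auto intro: tendsto_eventually)
  next
    fix t :: real assume t: "t \<in> {0<..1}"
    have "\<forall>\<^sub>F s in at_left t. restrict (\<lambda>_. 0 :: real ^ 'd) {0..1} s = 0"
      using eventually_mono[OF eventually_at_left_real[of 0 t]] t by auto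
    then show "(restrict (\<lambda>_. 0 :: real ^ 'd) {0..1} \<longlongrightarrow> 0) (at_left t)"
      by (auto intro: tendsto_eventually)
  qed
  then show ?thesis
    by (intro exI[of _ "restrict (\<lambda>_. 0) {0..1}"]) auto
qed

definition time_changes :: "(real \<Rightarrow> real) set" where
  "time_changes =
     {l. strict_mono_on {0..1} l \<and> continuous_on {0..1} l \<and> l ` {0..1} = {0..1}}"

definition sup_norm01 :: "(real \<Rightarrow> 'b::real_normed_vector) \<Rightarrow> real" where
  "sup_norm01 h = (SUP t\<in>{0..1}. norm (h t))"

definition skorokhod_cost ::
    "(real \<Rightarrow> real) \<Rightarrow> (real \<Rightarrow> 'b::real_normed_vector) \<Rightarrow> (real \<Rightarrow> 'b) \<Rightarrow> real" where
  "skorokhod_cost l f g = max (sup_norm01 (\<lambda>t. l t - t)) (sup_norm01 (\<lambda>t. f t - g (l t)))"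

lemma time_changesD:
  assumes "l \<in> time_changes"
  shows "\<And>s t. s \<in> {0..1} \<Longrightarrow> t \<in> {0..1} \<Longrightarrow> s < t \<Longrightarrow> l s < l t"
    and "continuous_on {0..1} l" and "l ` {0..1} = {0..1}"
    and "inj_on l {0..1}" and "\<And>t. t \<in> {0..1} \<Longrightarrow> l t \<in> {0..1}"
    and "\<And>t. 0 \<le> t \<Longrightarrow> t \<le> 1 \<Longrightarrow> 0 \<le> l t \<and> l t \<le> 1"
proof -
  have *: "strict_mono_on {0..1} l" "continuous_on {0..1} l" "l ` {0..1} = {0..1}"
    using assms by (auto simp: time_changes_def)
  show "\<And>s t. s \<in> {0..1} \<Longrightarrow> t \<in> {0..1} \<Longrightarrow> s < t \<Longrightarrow> l s < l t"
    using *(1) by (auto simp: strict_mono_on_def)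
  show "continuous_on {0..1} l" "l ` {0..1} = {0..1}" by fact+
  show "inj_on l {0..1}" using *(1) by (rule strict_mono_on_imp_inj_on)
  show l: "\<And>t. t \<in> {0..1} \<Longrightarrow> l t \<in> {0..1}" using *(3) by blast
  show "\<And>t. 0 \<le> t \<Longrightarrow> t \<le> 1 \<Longrightarrow> 0 \<le> l t \<and> l t \<le> 1" using l by auto
qed

lemma id_time_change: "(\<lambda>t. t) \<in> time_changes"
  by (auto simp: time_changes_def strict_mono_on_def)

lemma time_change_0_1:
  assumes "l \<in> time_changes" shows "l 0 = 0" "l 1 = 1"
proof -
  note l = time_changesD[OF assms]
  obtain s where s: "s \<in> {0..1}" "l s = 0" using l(3) by (metis atLeastAtMost_iff imageE order_refl zero_le_one)
  obtain u where u: "u \<in> {0..1}" "l u = 1" using l(3) by (metis atLeastAtMost_iff imageE order_refl zero_le_one)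
  show "l 0 = 0"
    using l(1)[of 0 s] l(5)[of 0] s by (cases "s = 0") auto
  show "l 1 = 1"
    using l(1)[of u 1] l(5)[of 1] u by (cases "u = 1") auto
qed

lemma time_change_comp:
  assumes "k \<in> time_changes" "l \<in> time_changes"
  shows "(\<lambda>t. k (l t)) \<in> time_changes"
proof -
  note k = time_changesD[OF assms(1)] and l = time_changesD[OF assms(2)]
  have "continuous_on {0..1} (\<lambda>t. k (l t))"
    using continuous_on_compose2[OF k(2) l(2)] l(3) by auto
  moreover have "(\<lambda>t. k (l t)) ` {0..1} = {0..1}"
    using l(3) k(3) by (metis image_image)
  moreover have "strict_mono_on {0..1} (\<lambda>t. k (l t))"
    by (rule strict_mono_onI) (rule k(1)[OF l(5) l(5) l(1)])
  ultimately show ?thesis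
    unfolding time_changes_def by simp
qed

lemma time_change_inv:
  assumes "l \<in> time_changes"
  obtains k where "k \<in> time_changes" "\<And>t. t \<in> {0..1} \<Longrightarrow> k (l t) = t"
    "\<And>t. t \<in> {0..1} \<Longrightarrow> l (k t) = t"
proof -
  note l = time_changesD[OF assms]
  define k where "k = inv_into {0..1} l"
  have kl: "k (l t) = t" if "t \<in> {0..1}" for t
    using that l(4) by (simp add: k_def inv_into_f_f)
  have lk: "l (k t) = t" if "t \<in> {0..1}" for t
    using that l(3) by (simp add: k_def f_inv_into_f)
  have k01: "k t \<in> {0..1}" if "t \<in> {0..1}" for t
    using that l(3) inv_into_into[of t l "{0..1}"] by (simp add: k_def)
  have "continuous_on (l ` {0..1}) k"
    by (rule continuous_on_inv[OF l(2)]) (auto simp: kl)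
  then have "continuous_on {0..1} k" using l(3) by simp
  moreover have "k ` {0..1} = {0..1}"
  proof
    show "k ` {0..1} \<subseteq> {0..1}" using k01 by blast
    show "{0..1} \<subseteq> k ` {0..1}"
    proof
      fix t :: real assume t: "t \<in> {0..1}"
      show "t \<in> k ` {0..1}" using kl[OF t] l(5)[OF t] by (metis imageI)
    qed
  qed
  moreover have "strict_mono_on {0..1} k"
    unfolding strict_mono_on_def
  proof (intro allI impI, elim conjE)
    fix s t :: real assume st: "s \<in> {0..1}" "t \<in> {0..1}" "s < t"
    show "k s < k t"
    proof (rule ccontr)
      assume "\<not> k s < k t"
      then have "l (k t) \<le> l (k s)"
        using l(1)[of "k t" "k s"] k01[OF st(1)] k01[OF st(2)] by (cases "k t = k s") auto
      then show False using lk st by auto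
    qed
  qed
  ultimately have "k \<in> time_changes" by (auto simp: time_changes_def)
  then show ?thesis using kl lk by (rule that)
qed

lemma cadlag_bounded:
  fixes f :: "real \<Rightarrow> 'b::real_normed_vector"
  assumes "cadlag f"
  shows "bounded (f ` {0..1})"
proof -
  have *: "\<exists>e>0. bounded (f ` {s. s \<noteq> x \<and> dist s x < e \<and> s \<in> S})"
    if "(f \<longlongrightarrow> l) (at x within S)" for l x S
  proof -
    have "\<forall>\<^sub>F s in at x within S. dist (f s) l < 1"
      using that tendstoD zero_less_one by blast
    then obtain e where "e > 0" "\<forall>s\<in>S. s \<noteq> x \<and> dist s x < e \<longrightarrow> dist (f s) l < 1"
      unfolding eventually_at by auto
    then show ?thesis
      by (intro exI[of _ e])
        (auto simp: bounded_def dist_commute intro!: less_imp_le exI[of _ l] exI[of _ 1])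
  qed
  have "bounded (f ` ({0..1} \<inter> {0..1}))"
  proof (rule Bolzano[of 0 1 "\<lambda>a b. bounded (f ` ({a..b} \<inter> {0..1}))"])
    fix a b c :: real
    assume "bounded (f ` ({a..b} \<inter> {0..1}))" "bounded (f ` ({b..c} \<inter> {0..1}))" "a \<le> b" "b \<le> c"
    then have "bounded (f ` (({a..b} \<inter> {0..1}) \<union> ({b..c} \<inter> {0..1})))" by (simp add: image_Un)
    then show "bounded (f ` ({a..c} \<inter> {0..1}))"
      by (rule bounded_subset) (rule image_mono, auto)
  next
    fix x :: real assume x: "0 \<le> x" "x \<le> 1"
    have "\<exists>e>0. bounded (f ` ({x<..<x + e} \<inter> {0..1}))"
    proof (cases "x = 1")
      case True
      then have "{x<..<x + 1} \<inter> {0..1} = {}" by auto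
      then show ?thesis by (metis bounded_empty image_empty zero_less_one)
    next
      case False
      then have "(f \<longlongrightarrow> f x) (at_right x)" using x assms by (auto simp: cadlag_def)
      from *[OF this] obtain e where "e > 0" "bounded (f ` {s. s \<noteq> x \<and> dist s x < e \<and> s \<in> {x<..}})" by auto
      then show ?thesis
        by (intro exI[of _ e] conjI) (auto elim!: bounded_subset simp: dist_real_def)
    qed
    then obtain e1 where e1: "e1 > 0" "bounded (f ` ({x<..<x + e1} \<inter> {0..1}))" by auto
    have "\<exists>e>0. bounded (f ` ({x - e<..<x} \<inter> {0..1}))"
    proof (cases "x = 0")
      case True
      then have "{x - 1<..<x} \<inter> {0..1} = {}" by auto
      then show ?thesis by (metis bounded_empty image_empty zero_less_one)
    next
      case False
      then have "x \<in> {0<..1}" using x by simp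
      then obtain l where "(f \<longlongrightarrow> l) (at_left x)" using assms unfolding cadlag_def by blast
      from *[OF this] obtain e where "e > 0" "bounded (f ` {s. s \<noteq> x \<and> dist s x < e \<and> s \<in> {..<x}})" by auto
      then show ?thesis
        by (intro exI[of _ e] conjI) (auto elim!: bounded_subset simp: dist_real_def)
    qed
    then obtain e2 where e2: "e2 > 0" "bounded (f ` ({x - e2<..<x} \<inter> {0..1}))" by auto
    have b: "bounded (insert (f x) (f ` ({x<..<x + e1} \<inter> {0..1}) \<union> f ` ({x - e2<..<x} \<inter> {0..1})))"
      using e1 e2 by simp
    show "\<exists>d>0. \<forall>a b. a \<le> x \<and> x \<le> b \<and> b - a < d \<longrightarrow> bounded (f ` ({a..b} \<inter> {0..1}))"
    proof (intro exI[of _ "min e1 e2"] conjI allI impI)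
      show "0 < min e1 e2" using e1 e2 by auto
      fix a b assume ab: "a \<le> x \<and> x \<le> b \<and> b - a < min e1 e2"
      show "bounded (f ` ({a..b} \<inter> {0..1}))"
      proof (rule bounded_subset[OF b], rule image_subsetI)
        fix s assume s: "s \<in> {a..b} \<inter> {0..1}"
        have "s = x \<or> s \<in> {x<..<x + e1} \<inter> {0..1} \<or> s \<in> {x - e2<..<x} \<inter> {0..1}"
          using s ab by auto
        then show "f s \<in> insert (f x) (f ` ({x<..<x + e1} \<inter> {0..1}) \<union> f ` ({x - e2<..<x} \<inter> {0..1}))"
          by blast
      qed
    qed
  qed auto
  then show ?thesis by simp
qed

lemma path_props:
  shows "path_of x \<in> extensional {0..1}" "cadlag (path_of x)" "path_of x 0 = 0" "bounded (path_of x ` {0..1})"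
  using path_of[of x] cadlag_bounded by auto

lemma sup_norm01_le_iff:
  fixes h :: "real \<Rightarrow> 'b::real_normed_vector"
  assumes "bounded (h ` {0..1})"
  shows "sup_norm01 h \<le> c \<longleftrightarrow> (\<forall>t\<in>{0..1}. norm (h t) \<le> c)"
proof -
  have "bdd_above ((\<lambda>t. norm (h t)) ` {0..1})"
    using assms by (auto simp: bounded_iff bdd_above_def)
  then show ?thesis
    unfolding sup_norm01_def by (subst cSUP_le_iff) auto
qed

lemma skorokhod_cost_le_iff:
  assumes "l \<in> time_changes" "bounded (f ` {0..1})" "bounded (g ` {0..1})"
  shows "skorokhod_cost l f g \<le> c \<longleftrightarrow>
    (\<forall>t\<in>{0..1}. \<bar>l t - t\<bar> \<le> c \<and> norm (f t - g (l t)) \<le> c)"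
proof -
  note l = time_changesD[OF assms(1)]
  have "bounded (l ` {0..1})" using l(3) by simp
  moreover have "bounded ((\<lambda>t. t) ` {0..1::real})" by simp
  ultimately have 1: "bounded ((\<lambda>t. l t - t) ` {0..1})" by (rule bounded_minus_comp)
  have "bounded ((\<lambda>t. g (l t)) ` {0..1})"
    using assms(3) l(3) by (metis image_image)
  with assms(2) have 2: "bounded ((\<lambda>t. f t - g (l t)) ` {0..1})" by (rule bounded_minus_comp)
  show ?thesis
    unfolding skorokhod_cost_def max.bounded_iff sup_norm01_le_iff[OF 1] sup_norm01_le_iff[OF 2]
    by auto
qed

instantiation cadlag0 :: (finite) metric_space
begin

definition dist_cadlag0 :: "'a cadlag0 \<Rightarrow> 'a cadlag0 \<Rightarrow> real" where
  "dist_cadlag0 x y = (INF l\<in>time_changes. skorokhod_cost l (path_of x) (path_of y))"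

definition uniformity_cadlag0 :: "('a cadlag0 \<times> 'a cadlag0) filter" where
  "uniformity_cadlag0 = (INF e\<in>{0<..}. principal {(x, y). dist x y < e})"

definition open_cadlag0 :: "'a cadlag0 set \<Rightarrow> bool" where
  "open_cadlag0 U = (\<forall>x\<in>U. \<forall>\<^sub>F (x', y) in uniformity. x' = x \<longrightarrow> y \<in> U)"

lemma cadlag0_cost_nonneg:
  fixes x y :: "'a cadlag0"
  assumes "l \<in> time_changes" shows "0 \<le> skorokhod_cost l (path_of x) (path_of y)"
proof -
  have "\<bar>l 0 - 0\<bar> \<le> skorokhod_cost l (path_of x) (path_of y)"
    using skorokhod_cost_le_iff[OF assms path_props(4) path_props(4), of x y "skorokhod_cost l (path_of x) (path_of y)"]
    by force
  then show ?thesis by linarith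
qed

lemma cadlag0_dist_le:
  fixes x y :: "'a cadlag0"
  assumes "l \<in> time_changes"
  shows "dist x y \<le> skorokhod_cost l (path_of x) (path_of y)"
  unfolding dist_cadlag0_def
  by (rule cINF_lower) (auto intro!: bdd_belowI2[of _ 0] cadlag0_cost_nonneg assms)

lemma cadlag0_dist_lessD:
  fixes x y :: "'a cadlag0"
  assumes "dist x y < e"
  obtains l where "l \<in> time_changes" "\<And>t. t \<in> {0..1} \<Longrightarrow> \<bar>l t - t\<bar> < e"
    "\<And>t. t \<in> {0..1} \<Longrightarrow> norm (path_of x t - path_of y (l t)) < e"
    "skorokhod_cost l (path_of x) (path_of y) < e"
proof -
  have "time_changes \<noteq> {}" using id_time_change by blast
  then obtain l where l: "l \<in> time_changes" "skorokhod_cost l (path_of x) (path_of y) < e"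
    using assms unfolding dist_cadlag0_def
    by (meson cINF_greatest not_less)
  then have "\<forall>t\<in>{0..1}. \<bar>l t - t\<bar> \<le> skorokhod_cost l (path_of x) (path_of y) \<and>
      norm (path_of x t - path_of y (l t)) \<le> skorokhod_cost l (path_of x) (path_of y)"
    using skorokhod_cost_le_iff[OF l(1) path_props(4) path_props(4), of x y "skorokhod_cost l (path_of x) (path_of y)"] by auto
  then show ?thesis using that[of l] l by force
qed

lemma cadlag0_dist_nonneg: "0 \<le> dist x (y :: 'a cadlag0)"
  unfolding dist_cadlag0_def
  by (rule cINF_greatest) (use id_time_change in \<open>auto intro!: cadlag0_cost_nonneg\<close>)

lemma cadlag0_dist_sym: "dist x y \<le> dist y (x :: 'a cadlag0)"
proof (rule field_le_epsilon)
  fix e :: real assume "e > 0"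
  then have "dist y x < dist y x + e" by simp
  then obtain l where l: "l \<in> time_changes" "\<And>t. t \<in> {0..1} \<Longrightarrow> \<bar>l t - t\<bar> < dist y x + e"
    "\<And>t. t \<in> {0..1} \<Longrightarrow> norm (path_of y t - path_of x (l t)) < dist y x + e"
    by (elim cadlag0_dist_lessD) blast
  obtain k where k: "k \<in> time_changes" "\<And>t. t \<in> {0..1} \<Longrightarrow> k (l t) = t"
    "\<And>t. t \<in> {0..1} \<Longrightarrow> l (k t) = t"
    using time_change_inv[OF l(1)] by blast
  have "skorokhod_cost k (path_of x) (path_of y) \<le> dist y x + e"
    unfolding skorokhod_cost_le_iff[OF k(1) path_props(4) path_props(4)]
  proof (intro ballI conjI)
    fix t :: real assume t: "t \<in> {0..1}"
    note kt = time_changesD(5)[OF k(1) t]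
    show "\<bar>k t - t\<bar> \<le> dist y x + e" using l(2)[OF kt] k(3)[OF t] by simp
    show "norm (path_of x t - path_of y (k t)) \<le> dist y x + e"
      using l(3)[OF kt] k(3)[OF t] by (simp add: norm_minus_commute)
  qed
  then show "dist x y \<le> dist y x + e" using cadlag0_dist_le[OF k(1), of x y] by linarith
qed

lemma cadlag0_dist_triangle: "dist x y \<le> dist x z + dist z (y :: 'a cadlag0)"
proof (rule field_le_epsilon)
  fix e :: real assume "e > 0"
  then have "dist x z < dist x z + e/2" "dist z y < dist z y + e/2" by auto
  then obtain l k where l: "l \<in> time_changes" "\<And>t. t \<in> {0..1} \<Longrightarrow> \<bar>l t - t\<bar> < dist x z + e/2"
      "\<And>t. t \<in> {0..1} \<Longrightarrow> norm (path_of x t - path_of z (l t)) < dist x z + e/2"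
    and k: "k \<in> time_changes" "\<And>t. t \<in> {0..1} \<Longrightarrow> \<bar>k t - t\<bar> < dist z y + e/2"
      "\<And>t. t \<in> {0..1} \<Longrightarrow> norm (path_of z t - path_of y (k t)) < dist z y + e/2"
    by (elim cadlag0_dist_lessD) blast
  note kl = time_change_comp[OF k(1) l(1)]
  have "skorokhod_cost (\<lambda>t. k (l t)) (path_of x) (path_of y) \<le> dist x z + dist z y + e"
    unfolding skorokhod_cost_le_iff[OF kl path_props(4) path_props(4)]
  proof (intro ballI conjI)
    fix t :: real assume t: "t \<in> {0..1}"
    note lt = time_changesD(5)[OF l(1) t]
    show "\<bar>k (l t) - t\<bar> \<le> dist x z + dist z y + e"
      using l(2)[OF t] k(2)[OF lt] by linarith
    have "norm (path_of x t - path_of y (k (l t))) \<le>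
        norm (path_of x t - path_of z (l t)) + norm (path_of z (l t) - path_of y (k (l t)))"
      using norm_triangle_ineq[of "path_of x t - path_of z (l t)" "path_of z (l t) - path_of y (k (l t))"] by simp
    then show "norm (path_of x t - path_of y (k (l t))) \<le> dist x z + dist z y + e"
      using l(3)[OF t] k(3)[OF lt] by linarith
  qed
  then show "dist x y \<le> dist x z + dist z y + e" using cadlag0_dist_le[OF kl, of x y] by linarith
qed

lemma cadlag0_dist_refl: "dist x (x :: 'a cadlag0) = 0"
proof -
  have "skorokhod_cost (\<lambda>t. t) (path_of x) (path_of x) \<le> 0"
    unfolding skorokhod_cost_le_iff[OF id_time_change path_props(4) path_props(4)] by auto
  then show ?thesis
    using cadlag0_dist_le[OF id_time_change, of x x] cadlag0_dist_nonneg[of x x] by linarith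
qed

lemma cadlag0_dist_0D:
  fixes x y :: "'a cadlag0"
  assumes "dist x y = 0"
  shows "x = y"
proof -
  let ?f = "path_of x" and ?g = "path_of y"
  have close: "\<exists>s\<in>{0..1}. \<bar>s - t\<bar> < e \<and> norm (?f t - ?g s) < e" if "e > 0" "t \<in> {0..1}" for e t
  proof -
    have "dist x y < e" using assms that by simp
    then obtain l where "l \<in> time_changes" "\<bar>l t - t\<bar> < e" "norm (?f t - ?g (l t)) < e"
      using \<open>t \<in> {0..1}\<close> by (elim cadlag0_dist_lessD) blast
    then show ?thesis using time_changesD(5)[of l t] that by blast
  qed
  have "?f t = ?g t" if t: "t \<in> {0..<1}" for t
  proof (rule ccontr)
    assume ne: "?f t \<noteq> ?g t"
    define e where "e = norm (?f t - ?g t) / 4"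
    have e: "e > 0" using ne by (simp add: e_def)
    have "\<forall>\<^sub>F s in at_right t. dist (?f s) (?f t) < e"
      using path_props(2)[of x] t e by (auto simp: cadlag_def tendsto_iff)
    moreover have "\<forall>\<^sub>F s in at_right t. dist (?g s) (?g t) < e"
      using path_props(2)[of y] t e by (auto simp: cadlag_def tendsto_iff)
    ultimately have "\<forall>\<^sub>F s in at_right t. dist (?f s) (?f t) < e \<and> dist (?g s) (?g t) < e"
      by (rule eventually_conj)
    then obtain b where b: "b > t" "\<And>s. s > t \<Longrightarrow> s < b \<Longrightarrow> dist (?f s) (?f t) < e \<and> dist (?g s) (?g t) < e"
      unfolding eventually_at_right_field by auto
    define c where "c = min b 1"
    have c: "c > t" "c \<le> 1" "c \<le> b" using b t by (auto simp: c_def)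
    define r where "r = (t + c) / 2"
    define d where "d = (c - t) / 2"
    have r: "t < r" "r < b" "r \<in> {0..1}" "d > 0" using c t by (auto simp: r_def d_def)
    obtain s where s: "\<bar>s - r\<bar> < min d e" "norm (?f r - ?g s) < min d e"
      using close[of "min d e" r] r e by auto
    have "t < s" "s < b" using s(1) c by (auto simp: r_def d_def field_simps abs_if split: if_splits)
    then have "dist (?g s) (?g t) < e" "dist (?f r) (?f t) < e" "dist (?f r) (?g s) < e"
      using b(2) r s(2) by (auto simp: dist_norm)
    then have "dist (?f t) (?g t) < 3 * e"
      using dist_triangle[of "?f t" "?g t" "?f r"] dist_triangle[of "?f r" "?g t" "?g s"]
      by (simp add: dist_commute)
    then show False using e by (simp add: e_def dist_norm)
  qed
  moreover have "?f 1 = ?g 1"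
  proof (rule ccontr)
    assume "?f 1 \<noteq> ?g 1"
    then have "dist x y < norm (?f 1 - ?g 1)" using assms by simp
    then obtain l where "l \<in> time_changes" "norm (?f 1 - ?g (l 1)) < norm (?f 1 - ?g 1)"
      by (elim cadlag0_dist_lessD) (meson atLeastAtMost_iff order_refl zero_le_one)
    then show False using time_change_0_1(2)[of l] by simp
  qed
  ultimately have "?f t = ?g t" if "t \<in> {0..1}" for t
    using that by (cases "t = 1") auto
  then have "?f = ?g"
    by (intro extensionalityI[OF path_props(1) path_props(1)])
  then show ?thesis by (simp add: path_of_inject)
qed

instance
proof
  fix x y z :: "'a cadlag0"
  show "dist x y = 0 \<longleftrightarrow> x = y" using cadlag0_dist_0D cadlag0_dist_refl by blast
  show "dist x y \<le> dist x z + dist y z"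
    using cadlag0_dist_triangle[of x y z] cadlag0_dist_sym[of z y] by linarith
qed (simp_all add: uniformity_cadlag0_def open_cadlag0_def)

end


section \<open>Weak convergence and Gaussian processes\<close>

text \<open>\<open>weakly_converges M X N Y\<close>: the random elements \<open>X n\<close>, defined on the probability space \<open>M\<close>,
  converge weakly to the random element \<open>Y\<close>, defined on the probability space \<open>N\<close>. Measurability
  refers to the Borel sigma-algebra of the metric space and is part of the notion.\<close>

definition weakly_converges ::
    "'a measure \<Rightarrow> (nat \<Rightarrow> 'a \<Rightarrow> 's::metric_space) \<Rightarrow> 'b measure \<Rightarrow> ('b \<Rightarrow> 's) \<Rightarrow> bool" where
  "weakly_converges M X N Y \<longleftrightarrow>
     (\<forall>n. X n \<in> borel_measurable M) \<and> Y \<in> borel_measurable N \<and>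
     (\<forall>f :: 's \<Rightarrow> real. continuous_on UNIV f \<longrightarrow> bounded (range f) \<longrightarrow>
        (\<lambda>n. LINT \<omega>|M. f (X n \<omega>)) \<longlonglongrightarrow> (LINT \<omega>|N. f (Y \<omega>)))"

text \<open>Point masses count as normal laws: \<open>\<Sigma>\<close> may be singular, and a path vanishes at time 0.\<close>

definition normal_law :: "real \<Rightarrow> real \<Rightarrow> real measure" where
  "normal_law m s = (if s = 0 then return borel m else density lborel (normal_density m s))"

text \<open>The concatenation of the vectors \<open>Y i\<close>, for \<open>i\<close> in the finite set \<open>I\<close>, is multivariate normal:
  all of its linear functionals have a univariate normal law.\<close>

definition multivariate_normal ::
    "'a measure \<Rightarrow> 'i set \<Rightarrow> ('i \<Rightarrow> 'a \<Rightarrow> 'v::euclidean_space) \<Rightarrow> bool" where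
  "multivariate_normal M I Y \<longleftrightarrow>
     (\<forall>i\<in>I. Y i \<in> borel_measurable M) \<and>
     (\<forall>u. \<exists>m s. 0 \<le> s \<and> distr M borel (\<lambda>\<omega>. \<Sum>i\<in>I. u i \<bullet> Y i \<omega>) = normal_law m s)"

definition outer :: "real ^ 'd \<Rightarrow> real ^ 'd \<Rightarrow> real ^ 'd ^ 'd" where
  "outer x y = (columnvector x :: real ^ 1 ^ 'd) ** (rowvector y :: real ^ 'd ^ 1)"

lemma outer_nth [simp]: "outer x y $ i $ j = x $ i * y $ j"
  by (simp add: outer_def columnvector_def rowvector_def matrix_matrix_mult_def)

definition covariance_matrix ::
    "'a measure \<Rightarrow> ('a \<Rightarrow> real ^ 'd) \<Rightarrow> ('a \<Rightarrow> real ^ 'd) \<Rightarrow> real ^ 'd ^ 'd" where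
  "covariance_matrix M Y Z =
     (LINT \<omega>|M. outer (Y \<omega> - (LINT \<omega>'|M. Y \<omega>')) (Z \<omega> - (LINT \<omega>'|M. Z \<omega>')))"

definition gaussian_process ::
    "'a measure \<Rightarrow> (real \<Rightarrow> 'a \<Rightarrow> real ^ 'd) \<Rightarrow>
     (real \<Rightarrow> real ^ 'd) \<Rightarrow> (real \<Rightarrow> real \<Rightarrow> real ^ 'd ^ 'd) \<Rightarrow> bool" where
  "gaussian_process M X m C \<longleftrightarrow>
     prob_space M \<and>
     (\<forall>T. finite T \<longrightarrow> T \<subseteq> {0..1} \<longrightarrow> multivariate_normal M T X) \<and>
     (\<forall>t\<in>{0..1}. (LINT \<omega>|M. X t \<omega>) = m t) \<and>
     (\<forall>t1\<in>{0..1}. \<forall>t2\<in>{0..1}. covariance_matrix M (X t1) (X t2) = C t1 t2)"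


section \<open>The centre of mass process of a random walk\<close>

text \<open>The increments are \<open>\<xi> 1, \<xi> 2, \<dots>\<close>; the entry \<open>\<xi> 0\<close> is the
  generic copy \<open>\<xi>\<close> and is not used by the walk.\<close>

definition walk :: "(nat \<Rightarrow> 'a \<Rightarrow> real ^ 'd) \<Rightarrow> nat \<Rightarrow> 'a \<Rightarrow> real ^ 'd" where
  "walk \<xi> n \<omega> = (\<Sum>i=1..n. \<xi> i \<omega>)"

definition centre_of_mass :: "(nat \<Rightarrow> 'a \<Rightarrow> real ^ 'd) \<Rightarrow> nat \<Rightarrow> 'a \<Rightarrow> real ^ 'd" where
  "centre_of_mass \<xi> n \<omega> =
     (if n = 0 then 0 else (1 / real n) *\<^sub>R (\<Sum>i=1..n. walk \<xi> i \<omega>))"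

definition centre_of_mass_path :: "(nat \<Rightarrow> 'a \<Rightarrow> real ^ 'd) \<Rightarrow> nat \<Rightarrow> 'a \<Rightarrow> 'd::finite cadlag0" where
  "centre_of_mass_path \<xi> n \<omega> =
     Abs_cadlag0 (\<lambda>t\<in>{0..1}. (1 / sqrt (real n)) *\<^sub>R centre_of_mass \<xi> (nat \<lfloor>real n * t\<rfloor>) \<omega>)"

lemma step_function_cadlag:
  fixes a :: "nat \<Rightarrow> 'b::topological_space"
  shows "cadlag (\<lambda>t\<in>{0..1}. a (nat \<lfloor>real n * t\<rfloor>))"
proof (cases "n = 0")
  case True
  show ?thesis unfolding cadlag_def
  proof (intro conjI ballI exI)
    fix t :: real assume t: "t \<in> {0..<1}"
    show "((\<lambda>t\<in>{0..1}. a (nat \<lfloor>real n * t\<rfloor>)) \<longlongrightarrow> (\<lambda>t\<in>{0..1}. a (nat \<lfloor>real n * t\<rfloor>)) t) (at_right t)"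
      by (rule tendsto_eventually, rule eventually_mono[OF eventually_at_right_real[of t 1]])
        (use t True in auto)
  next
    fix t :: real assume t: "t \<in> {0<..1}"
    show "((\<lambda>t\<in>{0..1}. a (nat \<lfloor>real n * t\<rfloor>)) \<longlongrightarrow> a 0) (at_left t)"
      by (rule tendsto_eventually, rule eventually_mono[OF eventually_at_left_real[of 0 t]])
        (use t True in auto)
  qed
next
  case False
  then have n: "real n > 0" by simp
  let ?f = "\<lambda>t\<in>{0..1}. a (nat \<lfloor>real n * t\<rfloor>)"
  show ?thesis unfolding cadlag_def
  proof (intro conjI ballI)
    fix t :: real assume t: "t \<in> {0..<1}"
    define b where "b = min 1 ((of_int \<lfloor>real n * t\<rfloor> + 1) / real n)"
    have "t < (of_int \<lfloor>real n * t\<rfloor> + 1) / real n"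
      using n floor_correct[of "real n * t"] by (simp add: field_simps)
    then have "t < b" using t by (simp add: b_def)
    have "?f s = ?f t" if "s \<in> {t<..<b}" for s
    proof -
      have "real n * s < of_int \<lfloor>real n * t\<rfloor> + 1"
        using that n by (simp add: b_def field_simps)
      moreover have "of_int \<lfloor>real n * t\<rfloor> \<le> real n * s"
        using that n floor_correct[of "real n * t"]
        by (meson greaterThanLessThan_iff less_imp_le mult_left_mono order_trans)
      ultimately have "\<lfloor>real n * s\<rfloor> = \<lfloor>real n * t\<rfloor>" by (simp add: floor_eq_iff)
      then show ?thesis using that t by (auto simp: b_def)
    qed
    then show "(?f \<longlongrightarrow> ?f t) (at_right t)"
      by (intro tendsto_eventually eventually_mono[OF eventually_at_right_real[OF \<open>t < b\<close>]])
  next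
    fix t :: real assume t: "t \<in> {0<..1}"
    define b where "b = max 0 ((of_int \<lceil>real n * t\<rceil> - 1) / real n)"
    have "(of_int \<lceil>real n * t\<rceil> - 1) / real n < t"
      using n ceiling_correct[of "real n * t"] by (simp add: field_simps)
    then have "b < t" using t by (simp add: b_def)
    have "?f s = a (nat (\<lceil>real n * t\<rceil> - 1))" if "s \<in> {b<..<t}" for s
    proof -
      have "of_int \<lceil>real n * t\<rceil> - 1 < real n * s"
        using that n by (simp add: b_def field_simps)
      moreover have "real n * s < of_int \<lceil>real n * t\<rceil>"
        using that n ceiling_correct[of "real n * t"]
        by (meson greaterThanLessThan_iff less_le_trans mult_strict_left_mono)
      ultimately have "\<lfloor>real n * s\<rfloor> = \<lceil>real n * t\<rceil> - 1" by (simp add: floor_eq_iff)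
      then show ?thesis using that t by (auto simp: b_def)
    qed
    then show "\<exists>l. (?f \<longlongrightarrow> l) (at_left t)"
      by (intro exI[of _ "a (nat (\<lceil>real n * t\<rceil> - 1))"] tendsto_eventually
          eventually_mono[OF eventually_at_left_real[OF \<open>b < t\<close>]])
  qed
qed

lemma path_of_centre_of_mass_path:
  "path_of (centre_of_mass_path \<xi> n \<omega>) =
     (\<lambda>t\<in>{0..1}. (1 / sqrt (real n)) *\<^sub>R centre_of_mass \<xi> (nat \<lfloor>real n * t\<rfloor>) \<omega>)"
  unfolding centre_of_mass_path_def
  using step_function_cadlag[of "\<lambda>k. (1 / sqrt (real n)) *\<^sub>R centre_of_mass \<xi> k \<omega>" n]
  by (subst Abs_cadlag0_inverse) (auto simp: centre_of_mass_def)

text \<open>A process with paths in the Skorokhod space vanishes at time 0, so its covariance at \<open>(0, t)\<close> is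
  necessarily 0. The value \<open>(t / 3) *\<^sub>R \<Sigma>\<close> printed in the source for \<open>(0, t)\<close> with \<open>t \<noteq> 0\<close> is therefore
  impossible unless \<open>\<Sigma> = 0\<close>; it is the value at \<open>(t, t)\<close>. The definition below agrees with the printed
  one at all other arguments, and extends it continuously to \<open>(0, t)\<close>.\<close>

lemma gaussian_process_covariance_0:
  fixes X :: "'a \<Rightarrow> 'd::finite cadlag0"
  assumes "gaussian_process N (\<lambda>t \<omega>. path_of (X \<omega>) t) m C" and "t \<in> {0..1}"
  shows "C 0 t = 0"
proof -
  have "C 0 t = covariance_matrix N (\<lambda>\<omega>. path_of (X \<omega>) 0) (\<lambda>\<omega>. path_of (X \<omega>) t)"
    using assms by (simp add: gaussian_process_def)
  also have "\<dots> = (LINT \<omega>|N. 0)"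
    unfolding covariance_matrix_def path_props(3)
    by (intro Bochner_Integration.integral_cong) (auto simp: vec_eq_iff)
  finally show ?thesis by simp
qed

definition limit_covariance :: "real ^ 'd ^ 'd \<Rightarrow> real \<Rightarrow> real \<Rightarrow> real ^ 'd ^ 'd" where
  "limit_covariance \<Sigma> t1 t2 =
     (if 0 < t1 \<and> t1 \<le> t2 then (t1 * (3 * t2 - t1) / (6 * t2)) *\<^sub>R \<Sigma>
      else if 0 < t2 \<and> t2 < t1 then (t2 * (3 * t1 - t2) / (6 * t1)) *\<^sub>R \<Sigma>
      else 0)"

end

theory Submission
  imports Defs
begin

text \<open>Write \<open>Z\<^sub>n\<close> for the rescaled centre of mass process. Only second moments are needed. The increments
  satisfy \<open>E |G\<^sub>m\<^sub>+\<^sub>1 - G\<^sub>m|\<^sup>2 \<le> E |\<xi>|\<^sup>2 / (m + 1)\<close>, because \<open>G\<^sub>m\<^sub>+\<^sub>1 - G\<^sub>m\<close> is a weighted sum of \<open>m + 1\<close> steps with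
  weights at most \<open>1 / (m + 1)\<close>; a weighted Cauchy--Schwarz inequality turns this into a bound on the
  supremum distance between \<open>Z\<^sub>n\<close> and its restriction to the grid of mesh \<open>1 / k\<close>, of order
  \<open>(1 / k + 1 / n) powr (1 / 4)\<close> in mean. On a grid, characteristic functions converge to Gaussian ones.
  The limit is built from a Gaussian sequence obtained by an infinite Cholesky factorisation of the covariance
  kernel (positive semidefinite as a limit of covariances): since its increments have variance
  \<open>(t - s)\<^sup>2 / (3 t)\<close> times \<open>\<Sigma>\<close>, the dyadic step paths converge uniformly almost surely. It remains to
  compare expectations of Lipschitz functions, which determine weak convergence.\<close>

section \<open>Weak convergence through Lipschitz functions\<close>

text \<open>Neither a tightness criterion nor a maximal inequality enters. Averaging is what makes
  this possible: the increments of \<open>G\<close> shrink along the walk, so bounding an increment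
  over a block by the sum of the sizes of its steps loses little, whereas the steps of
  \<open>S\<close> keep a fixed variance and the same bound would be useless. No time change is ever
  constructed, since all approximations hold in supremum norm. The exponent 1/4 has two sources:
  Cauchy-Schwarz bounds the mean squared distance by the square root of
  \<open>1 / k + 1 / n\<close>, and the passage from the second moment to the mean takes another
  root. The limit has to be constructed, because its existence with paths in the Skorokhod space is
  part of the claim. Only rational times are needed before completion, so pairs of a time and a
  coordinate can be coded by natural numbers; the construction becomes the factorisation of a single
  infinite matrix, and the same codes index the finite-dimensional distributions of the
  walk.\<close>

lemma continuous_limit_of_lipschitz:
  fixes f :: "'s::metric_space \<Rightarrow> real"
  assumes f: "continuous_on UNIV f" and B: "\<And>x. \<bar>f x\<bar> \<le> B"
  obtains g where "\<And>k x y. \<bar>g k x - g k y\<bar> \<le> real k * dist x y" "\<And>k x. \<bar>g k x\<bar> \<le> B"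
    "\<And>k x. g k x \<le> f x" "\<And>x. (\<lambda>k. g k x) \<longlonglongrightarrow> f x"
proof -
  \<comment> \<open>Infimal convolution of \<open>f\<close> with \<open>real k * dist\<close>: an
    infimum of functions that are \<open>real k\<close>-Lipschitz in \<open>x\<close>, lying below
    \<open>f\<close> by the choice \<open>y = x\<close>. Boundedness of \<open>f\<close> keeps the
    infimum finite.\<close>
  define g where "g k x = (INF y. f y + real k * dist x y)" for k :: nat and x
  have bdd: "bdd_below (range (\<lambda>y. f y + real k * dist x y))" for k x
  proof (rule bdd_belowI2)
    fix y show "- B \<le> f y + real k * dist x y"
      using B[of y] zero_le_dist[of x y] mult_nonneg_nonneg[of "real k" "dist x y"] by linarith
  qed
  have gle: "g k x \<le> f y + real k * dist x y" for k x y
    unfolding g_def by (rule cINF_lower[OF bdd]) auto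
  have geI: "c \<le> g k x" if "\<And>y. c \<le> f y + real k * dist x y" for c k x
    unfolding g_def by (rule cINF_greatest) (use that in auto)
  have gf: "g k x \<le> f x" for k x using gle[of k x x] by simp
  have lip1: "g k x \<le> g k y + real k * dist x y" for k x y
  proof -
    have "g k x - real k * dist x y \<le> g k y"
    proof (rule geI)
      fix z
      have "real k * dist x z \<le> real k * dist x y + real k * dist y z"
        using mult_left_mono[OF dist_triangle[of x z y], of "real k"] by (simp add: algebra_simps)
      then show "g k x - real k * dist x y \<le> f z + real k * dist y z"
        using gle[of k x z] by linarith
    qed
    then show ?thesis by linarith
  qed
  have lip: "\<bar>g k x - g k y\<bar> \<le> real k * dist x y" for k x y
    using lip1[of k x y] lip1[of k y x] by (simp add: dist_commute abs_le_iff)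
  have lower: "- B \<le> g k x" for k x
  proof (rule geI)
    fix y show "- B \<le> f y + real k * dist x y"
      using B[of y] zero_le_dist[of x y] mult_nonneg_nonneg[of "real k" "dist x y"] by linarith
  qed
  have bnd: "\<bar>g k x\<bar> \<le> B" for k x
    using lower[of k x] gf[of k x] B[of x] by (simp add: abs_le_iff)
  have lim: "(\<lambda>k. g k x) \<longlonglongrightarrow> f x" for x
  proof (rule LIMSEQ_I)
    fix r :: real assume r: "r > 0"
    have "continuous (at x) f" using f by (simp add: continuous_on_eq_continuous_at)
    then obtain d where d: "d > 0" "\<And>y. dist y x < d \<Longrightarrow> dist (f y) (f x) < r / 2"
      using r unfolding continuous_at_eps_delta by (meson half_gt_zero)
    \<comment> \<open>A point \<open>y\<close> at distance at least \<open>d\<close> from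
      \<open>x\<close> pays a penalty above \<open>2 * B\<close>, more than \<open>f\<close> can
      vary, so from \<open>K\<close> on only points near \<open>x\<close> matter.\<close>
    obtain K where K: "real K > 2 * B / d" using reals_Archimedean2 by blast
    show "\<exists>no. \<forall>k\<ge>no. norm (g k x - f x) < r"
    proof (intro exI[of _ K] allI impI)
      fix k assume k: "k \<ge> K"
      have "f x - r / 2 \<le> g k x"
      proof (rule geI)
        fix y
        show "f x - r / 2 \<le> f y + real k * dist x y"
        proof (cases "dist y x < d")
          case True
          have "0 \<le> real k * dist x y" by simp
          then show ?thesis using d(2)[OF True] unfolding dist_real_def by linarith
        next
          case False
          have "2 * B < real K * d" using K d by (simp add: field_simps)
          also have "\<dots> \<le> real k * dist x y"
            using k False d by (intro mult_mono) (auto simp: dist_commute)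
          finally show ?thesis using B[of x] B[of y] r by linarith
        qed
      qed
      then show "norm (g k x - f x) < r" using gf[of k x] r by (simp add: abs_if)
    qed
  qed
  show ?thesis by (rule that[of g]) (use lip bnd gf lim in auto)
qed

lemma lipschitz_continuous_on:
  fixes f :: "'s::metric_space \<Rightarrow> real"
  assumes "\<And>x y. \<bar>f x - f y\<bar> \<le> C * dist x y"
  shows "continuous_on UNIV f"
proof (rule lipschitz_on_continuous_on)
  have "dist (f x) (f y) \<le> max C 0 * dist x y" for x y
    using assms[of x y] mult_right_mono[of C "max C 0" "dist x y"] by (simp add: dist_real_def)
  then show "(max C 0)-lipschitz_on UNIV f"
    by (intro lipschitz_onI) auto
qed

lemma (in prob_space) integrable_continuous_bounded:
  fixes f :: "'s::topological_space \<Rightarrow> real"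
  assumes "continuous_on UNIV f" "\<And>x. \<bar>f x\<bar> \<le> B" "X \<in> borel_measurable M"
  shows "integrable M (\<lambda>\<omega>. f (X \<omega>))"
  using assms borel_measurable_continuous_onI[OF assms(1)]
  by (intro integrable_const_bound[where B = B]) (auto intro: measurable_compose[OF assms(3)])

text \<open>Lipschitz approximation from below gives only a lower bound on the limit inferior; the
  same bound for \<open>- f\<close> supplies the other half. The approximation is integrated to the
  limit under \<open>N\<close> alone, so pointwise convergence with a common bound is
  enough.\<close>

lemma weakly_converges_lipschitz:
  fixes X :: "nat \<Rightarrow> 'a \<Rightarrow> 's::metric_space" and Y :: "'b \<Rightarrow> 's"
  assumes M: "prob_space M" and N: "prob_space N"
    and X: "\<And>n. X n \<in> borel_measurable M" and Y: "Y \<in> borel_measurable N"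
    and lip: "\<And>f C B. (\<And>x y. \<bar>f x - f y\<bar> \<le> C * dist x y) \<Longrightarrow> (\<And>x. \<bar>f x\<bar> \<le> B) \<Longrightarrow>
      (\<lambda>n. LINT \<omega>|M. f (X n \<omega>)) \<longlonglongrightarrow> (LINT \<omega>|N. f (Y \<omega>))"
  shows "weakly_converges M X N Y"
proof -
  interpret M: prob_space M by fact
  interpret N: prob_space N by fact
  have lower: "\<forall>\<^sub>F n in sequentially. (LINT \<omega>|N. f (Y \<omega>)) - e < (LINT \<omega>|M. f (X n \<omega>))"
    if f: "continuous_on UNIV f" and B: "\<And>x. \<bar>f x\<bar> \<le> B" and e: "e > 0" for f :: "'s \<Rightarrow> real" and B e
  proof -
    obtain g where g: "\<And>k x y. \<bar>g k x - g k y\<bar> \<le> real k * dist x y" "\<And>k x. \<bar>g k x\<bar> \<le> B"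
      "\<And>k x. g k x \<le> f x" "\<And>x. (\<lambda>k. g k x) \<longlonglongrightarrow> f x"
      using continuous_limit_of_lipschitz[OF f B] by blast
    have gc: "continuous_on UNIV (g k)" for k by (rule lipschitz_continuous_on[OF g(1)])
    note [measurable] = borel_measurable_continuous_onI[OF gc] borel_measurable_continuous_onI[OF f] X Y
    have "(\<lambda>k. LINT \<omega>|N. g k (Y \<omega>)) \<longlonglongrightarrow> (LINT \<omega>|N. f (Y \<omega>))"
      by (rule integral_dominated_convergence[where w = "\<lambda>_. B"]) (use g in auto)
    then have "\<forall>\<^sub>F k in sequentially. (LINT \<omega>|N. f (Y \<omega>)) - e < (LINT \<omega>|N. g k (Y \<omega>))"
      by (rule order_tendstoD) (use e in simp)
    then obtain k where k: "(LINT \<omega>|N. f (Y \<omega>)) - e < (LINT \<omega>|N. g k (Y \<omega>))"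
      by (auto simp: eventually_sequentially)
    have "(\<lambda>n. LINT \<omega>|M. g k (X n \<omega>)) \<longlonglongrightarrow> (LINT \<omega>|N. g k (Y \<omega>))"
      by (rule lip[OF g(1,2)])
    then have "\<forall>\<^sub>F n in sequentially. (LINT \<omega>|N. f (Y \<omega>)) - e < (LINT \<omega>|M. g k (X n \<omega>))"
      using k by (rule order_tendstoD)
    then show ?thesis
    proof eventually_elim
      case (elim n)
      have "(LINT \<omega>|M. g k (X n \<omega>)) \<le> (LINT \<omega>|M. f (X n \<omega>))"
        by (intro integral_mono M.integrable_continuous_bounded[OF gc g(2)] g(3)
            M.integrable_continuous_bounded[OF f B] X)
      then show ?case using elim by linarith
    qed
  qed
  have "(\<lambda>n. LINT \<omega>|M. f (X n \<omega>)) \<longlonglongrightarrow> (LINT \<omega>|N. f (Y \<omega>))"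
    if f: "continuous_on UNIV f" and bd: "bounded (range f)" for f :: "'s \<Rightarrow> real"
  proof -
    obtain B where B: "\<And>x. \<bar>f x\<bar> \<le> B" using bd by (auto simp: bounded_iff)
    have f': "continuous_on UNIV (\<lambda>x. - f x)" using f by (intro continuous_intros)
    show ?thesis
    proof (rule tendstoI)
      fix e :: real assume e: "e > 0"
      from lower[OF f B e] lower[OF f' _ e, of B]
      show "\<forall>\<^sub>F n in sequentially. dist (LINT \<omega>|M. f (X n \<omega>)) (LINT \<omega>|N. f (Y \<omega>)) < e"
      proof (rule eventually_elim2)
        show "\<And>x. \<bar>- f x\<bar> \<le> B" using B by simp
      qed (auto simp: dist_real_def)
    qed
  qed
  then show ?thesis using X Y unfolding weakly_converges_def by blast
qed

section \<open>Step paths\<close>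

text \<open>Index 0 is overwritten by zero, so every sequence yields a path that starts at 0 and
  \<open>step_path n\<close> is total on sequences.\<close>

definition step_path :: "nat \<Rightarrow> (nat \<Rightarrow> real ^ 'd::finite) \<Rightarrow> 'd cadlag0" where
  "step_path n a = Abs_cadlag0 (\<lambda>t\<in>{0..1}. if nat \<lfloor>real n * t\<rfloor> = 0 then 0 else a (nat \<lfloor>real n * t\<rfloor>))"

lemma path_of_step_path:
  "path_of (step_path n a) =
    (\<lambda>t\<in>{0..1}. if nat \<lfloor>real n * t\<rfloor> = 0 then 0 else a (nat \<lfloor>real n * t\<rfloor>))"
  unfolding step_path_def
  using step_function_cadlag[of "\<lambda>k. if k = 0 then 0 else a k" n]
  by (subst Abs_cadlag0_inverse) auto

text \<open>The identity is an admissible time change.\<close>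

lemma dist_le_uniform:
  fixes x y :: "'d::finite cadlag0"
  assumes "\<And>t. t \<in> {0..1} \<Longrightarrow> norm (path_of x t - path_of y t) \<le> c"
  shows "dist x y \<le> c"
proof -
  have "0 \<le> c" using assms[of 0] norm_ge_zero order_trans by (metis atLeastAtMost_iff order_refl zero_le_one)
  then have "skorokhod_cost (\<lambda>t. t) (path_of x) (path_of y) \<le> c"
    using assms by (subst skorokhod_cost_le_iff[OF id_time_change]) (auto intro: path_props)
  then show ?thesis using cadlag0_dist_le[OF id_time_change, of x y] by linarith
qed

lemma nat_floor_grid:
  assumes "t \<in> {0..1}" shows "nat \<lfloor>real n * t\<rfloor> \<le> n"
proof -
  have "real n * t \<le> real n" using assms mult_left_le[of t "real n"] by auto
  then have "\<lfloor>real n * t\<rfloor> \<le> int n" by (metis floor_mono floor_of_nat)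
  then show ?thesis by linarith
qed

lemma dist_step_path_le:
  assumes "\<And>k. 0 < k \<Longrightarrow> k \<le> n \<Longrightarrow> norm (a k - b k) \<le> c" "0 \<le> c"
  shows "dist (step_path n a) (step_path n b) \<le> c"
  by (rule dist_le_uniform) (use assms nat_floor_grid[of _ n] in \<open>auto simp: path_of_step_path\<close>)

lemma step_path_cong:
  assumes "\<And>j. j \<le> n \<Longrightarrow> a j = b j" shows "step_path n a = step_path n b"
proof -
  have "dist (step_path n a) (step_path n b) \<le> 0" by (rule dist_step_path_le) (simp_all add: assms)
  then show ?thesis by simp
qed

lemma dist_step_path_le_sum:
  "dist (step_path n a) (step_path n b) \<le> (\<Sum>k\<le>n. norm (a k - b k))"
proof (rule dist_step_path_le)
  fix k assume "k \<le> n"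
  then show "norm (a k - b k) \<le> (\<Sum>k\<le>n. norm (a k - b k))"
    by (intro member_le_sum) auto
qed (rule sum_nonneg, simp)

text \<open>Sequences carry the product topology, and only the coordinates up to \<open>n\<close>
  matter. Continuity makes \<open>step_path n\<close> Borel measurable and so reduces measurability
  of random step paths to that of their values; the Borel sets of the Skorokhod metric need no
  description.\<close>

lemma continuous_step_path: "continuous_on UNIV (step_path n :: _ \<Rightarrow> 'd::finite cadlag0)"
  unfolding continuous_on_def
proof safe
  fix a :: "nat \<Rightarrow> real ^ 'd"
  have "((\<lambda>b. \<Sum>k\<le>n. norm (a k - b k)) \<longlongrightarrow> (\<Sum>k\<le>n. norm (a k - a k))) (at a)"
  proof (intro tendsto_intros)
    fix k
    have "continuous_on UNIV (\<lambda>x :: nat \<Rightarrow> real ^ 'd. x k)" by (rule continuous_on_product_coordinates)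
    then show "((\<lambda>x. x k) \<longlongrightarrow> a k) (at a)" by (simp add: continuous_on_def)
  qed
  then have "((\<lambda>b. \<Sum>k\<le>n. norm (a k - b k)) \<longlongrightarrow> 0) (at a)" by simp
  then have "((\<lambda>b. dist (step_path n a) (step_path n b)) \<longlongrightarrow> 0) (at a)"
    by (rule Lim_null_comparison[rotated]) (auto intro!: always_eventually dist_step_path_le_sum)
  then show "(step_path n \<longlongrightarrow> step_path n a) (at a)"
    by (subst tendsto_dist_iff) (simp add: dist_commute)
qed

lemma measurable_step_path:
  fixes a :: "'a \<Rightarrow> nat \<Rightarrow> real ^ 'd::finite"
  assumes "\<And>k. (\<lambda>\<omega>. a \<omega> k) \<in> borel_measurable M"
  shows "(\<lambda>\<omega>. step_path n (a \<omega>)) \<in> borel_measurable M"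
  by (rule measurable_compose[OF measurable_coordinatewise_then_product
        borel_measurable_continuous_onI[OF continuous_step_path]]) (rule assms)

lemma centre_of_mass_path_eq_step_path:
  "centre_of_mass_path \<xi> n \<omega> = step_path n (\<lambda>k. (1 / sqrt (real n)) *\<^sub>R centre_of_mass \<xi> k \<omega>)"
proof -
  have "path_of (centre_of_mass_path \<xi> n \<omega>) =
      path_of (step_path n (\<lambda>k. (1 / sqrt (real n)) *\<^sub>R centre_of_mass \<xi> k \<omega>))"
    unfolding path_of_centre_of_mass_path path_of_step_path
    by (intro arg_cong2[where f = restrict] ext refl) (simp add: centre_of_mass_def)
  then show ?thesis by (simp add: path_of_inject)
qed

section \<open>Convergence of characteristic functions in finite dimensions\<close>

definition linear_form :: "'i set \<Rightarrow> ('i \<Rightarrow> real) \<Rightarrow> ('i \<Rightarrow> real) \<Rightarrow> real" where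
  "linear_form A u x = (\<Sum>i\<in>A. u i * x i)"

lemma abs_sin_diff_le: "\<bar>sin x - x\<bar> \<le> (x::real)\<^sup>2"
proof -
  have "\<bar>sin x - x\<bar> \<le> inverse (fact 2) * \<bar>x\<bar> ^ 2"
    using Maclaurin_sin_bound[of x 2] by (simp add: numeral_2_eq_2 sin_coeff_def)
  also have "\<dots> \<le> x\<^sup>2" by (simp add: fact_numeral)
  finally show ?thesis .
qed

lemma abs_integral_diff_le:
  fixes f g h :: "'a \<Rightarrow> real"
  assumes "integrable M f" "integrable M g" "integrable M h" "\<And>\<omega>. \<bar>f \<omega> - g \<omega>\<bar> \<le> h \<omega>"
  shows "\<bar>(LINT \<omega>|M. f \<omega>) - (LINT \<omega>|M. g \<omega>)\<bar> \<le> (LINT \<omega>|M. h \<omega>)"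
proof -
  have "\<bar>LINT \<omega>|M. f \<omega> - g \<omega>\<bar> \<le> (LINT \<omega>|M. \<bar>f \<omega> - g \<omega>\<bar>)" by (rule integral_abs_bound)
  also have "\<dots> \<le> (LINT \<omega>|M. h \<omega>)"
    using assms by (intro integral_mono integrable_abs Bochner_Integration.integrable_diff)
  finally show ?thesis using assms by simp
qed

text \<open>\<open>L * sin (x / L)\<close> serves as a bounded truncation of \<open>x\<close>. The
  error is stated quadratically in \<open>x\<close> because second moments then control it.\<close>

lemma sin_rescaled_le:
  fixes x L :: real
  assumes "L > 0"
  shows "\<bar>x - L * sin (x / L)\<bar> \<le> x\<^sup>2 / L"
proof -
  have "\<bar>x - L * sin (x / L)\<bar> = L * \<bar>sin (x / L) - x / L\<bar>"
  proof -
    have "x - L * sin (x / L) = - (L * (sin (x / L) - x / L))"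
      using assms by (simp add: right_diff_distrib)
    then show ?thesis using assms by (simp only: abs_minus_cancel abs_mult abs_of_pos)
  qed
  also have "\<dots> \<le> L * (x / L)\<^sup>2"
    using assms by (intro mult_left_mono abs_sin_diff_le) auto
  also have "\<dots> = x\<^sup>2 / L" using assms by (simp add: power2_eq_square)
  finally show ?thesis .
qed

lemma sin_eq_cis: "complex_of_real (sin y) = (cis y - cis (- y)) / (2 * \<i>)"
  by (simp add: complex_eq_iff Re_divide Im_divide power2_eq_square)

lemma compact_cube: "compact {x :: 'i \<Rightarrow> real. \<forall>i. x i \<in> {-1..1}}"
proof -
  have "compactin (product_topology (\<lambda>_. euclidean) UNIV) (PiE UNIV (\<lambda>_ :: 'i. {-1..1::real}))"
    by (subst compactin_PiE) auto
  moreover have "PiE UNIV (\<lambda>_ :: 'i. {-1..1::real}) = {x. \<forall>i. x i \<in> {-1..1}}"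
    by (auto simp: PiE_def Pi_def)
  ultimately show ?thesis by (simp add: euclidean_product_topology)
qed

text \<open>Setting of a multivariate continuity theorem for characteristic functions.
  \<open>A\<close> holds the finitely many coordinates that matter; countability of the index type
  turns coordinatewise measurability into Borel measurability for the product topology.\<close>

locale cf_convergence = M: prob_space M + N: prob_space N
  for M :: "'a measure" and N :: "'b measure" +
  fixes X :: "nat \<Rightarrow> 'a \<Rightarrow> 'i::countable \<Rightarrow> real" and Y :: "'b \<Rightarrow> 'i \<Rightarrow> real" and A :: "'i set"
  assumes finite_A: "finite A"
    and X_meas [measurable]: "\<And>n i. (\<lambda>\<omega>. X n \<omega> i) \<in> borel_measurable M"
    and Y_meas [measurable]: "\<And>i. (\<lambda>\<omega>. Y \<omega> i) \<in> borel_measurable N"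
    and cf: "\<And>u. (\<lambda>n. LINT \<omega>|M. cis (linear_form A u (X n \<omega>))) \<longlonglongrightarrow>
                  (LINT \<omega>|N. cis (linear_form A u (Y \<omega>)))"
begin

text \<open>Convergence is demanded after multiplication by every character: the case
  \<open>u = 0\<close> alone would not be inherited by products with characters.\<close>

definition test_fun :: "(('i \<Rightarrow> real) \<Rightarrow> complex) \<Rightarrow> bool" where
  "test_fun h \<longleftrightarrow> h \<in> borel_measurable borel \<and> bounded (range h) \<and>
     (\<forall>u. (\<lambda>n. LINT \<omega>|M. h (X n \<omega>) * cis (linear_form A u (X n \<omega>))) \<longlonglongrightarrow>
          (LINT \<omega>|N. h (Y \<omega>) * cis (linear_form A u (Y \<omega>))))"

lemma measurable_linear_form [measurable]: "linear_form A u \<in> borel_measurable borel"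
proof -
  have "continuous_on UNIV (linear_form A u)"
    unfolding linear_form_def
    by (intro continuous_intros continuous_on_product_coordinates)
  then show ?thesis by (rule borel_measurable_continuous_onI)
qed

lemma measurable_XY [measurable]:
  "X n \<in> borel_measurable M" "Y \<in> borel_measurable N"
  by (intro measurable_coordinatewise_then_product; measurable)+

lemma measurable_cis [measurable]: "cis \<in> borel_measurable borel"
  by (intro borel_measurable_continuous_onI continuous_on_cis continuous_on_id)

lemma test_fun_integrable:
  assumes "h \<in> borel_measurable borel" "bounded (range h)"
  shows "integrable M (\<lambda>\<omega>. h (X n \<omega>) * cis (linear_form A u (X n \<omega>)))"
    and "integrable N (\<lambda>\<omega>. h (Y \<omega>) * cis (linear_form A u (Y \<omega>)))"
proof -
  obtain B where B: "\<And>x. norm (h x) \<le> B" using assms(2) by (auto simp: bounded_iff)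
  note [measurable] = assms(1)
  show "integrable M (\<lambda>\<omega>. h (X n \<omega>) * cis (linear_form A u (X n \<omega>)))"
    by (rule M.integrable_const_bound[where B = B]) (use B in \<open>auto simp: norm_mult\<close>)
  show "integrable N (\<lambda>\<omega>. h (Y \<omega>) * cis (linear_form A u (Y \<omega>)))"
    by (rule N.integrable_const_bound[where B = B]) (use B in \<open>auto simp: norm_mult\<close>)
qed

lemma test_fun_one: "test_fun (\<lambda>_. 1)"
  using cf by (simp add: test_fun_def)

lemma test_fun_scale:
  assumes "test_fun h" shows "test_fun (\<lambda>x. c * h x)"
  unfolding test_fun_def
proof (intro conjI allI)
  show "(\<lambda>x. c * h x) \<in> borel_measurable borel" using assms by (auto simp: test_fun_def)
  obtain B where B: "\<And>x. norm (h x) \<le> B" using assms by (auto simp: bounded_iff test_fun_def)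
  show "bounded (range (\<lambda>x. c * h x))"
    unfolding bounded_iff by (intro exI[of _ "norm c * B"]) (auto simp: norm_mult B mult_left_mono)
  fix u
  show "(\<lambda>n. LINT \<omega>|M. c * h (X n \<omega>) * cis (linear_form A u (X n \<omega>))) \<longlonglongrightarrow>
          (LINT \<omega>|N. c * h (Y \<omega>) * cis (linear_form A u (Y \<omega>)))"
    using assms unfolding mult.assoc integral_mult_right_zero
    by (intro tendsto_mult_left) (auto simp: test_fun_def)
qed

lemma test_fun_add:
  assumes "test_fun h" "test_fun k" shows "test_fun (\<lambda>x. h x + k x)"
  unfolding test_fun_def
proof (intro conjI allI)
  show "(\<lambda>x. h x + k x) \<in> borel_measurable borel" using assms by (auto simp: test_fun_def)
  show "bounded (range (\<lambda>x. h x + k x))" using assms by (auto simp: test_fun_def intro: bounded_plus_comp)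
  fix u
  have *: "h \<in> borel_measurable borel" "bounded (range h)" "k \<in> borel_measurable borel" "bounded (range k)"
    using assms by (auto simp: test_fun_def)
  note tendsto_add[OF assms[unfolded test_fun_def, THEN conjunct2, THEN conjunct2, THEN spec, of u]]
  then show "(\<lambda>n. LINT \<omega>|M. (h (X n \<omega>) + k (X n \<omega>)) * cis (linear_form A u (X n \<omega>))) \<longlonglongrightarrow>
          (LINT \<omega>|N. (h (Y \<omega>) + k (Y \<omega>)) * cis (linear_form A u (Y \<omega>)))"
    by (simp only: distrib_right Bochner_Integration.integral_add[OF test_fun_integrable(1)[OF *(1,2)] test_fun_integrable(1)[OF *(3,4)]]
        Bochner_Integration.integral_add[OF test_fun_integrable(2)[OF *(1,2)] test_fun_integrable(2)[OF *(3,4)]])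
qed

lemma test_fun_shift:
  assumes "test_fun h" shows "test_fun (\<lambda>x. h x * cis (linear_form A v x))"
  unfolding test_fun_def
proof (intro conjI allI)
  have *: "h \<in> borel_measurable borel" "bounded (range h)" using assms by (auto simp: test_fun_def)
  then show "(\<lambda>x. h x * cis (linear_form A v x)) \<in> borel_measurable borel" by measurable
  show "bounded (range (\<lambda>x. h x * cis (linear_form A v x)))" using *(2) by (auto simp: bounded_iff norm_mult)
  fix u
  have eq: "h x * cis (linear_form A v x) * cis (linear_form A u x) = h x * cis (linear_form A (\<lambda>i. v i + u i) x)" for x
    by (simp add: mult.assoc cis_mult linear_form_def sum.distrib distrib_right)
  then show "(\<lambda>n. LINT \<omega>|M. h (X n \<omega>) * cis (linear_form A v (X n \<omega>)) * cis (linear_form A u (X n \<omega>))) \<longlonglongrightarrow>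
          (LINT \<omega>|N. h (Y \<omega>) * cis (linear_form A v (Y \<omega>)) * cis (linear_form A u (Y \<omega>)))"
    using assms by (simp only: eq test_fun_def)
qed

text \<open>By Euler's formula, multiplication by a sine is a linear combination of multiplications
  by two characters.\<close>

lemma test_fun_sin:
  assumes "test_fun h" "i \<in> A"
  shows "test_fun (\<lambda>x. complex_of_real (sin (x i / L)) * h x)"
proof -
  have lf: "linear_form A (\<lambda>j. if j = i then c else 0) x = c * x i" for c and x :: "'i \<Rightarrow> real"
  proof -
    have "linear_form A (\<lambda>j. if j = i then c else 0) x = (\<Sum>j\<in>A. if j = i then c * x i else 0)"
      unfolding linear_form_def by (rule sum.cong) auto
    then show ?thesis using assms(2) finite_A by simp
  qed
  have "test_fun (\<lambda>x. 1 / (2 * \<i>) * (h x * cis (linear_form A (\<lambda>j. if j = i then 1 / L else 0) x))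
      + (- 1 / (2 * \<i>)) * (h x * cis (linear_form A (\<lambda>j. if j = i then - 1 / L else 0) x)))"
    by (intro test_fun_add test_fun_scale test_fun_shift assms(1))
  moreover have "1 / (2 * \<i>) * (h x * cis (1 / L * x i)) + (- 1 / (2 * \<i>)) * (h x * cis (- 1 / L * x i))
      = complex_of_real (sin (x i / L)) * h x" for x
    unfolding sin_eq_cis by (simp add: algebra_simps diff_divide_distrib)
  ultimately show ?thesis unfolding lf by simp
qed

text \<open>Multiplication by \<open>g\<close> preserves \<^term>\<open>test_fun\<close>: functions \<open>g\<close> with this property form an
  algebra, although products of test functions need not be test functions.\<close>

definition multiplier :: "(('i \<Rightarrow> real) \<Rightarrow> real) \<Rightarrow> bool" where
  "multiplier g \<longleftrightarrow> (\<forall>h. test_fun h \<longrightarrow> test_fun (\<lambda>x. complex_of_real (g x) * h x))"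

lemma multiplierI: "(\<And>h. test_fun h \<Longrightarrow> test_fun (\<lambda>x. complex_of_real (g x) * h x)) \<Longrightarrow> multiplier g"
  unfolding multiplier_def by blast

lemma multiplierD: "multiplier g \<Longrightarrow> test_fun h \<Longrightarrow> test_fun (\<lambda>x. complex_of_real (g x) * h x)"
  unfolding multiplier_def by blast

lemma multiplier_add:
  assumes "multiplier f" "multiplier g" shows "multiplier (\<lambda>x. f x + g x)"
proof (rule multiplierI)
  fix h assume "test_fun h"
  from test_fun_add[OF multiplierD[OF assms(1) this] multiplierD[OF assms(2) this]]
  show "test_fun (\<lambda>x. complex_of_real (f x + g x) * h x)" by (simp only: of_real_add distrib_right)
qed

lemma multiplier_mult:
  assumes "multiplier f" "multiplier g" shows "multiplier (\<lambda>x. f x * g x)"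
proof (rule multiplierI)
  fix h assume "test_fun h"
  from multiplierD[OF assms(1) multiplierD[OF assms(2) this]]
  show "test_fun (\<lambda>x. complex_of_real (f x * g x) * h x)" by (simp only: of_real_mult mult.assoc)
qed

lemma multiplier_const: "multiplier (\<lambda>_. c)"
  by (rule multiplierI) (rule test_fun_scale)

lemma multiplier_sin: "i \<in> A \<Longrightarrow> multiplier (\<lambda>x. sin (x i / L))"
  by (rule multiplierI) (rule test_fun_sin)

text \<open>Apply the multiplier to the constant test function 1 and read off the trivial
  character.\<close>

lemma multiplier_convergence:
  assumes "multiplier g"
  shows "(\<lambda>n. LINT \<omega>|M. g (X n \<omega>)) \<longlonglongrightarrow> (LINT \<omega>|N. g (Y \<omega>))"
proof -
  have "test_fun (\<lambda>x. complex_of_real (g x) * 1)"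
    using assms test_fun_one unfolding multiplier_def by blast
  then have "test_fun (\<lambda>x. complex_of_real (g x))" by simp
  note this[unfolded test_fun_def, THEN conjunct2, THEN conjunct2, THEN spec, of "\<lambda>_. 0"]
  moreover have "linear_form A (\<lambda>_. 0) x = 0" for x by (simp add: linear_form_def)
  ultimately show ?thesis
    by (simp only: cis_zero mult_1_right integral_complex_of_real tendsto_of_real_iff)
qed

text \<open>Composition with \<open>x \<mapsto> L sin (x / L)\<close> turns a function on the cube, which Stone--Weierstrass
  approximates by polynomials, into a bounded function approximated uniformly by trigonometric
  polynomials.\<close>

lemma sin_convergence:
  fixes F :: "('i \<Rightarrow> real) \<Rightarrow> real"
  assumes F: "continuous_on UNIV F" and FA: "\<And>x y. (\<And>i. i \<in> A \<Longrightarrow> x i = y i) \<Longrightarrow> F x = F y"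
    and bnd: "\<And>x. \<bar>F x\<bar> \<le> B"
  shows "(\<lambda>n. LINT \<omega>|M. F (\<lambda>i. L * sin (X n \<omega> i / L))) \<longlonglongrightarrow> (LINT \<omega>|N. F (\<lambda>i. L * sin (Y \<omega> i / L)))"
proof -
  \<comment> \<open>Coordinates outside \<open>A\<close> are pinned to 0: only sines of coordinates
    in \<open>A\<close> are known to be multipliers, so only these coordinates can separate points
    of \<open>S\<close>.\<close>
  define S where "S = {x :: 'i \<Rightarrow> real. \<forall>i. x i \<in> {-1..1}} \<inter> {x. \<forall>i. i \<notin> A \<longrightarrow> x i = 0}"
  \<comment> \<open>The algebra given to Stone-Weierstrass consists of all continuous functions that
    become multipliers after the substitution, so polynomials need not be written out.\<close>
  define R where "R = {g :: ('i \<Rightarrow> real) \<Rightarrow> real. continuous_on UNIV g \<and> multiplier (\<lambda>x. g (\<lambda>i. if i \<in> A then sin (x i / L) else 0))}"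
  have closed: "closed {x :: 'i \<Rightarrow> real. \<forall>i. i \<notin> A \<longrightarrow> x i = 0}"
  proof -
    have "closed {x :: 'i \<Rightarrow> real. x i = 0}" for i
      using closed_Collect_eq[OF continuous_on_product_coordinates[of i] continuous_on_const[of UNIV 0]] by simp
    then have "closed (\<Inter>i\<in>-A. {x :: 'i \<Rightarrow> real. x i = 0})" by blast
    moreover have "(\<Inter>i\<in>-A. {x :: 'i \<Rightarrow> real. x i = 0}) = {x. \<forall>i. i \<notin> A \<longrightarrow> x i = 0}" by auto
    ultimately show ?thesis by simp
  qed
  have ring: "function_ring_on R S"
  proof (rule function_ring_on.intro)
    show "compact S" unfolding S_def by (intro compact_Int_closed compact_cube closed)
    fix x y assume "x \<in> S" "y \<in> S" "x \<noteq> y"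
    obtain i where i: "x i \<noteq> y i" using \<open>x \<noteq> y\<close> by blast
    then have "i \<in> A" using \<open>x \<in> S\<close> \<open>y \<in> S\<close> unfolding S_def by (metis (mono_tags, lifting) IntD2 mem_Collect_eq)
    with i show "\<exists>f\<in>R. f x \<noteq> f y"
      by (intro bexI[of _ "\<lambda>x. x i"]) (simp_all add: R_def multiplier_sin continuous_on_product_coordinates)
  next
    fix f assume f: "f \<in> R"
    then show "continuous_on S f" by (auto simp: R_def intro: continuous_on_subset)
    fix g assume "g \<in> R"
    with f show "(\<lambda>x. f x + g x) \<in> R" "(\<lambda>x. f x * g x) \<in> R"
      by (auto simp: R_def multiplier_add multiplier_mult continuous_on_add continuous_on_mult)
  next
    fix c show "(\<lambda>_. c) \<in> R" by (simp add: R_def multiplier_const)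
  qed
  let ?s = "\<lambda>x i. if i \<in> A then sin (x i / L) else 0"
  have sS: "?s x \<in> S" for x :: "'i \<Rightarrow> real" by (auto simp: S_def)
  let ?G = "\<lambda>x :: 'i \<Rightarrow> real. F (\<lambda>i. L * x i)"
  have cG: "continuous_on UNIV ?G"
    by (rule continuous_on_compose2[OF F])
      (auto intro!: continuous_on_coordinatewise_then_product continuous_intros continuous_on_product_coordinates)
  have Gs: "F (\<lambda>i. L * sin (x i / L)) = ?G (?s x)" for x
    by (rule FA) simp
  obtain P where P: "\<And>k. P k \<in> R" "uniform_limit S P ?G sequentially"
    using function_ring_on.Stone_Weierstrass[OF ring continuous_on_subset[OF cG]] by blast
  have cs: "continuous_on UNIV ?s"
  proof (rule continuous_on_coordinatewise_then_product)
    fix i show "continuous_on UNIV (\<lambda>x. ?s x i)"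
      by (cases "i \<in> A") (auto intro!: continuous_intros continuous_on_product_coordinates simp: divide_inverse)
  qed
  show ?thesis
  proof (rule tendstoI)
    fix e :: real assume e: "e > 0"
    from uniform_limitD[OF P(2), of "e / 3"] e
    obtain k where k: "\<And>x. x \<in> S \<Longrightarrow> dist (P k x) (?G x) < e / 3" by (auto simp: eventually_sequentially)
    have d: "\<bar>P k (?s x) - F (\<lambda>i. L * sin (x i / L))\<bar> \<le> e / 3" for x
      using k[OF sS[of x]] unfolding Gs by (simp add: dist_real_def)
    have cP: "continuous_on UNIV (\<lambda>x. P k (?s x))"
      by (rule continuous_on_compose2[OF _ cs]) (use P(1)[of k] in \<open>auto simp: R_def\<close>)
    have cF: "continuous_on UNIV (\<lambda>x. F (\<lambda>i. L * sin (x i / L)))"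
      unfolding Gs by (rule continuous_on_compose2[OF cG cs]) auto
    have bP: "\<bar>P k (?s x)\<bar> \<le> B + e" for x using d[of x] bnd[of "\<lambda>i. L * sin (x i / L)"] e by linarith
    note iM = M.integrable_continuous_bounded[OF cP bP] M.integrable_continuous_bounded[OF cF bnd]
    note iN = N.integrable_continuous_bounded[OF cP bP] N.integrable_continuous_bounded[OF cF bnd]
    have dM: "\<bar>(LINT \<omega>|M. P k (?s (X n \<omega>))) - (LINT \<omega>|M. F (\<lambda>i. L * sin (X n \<omega> i / L)))\<bar> \<le> e / 3" for n
      using abs_integral_diff_le[OF iM(1)[OF measurable_XY(1)] iM(2)[OF measurable_XY(1)] M.integrable_const d] by (simp add: M.prob_space)
    have dN: "\<bar>(LINT \<omega>|N. P k (?s (Y \<omega>))) - (LINT \<omega>|N. F (\<lambda>i. L * sin (Y \<omega> i / L)))\<bar> \<le> e / 3"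
      using abs_integral_diff_le[OF iN(1)[OF measurable_XY(2)] iN(2)[OF measurable_XY(2)] N.integrable_const d] by (simp add: N.prob_space)
    have "(\<lambda>n. LINT \<omega>|M. P k (?s (X n \<omega>))) \<longlonglongrightarrow> (LINT \<omega>|N. P k (?s (Y \<omega>)))"
      by (rule multiplier_convergence) (use P(1)[of k] in \<open>auto simp: R_def\<close>)
    then have "\<forall>\<^sub>F n in sequentially. dist (LINT \<omega>|M. P k (?s (X n \<omega>))) (LINT \<omega>|N. P k (?s (Y \<omega>))) < e / 3"
      by (rule tendstoD) (use e in simp)
    then show "\<forall>\<^sub>F n in sequentially. dist (LINT \<omega>|M. F (\<lambda>i. L * sin (X n \<omega> i / L)))
        (LINT \<omega>|N. F (\<lambda>i. L * sin (Y \<omega> i / L))) < e"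
    proof eventually_elim
      case (elim n)
      then show ?case using dM[of n] dN unfolding dist_real_def by linarith
    qed
  qed
qed

text \<open>Removes the truncation from \<open>sin_convergence\<close>. Replacing each coordinate by
  \<open>L * sin (x / L)\<close> changes the expectation by at most a constant over
  \<open>L\<close>, uniformly in \<open>n\<close>, thanks to the common bound \<open>D\<close>; this
  takes the place of tightness in finite dimensions.\<close>

lemma lipschitz_convergence:
  fixes F :: "('i \<Rightarrow> real) \<Rightarrow> real"
  assumes lip: "\<And>x y. \<bar>F x - F y\<bar> \<le> C * (\<Sum>i\<in>A. \<bar>x i - y i\<bar>)" and C: "0 \<le> C"
    and bnd: "\<And>x. \<bar>F x\<bar> \<le> B"
    and X2: "\<And>n i. i \<in> A \<Longrightarrow> integrable M (\<lambda>\<omega>. (X n \<omega> i)\<^sup>2)"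
      "\<And>n i. i \<in> A \<Longrightarrow> (LINT \<omega>|M. (X n \<omega> i)\<^sup>2) \<le> D"
    and Y2: "\<And>i. i \<in> A \<Longrightarrow> integrable N (\<lambda>\<omega>. (Y \<omega> i)\<^sup>2)" "\<And>i. i \<in> A \<Longrightarrow> (LINT \<omega>|N. (Y \<omega> i)\<^sup>2) \<le> D"
  shows "(\<lambda>n. LINT \<omega>|M. F (X n \<omega>)) \<longlonglongrightarrow> (LINT \<omega>|N. F (Y \<omega>))"
proof -
  have F: "continuous_on UNIV F"
    unfolding continuous_on_def
  proof safe
    fix a :: "'i \<Rightarrow> real"
    have "((\<lambda>b. C * (\<Sum>i\<in>A. \<bar>b i - a i\<bar>)) \<longlongrightarrow> C * (\<Sum>i\<in>A. \<bar>a i - a i\<bar>)) (at a)"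
    proof (intro tendsto_intros)
      fix k
      have "continuous_on UNIV (\<lambda>x :: 'i \<Rightarrow> real. x k)" by (rule continuous_on_product_coordinates)
      then show "((\<lambda>x. x k) \<longlongrightarrow> a k) (at a)" by (simp add: continuous_on_def)
    qed
    then have "((\<lambda>b. C * (\<Sum>i\<in>A. \<bar>b i - a i\<bar>)) \<longlongrightarrow> 0) (at a)" by simp
    then have "((\<lambda>b. F b - F a) \<longlongrightarrow> 0) (at a)"
      by (rule Lim_null_comparison[rotated]) (auto intro!: always_eventually lip)
    then show "(F \<longlongrightarrow> F a) (at a)" by (rule LIM_zero_cancel)
  qed
  have FA: "F x = F y" if "\<And>i. i \<in> A \<Longrightarrow> x i = y i" for x y
    using lip[of x y] that by simp
  \<comment> \<open>The sign of \<open>D\<close> comes from a second moment below it, hence only if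
    \<open>A\<close> has an element; for empty \<open>A\<close> the factor \<open>card A\<close> is
    0.\<close>
  have D: "0 \<le> D \<or> A = {}"
    using Y2(2) integral_nonneg_AE[of "\<lambda>\<omega>. (Y \<omega> _)\<^sup>2" N] by (metis (no_types, lifting) AE_I2 all_not_in_conv order_trans zero_le_power2)
  have d: "\<bar>F x - F (\<lambda>i. L * sin (x i / L))\<bar> \<le> (C / L) * (\<Sum>i\<in>A. (x i)\<^sup>2)" if "L > 0" for L x
  proof -
    have "\<bar>F x - F (\<lambda>i. L * sin (x i / L))\<bar> \<le> C * (\<Sum>i\<in>A. (x i)\<^sup>2 / L)"
      using sin_rescaled_le[OF that] C by (intro order_trans[OF lip] mult_left_mono sum_mono) auto
    then show ?thesis by (simp add: sum_divide_distrib[symmetric])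
  qed
  have cF: "continuous_on UNIV (\<lambda>x. F (\<lambda>i. L * sin (x i / L)))" for L
    by (rule continuous_on_compose2[OF F])
      (auto intro!: continuous_on_coordinatewise_then_product continuous_intros continuous_on_product_coordinates simp: divide_inverse)
  note i = M.integrable_continuous_bounded[OF F bnd] M.integrable_continuous_bounded[OF cF bnd]
     N.integrable_continuous_bounded[OF F bnd] N.integrable_continuous_bounded[OF cF bnd]
  have dM: "\<bar>(LINT \<omega>|M. F (X n \<omega>)) - (LINT \<omega>|M. F (\<lambda>i. L * sin (X n \<omega> i / L)))\<bar> \<le> (C / L) * (card A * D)" if L: "L > 0" for n L
  proof -
    have "\<bar>(LINT \<omega>|M. F (X n \<omega>)) - (LINT \<omega>|M. F (\<lambda>i. L * sin (X n \<omega> i / L)))\<bar> \<le> (LINT \<omega>|M. (C / L) * (\<Sum>i\<in>A. (X n \<omega> i)\<^sup>2))"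
      by (rule abs_integral_diff_le[OF i(1)[OF measurable_XY(1)] i(2)[OF measurable_XY(1)] _ d[OF L]])
        (intro integrable_mult_right Bochner_Integration.integrable_sum X2)
    also have "\<dots> = (C / L) * (\<Sum>i\<in>A. LINT \<omega>|M. (X n \<omega> i)\<^sup>2)"
      by (simp add: X2)
    also have "\<dots> \<le> (C / L) * (card A * D)"
      using X2(2) C L by (intro mult_left_mono sum_bounded_above) auto
    finally show ?thesis .
  qed
  have dN: "\<bar>(LINT \<omega>|N. F (Y \<omega>)) - (LINT \<omega>|N. F (\<lambda>i. L * sin (Y \<omega> i / L)))\<bar> \<le> (C / L) * (card A * D)" if L: "L > 0" for L
  proof -
    have "\<bar>(LINT \<omega>|N. F (Y \<omega>)) - (LINT \<omega>|N. F (\<lambda>i. L * sin (Y \<omega> i / L)))\<bar> \<le> (LINT \<omega>|N. (C / L) * (\<Sum>i\<in>A. (Y \<omega> i)\<^sup>2))"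
      by (rule abs_integral_diff_le[OF i(3)[OF measurable_XY(2)] i(4)[OF measurable_XY(2)] _ d[OF L]])
        (intro integrable_mult_right Bochner_Integration.integrable_sum Y2)
    also have "\<dots> = (C / L) * (\<Sum>i\<in>A. LINT \<omega>|N. (Y \<omega> i)\<^sup>2)"
      by (simp add: Y2)
    also have "\<dots> \<le> (C / L) * (card A * D)"
      using Y2(2) C L by (intro mult_left_mono sum_bounded_above) auto
    finally show ?thesis .
  qed
  show ?thesis
  proof (rule tendstoI)
    fix e :: real assume e: "e > 0"
    define c where "c = C * (card A * D)"
    have c: "0 \<le> c" using C D by (auto simp: c_def)
    \<comment> \<open>Chosen so that \<open>c / L < e / 3\<close>; the added 1 keeps
      \<open>L\<close> positive when \<open>c = 0\<close>.\<close>
    define L where "L = (3 * c + 1) / e"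
    have L: "L > 0" using c e by (simp add: L_def)
    have "(C / L) * (card A * D) = c / L" by (simp add: c_def)
    also have "\<dots> < e / 3" using c e by (simp add: L_def field_simps)
    finally have small: "(C / L) * (card A * D) < e / 3" .
    have "\<forall>\<^sub>F n in sequentially. dist (LINT \<omega>|M. F (\<lambda>i. L * sin (X n \<omega> i / L)))
        (LINT \<omega>|N. F (\<lambda>i. L * sin (Y \<omega> i / L))) < e / 3"
      by (rule tendstoD[OF sin_convergence[OF F FA bnd]]) (use e in simp_all)
    then show "\<forall>\<^sub>F n in sequentially. dist (LINT \<omega>|M. F (X n \<omega>)) (LINT \<omega>|N. F (Y \<omega>)) < e"
    proof eventually_elim
      case (elim n)
      then show ?case using dM[OF L, of n] dN[OF L] small unfolding dist_real_def by linarith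
    qed
  qed
qed

end

section \<open>Linear statistics of i.i.d. vectors\<close>

lemma measurable_vec_nth: "(\<lambda>x :: real ^ 'n. x $ i) \<in> borel_measurable borel"
  by (intro borel_measurable_continuous_onI continuous_intros)

lemma bounded_linear_axis: "bounded_linear (axis i :: 'b::euclidean_space \<Rightarrow> 'b ^ 'n::finite)"
  unfolding linear_conv_bounded_linear[symmetric] by (rule linearI) (auto simp: vec_eq_iff axis_def)

lemma integrable_vec:
  fixes f :: "'a \<Rightarrow> 'b::euclidean_space ^ 'n::finite"
  assumes "\<And>i. integrable M (\<lambda>\<omega>. f \<omega> $ i)"
  shows "integrable M f"
proof -
  have "f = (\<lambda>\<omega>. \<Sum>i\<in>UNIV. axis i (f \<omega> $ i))"
    by (simp add: fun_eq_iff vec_eq_iff axis_def)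
  moreover have "integrable M (\<lambda>\<omega>. \<Sum>i\<in>UNIV. axis i (f \<omega> $ i))"
    by (intro Bochner_Integration.integrable_sum integrable_bounded_linear[OF bounded_linear_axis] assms)
  ultimately show ?thesis by simp
qed

lemma integral_vec_nth:
  fixes f :: "'a \<Rightarrow> 'b::euclidean_space ^ 'n::finite"
  assumes "\<And>i. integrable M (\<lambda>\<omega>. f \<omega> $ i)"
  shows "(LINT \<omega>|M. f \<omega>) $ i = (LINT \<omega>|M. f \<omega> $ i)"
  by (rule integral_bounded_linear[OF bounded_linear_vec_nth integrable_vec[OF assms], symmetric])

lemma inner_sq_le: "(v \<bullet> x)\<^sup>2 \<le> (norm v)\<^sup>2 * (norm x)\<^sup>2" for v x :: "real ^ 'd"
  using power_mono[OF Cauchy_Schwarz_ineq2[of v x], of 2] by (simp add: power_mult_distrib)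

lemma exp_minus_approx: "\<bar>exp (- x) - (1 - x)\<bar> \<le> x\<^sup>2" if "0 \<le> x" for x :: real
proof -
  have "1 - x \<le> exp (- x)" using exp_ge_add_one_self[of "- x"] by simp
  moreover have "exp (- x) \<le> 1 - x + x\<^sup>2"
  proof -
    have "exp (- x) * (1 + x) \<le> exp (- x) * exp x"
      using exp_ge_add_one_self[of x] by (intro mult_left_mono) auto
    also have "\<dots> = 1" by (simp add: exp_minus)
    also have "1 \<le> (1 - x + x\<^sup>2) * (1 + x)"
    proof -
      have "(1 - x + x\<^sup>2) * (1 + x) = 1 + x ^ 3" by (simp add: algebra_simps power2_eq_square power3_eq_cube)
      then show ?thesis using that by simp
    qed
    finally show ?thesis using that by simp
  qed
  ultimately show ?thesis by (simp add: abs_if)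
qed

locale centred_iid = prob_space M for M :: "'a measure" +
  fixes \<xi> :: "nat \<Rightarrow> 'a \<Rightarrow> real ^ 'd::finite" and \<Sigma> :: "real ^ 'd ^ 'd"
  assumes indep: "indep_vars (\<lambda>_. borel) \<xi> UNIV"
    and ident: "\<And>i. distr M borel (\<xi> i) = distr M borel (\<xi> 0)"
    and mean: "(LINT \<omega>|M. \<xi> 0 \<omega>) = 0"
    and square_integrable: "integrable M (\<lambda>\<omega>. (norm (\<xi> 0 \<omega>))\<^sup>2)"
    and covariance: "\<Sigma> = (LINT \<omega>|M. outer (\<xi> 0 \<omega>) (\<xi> 0 \<omega>))"
begin

lemma measurable_xi [measurable]: "\<xi> i \<in> borel_measurable M"
  using indep unfolding indep_vars_def2 by simp

lemma integral_xi:
  fixes g :: "real ^ 'd \<Rightarrow> 'c::{banach, second_countable_topology}"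
  assumes g: "g \<in> borel_measurable borel"
  shows "(LINT \<omega>|M. g (\<xi> i \<omega>)) = (LINT \<omega>|M. g (\<xi> 0 \<omega>))"
proof -
  have "(LINT \<omega>|M. g (\<xi> i \<omega>)) = (LINT x|distr M borel (\<xi> i). g x)" for i
    by (rule integral_distr[symmetric]) (use g in auto)
  then show ?thesis using ident by metis
qed

lemma integrable_xi:
  fixes g :: "real ^ 'd \<Rightarrow> 'c::{banach, second_countable_topology}"
  assumes g: "g \<in> borel_measurable borel"
  shows "integrable M (\<lambda>\<omega>. g (\<xi> i \<omega>)) \<longleftrightarrow> integrable M (\<lambda>\<omega>. g (\<xi> 0 \<omega>))"
proof -
  have "integrable M (\<lambda>\<omega>. g (\<xi> i \<omega>)) \<longleftrightarrow> integrable (distr M borel (\<xi> i)) g" for i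
    by (rule integrable_distr_eq[symmetric]) (use g in auto)
  then show ?thesis using ident by metis
qed

definition mean_square :: real where "mean_square = (LINT \<omega>|M. (norm (\<xi> 0 \<omega>))\<^sup>2)"

lemma mean_square_nonneg: "0 \<le> mean_square" by (simp add: mean_square_def)

lemma integrable_inner_sq: "integrable M (\<lambda>\<omega>. (v \<bullet> \<xi> i \<omega>)\<^sup>2)"
proof -
  have "integrable M (\<lambda>\<omega>. (v \<bullet> \<xi> 0 \<omega>)\<^sup>2)"
    by (rule Bochner_Integration.integrable_bound[OF integrable_mult_right[OF square_integrable, of "(norm v)\<^sup>2"]])
      (auto simp: inner_sq_le)
  then show ?thesis by (subst integrable_xi[of "\<lambda>x. (v \<bullet> x)\<^sup>2"]) auto
qed

lemma integrable_inner: "integrable M (\<lambda>\<omega>. v \<bullet> \<xi> i \<omega>)"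
  by (rule square_integrable_imp_integrable[OF _ integrable_inner_sq]) simp

lemma integrable_xi0: "integrable M (\<xi> i)"
proof -
  have "integrable M (\<lambda>\<omega>. (norm (\<xi> i \<omega>))\<^sup>2)"
    by (subst integrable_xi[of "\<lambda>x. (norm x)\<^sup>2" i]) (use square_integrable in simp_all)
  from square_integrable_imp_integrable[OF _ this] have "integrable M (\<lambda>\<omega>. norm (\<xi> i \<omega>))"
    by simp
  then show ?thesis using integrable_norm_iff[OF measurable_xi] by blast
qed

lemma mean_inner: "(LINT \<omega>|M. v \<bullet> \<xi> i \<omega>) = 0"
proof -
  have "(LINT \<omega>|M. v \<bullet> \<xi> i \<omega>) = (LINT \<omega>|M. v \<bullet> \<xi> 0 \<omega>)"
    by (rule integral_xi) simp
  also have "\<dots> = v \<bullet> (LINT \<omega>|M. \<xi> 0 \<omega>)"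
    by (rule integral_inner_right) (simp add: integrable_xi0)
  finally show ?thesis by (simp add: mean)
qed

text \<open>The quadratic form of \<open>\<Sigma>\<close>, kept as a second moment so that
  nonnegativity is immediate; \<open>quadratic_sum\<close> gives its matrix expression.\<close>

definition quadratic :: "real ^ 'd \<Rightarrow> real" where "quadratic v = (LINT \<omega>|M. (v \<bullet> \<xi> 0 \<omega>)\<^sup>2)"

lemma quadratic_nonneg: "0 \<le> quadratic v" by (simp add: quadratic_def)

lemma quadratic_xi: "(LINT \<omega>|M. (v \<bullet> \<xi> i \<omega>)\<^sup>2) = quadratic v"
  unfolding quadratic_def by (rule integral_xi) simp

lemma quadratic_le: "quadratic v \<le> (norm v)\<^sup>2 * mean_square"
proof -
  have "quadratic v \<le> (LINT \<omega>|M. (norm v)\<^sup>2 * (norm (\<xi> 0 \<omega>))\<^sup>2)"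
    unfolding quadratic_def
    by (rule integral_mono[OF integrable_inner_sq integrable_mult_right[OF square_integrable]]) (rule inner_sq_le)
  then show ?thesis by (simp add: mean_square_def)
qed

lemma integrable_nth_mult: "integrable M (\<lambda>\<omega>. \<xi> 0 \<omega> $ i * \<xi> 0 \<omega> $ j)"
proof (rule Bochner_Integration.integrable_bound[OF square_integrable])
  have "(\<lambda>\<omega>. \<xi> 0 \<omega> $ k) \<in> borel_measurable M" for k
    by (rule measurable_compose[OF measurable_xi measurable_vec_nth])
  then show "(\<lambda>\<omega>. \<xi> 0 \<omega> $ i * \<xi> 0 \<omega> $ j) \<in> borel_measurable M"
    by (intro borel_measurable_times)
  show "AE \<omega> in M. norm (\<xi> 0 \<omega> $ i * \<xi> 0 \<omega> $ j) \<le> norm ((norm (\<xi> 0 \<omega>))\<^sup>2)"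
    by (intro AE_I2) (simp add: abs_mult power2_eq_square mult_mono component_le_norm_cart)
qed

lemma covariance_nth: "\<Sigma> $ i $ j = (LINT \<omega>|M. \<xi> 0 \<omega> $ i * \<xi> 0 \<omega> $ j)"
proof -
  have i: "integrable M (\<lambda>\<omega>. outer (\<xi> 0 \<omega>) (\<xi> 0 \<omega>) $ i $ j)" for i j
    unfolding outer_nth by (rule integrable_nth_mult)
  have "\<Sigma> $ i $ j = (LINT \<omega>|M. outer (\<xi> 0 \<omega>) (\<xi> 0 \<omega>) $ i $ j)"
    unfolding covariance integral_vec_nth[OF integrable_vec[OF i]] by (rule integral_vec_nth[OF i])
  then show ?thesis by simp
qed

lemma covariance_sym: "\<Sigma> $ i $ j = \<Sigma> $ j $ i"
  unfolding covariance_nth by (simp add: mult.commute)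

lemma quadratic_sum:
  assumes "finite A"
  shows "quadratic (\<Sum>p\<in>A. c p *\<^sub>R axis (k p) 1) = (\<Sum>p\<in>A. \<Sum>r\<in>A. c p * c r * \<Sigma> $ k p $ k r)"
proof -
  have "((\<Sum>p\<in>A. c p *\<^sub>R axis (k p) 1) \<bullet> x)\<^sup>2 = (\<Sum>p\<in>A. \<Sum>r\<in>A. c p * c r * (x $ k p * x $ k r))" for x :: "real ^ 'd"
    by (simp add: inner_sum_left inner_axis' power2_eq_square sum_product mult_ac)
  then show ?thesis
    by (simp add: quadratic_def covariance_nth integrable_nth_mult)
qed

lemma indep_inner: "indep_vars (\<lambda>_. borel) (\<lambda>m \<omega>. v m \<bullet> \<xi> m \<omega>) I"
  by (rule indep_vars_compose2[OF indep_vars_subset[OF indep]]) auto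

text \<open>Pythagoras for independent centred variables: in the induction, the cross term has
  expectation 0.\<close>

lemma sum_inner_sq:
  assumes "finite I"
  shows "integrable M (\<lambda>\<omega>. (\<Sum>m\<in>I. v m \<bullet> \<xi> m \<omega>)\<^sup>2)"
    and "(LINT \<omega>|M. (\<Sum>m\<in>I. v m \<bullet> \<xi> m \<omega>)\<^sup>2) = (\<Sum>m\<in>I. quadratic (v m))"
proof -
  have "integrable M (\<lambda>\<omega>. (\<Sum>m\<in>I. v m \<bullet> \<xi> m \<omega>)\<^sup>2) \<and>
    (LINT \<omega>|M. (\<Sum>m\<in>I. v m \<bullet> \<xi> m \<omega>)\<^sup>2) = (\<Sum>m\<in>I. quadratic (v m))"
    using assms
  proof (induction I)
    case (insert j I)
    let ?S = "\<lambda>\<omega>. \<Sum>m\<in>I. v m \<bullet> \<xi> m \<omega>"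
    have iS: "integrable M ?S" by (intro Bochner_Integration.integrable_sum integrable_inner)
    have ind: "indep_var borel (\<lambda>\<omega>. v j \<bullet> \<xi> j \<omega>) borel ?S"
      by (rule indep_vars_sum[OF _ _ indep_inner]) (use insert in auto)
    have prod: "integrable M (\<lambda>\<omega>. (v j \<bullet> \<xi> j \<omega>) * ?S \<omega>)"
        "(LINT \<omega>|M. (v j \<bullet> \<xi> j \<omega>) * ?S \<omega>) = 0"
      using indep_var_integrable[OF ind integrable_inner iS] indep_var_lebesgue_integral[OF ind integrable_inner iS]
      by (simp_all add: mean_inner)
    have eq: "(\<Sum>m\<in>insert j I. v m \<bullet> \<xi> m \<omega>)\<^sup>2 =
        (v j \<bullet> \<xi> j \<omega>)\<^sup>2 + 2 * ((v j \<bullet> \<xi> j \<omega>) * ?S \<omega>) + (?S \<omega>)\<^sup>2" for \<omega>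
      using insert by (simp add: power2_sum)
    have "integrable M (\<lambda>\<omega>. (v j \<bullet> \<xi> j \<omega>)\<^sup>2)" "integrable M (\<lambda>\<omega>. 2 * ((v j \<bullet> \<xi> j \<omega>) * ?S \<omega>))"
        "integrable M (\<lambda>\<omega>. (?S \<omega>)\<^sup>2)"
      using insert prod integrable_inner_sq by auto
    then show ?case unfolding eq using insert prod by (simp add: quadratic_xi)
  qed simp
  then show "integrable M (\<lambda>\<omega>. (\<Sum>m\<in>I. v m \<bullet> \<xi> m \<omega>)\<^sup>2)"
    "(LINT \<omega>|M. (\<Sum>m\<in>I. v m \<bullet> \<xi> m \<omega>)\<^sup>2) = (\<Sum>m\<in>I. quadratic (v m))" by auto
qed

lemma quadratic_axis_sum: "(\<Sum>i\<in>UNIV. quadratic (axis i c)) = c\<^sup>2 * mean_square"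
proof -
  have "(\<Sum>i\<in>UNIV. quadratic (axis i c)) = (LINT \<omega>|M. (\<Sum>i\<in>UNIV. (axis i c \<bullet> \<xi> 0 \<omega>)\<^sup>2))"
    unfolding quadratic_def by (simp add: integrable_inner_sq)
  also have "\<dots> = (LINT \<omega>|M. c\<^sup>2 * (norm (\<xi> 0 \<omega>))\<^sup>2)"
    by (intro Bochner_Integration.integral_cong refl)
      (simp add: inner_axis' power_mult_distrib sum_distrib_left norm_vec_def L2_set_def sum_nonneg)
  finally show ?thesis by (simp add: mean_square_def)
qed

lemma weighted_sum_sq:
  assumes "finite I"
  shows "integrable M (\<lambda>\<omega>. (norm (\<Sum>m\<in>I. c m *\<^sub>R \<xi> m \<omega>))\<^sup>2)"
    and "(LINT \<omega>|M. (norm (\<Sum>m\<in>I. c m *\<^sub>R \<xi> m \<omega>))\<^sup>2) = (\<Sum>m\<in>I. (c m)\<^sup>2) * mean_square"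
proof -
  have eq: "(norm (\<Sum>m\<in>I. c m *\<^sub>R \<xi> m \<omega>))\<^sup>2 = (\<Sum>i\<in>UNIV. (\<Sum>m\<in>I. axis i (c m) \<bullet> \<xi> m \<omega>)\<^sup>2)" for \<omega>
    by (simp add: norm_vec_def L2_set_def sum_nonneg inner_axis')
  show "integrable M (\<lambda>\<omega>. (norm (\<Sum>m\<in>I. c m *\<^sub>R \<xi> m \<omega>))\<^sup>2)"
    unfolding eq by (intro Bochner_Integration.integrable_sum sum_inner_sq assms)
  have "(LINT \<omega>|M. (norm (\<Sum>m\<in>I. c m *\<^sub>R \<xi> m \<omega>))\<^sup>2) = (\<Sum>i\<in>UNIV. \<Sum>m\<in>I. quadratic (axis i (c m)))"
    unfolding eq using sum_inner_sq[OF assms] by simp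
  also have "\<dots> = (\<Sum>m\<in>I. (c m)\<^sup>2) * mean_square"
    by (subst sum.swap) (simp add: quadratic_axis_sum sum_distrib_right)
  finally show "(LINT \<omega>|M. (norm (\<Sum>m\<in>I. c m *\<^sub>R \<xi> m \<omega>))\<^sup>2) = (\<Sum>m\<in>I. (c m)\<^sup>2) * mean_square" .
qed

text \<open>Third-order Taylor estimate with the remainder cut off at second order, so that no third
  moment is required. Pulling out \<open>a\<^sup>2\<close> leaves an integral that tends to 0 with
  \<open>a\<close>; the last summand is the cost of replacing \<open>1 - quadratic v / 2\<close> by
  the Gaussian factor.\<close>

lemma char_inner_approx:
  assumes v: "norm v \<le> a" and a: "0 \<le> a"
  shows "norm (char (distr M borel (\<lambda>\<omega>. v \<bullet> \<xi> m \<omega>)) 1 - complex_of_real (exp (- (quadratic v / 2))))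
    \<le> a\<^sup>2 / 6 * (LINT \<omega>|M. min (6 * (norm (\<xi> 0 \<omega>))\<^sup>2) (a * norm (\<xi> 0 \<omega>) ^ 3)) + (a\<^sup>2 * mean_square)\<^sup>2"
proof -
  let ?g = "\<lambda>x :: real ^ 'd. min (6 * (norm x)\<^sup>2) (a * norm x ^ 3)"
  have ig: "integrable M (\<lambda>\<omega>. ?g (\<xi> 0 \<omega>))"
    by (rule Bochner_Integration.integrable_bound[OF integrable_mult_right[OF square_integrable, of 6]]) (use a in auto)
  have "norm (char (distr M borel (\<lambda>\<omega>. v \<bullet> \<xi> m \<omega>)) 1 - (1 - 1\<^sup>2 * quadratic v / 2))
      \<le> (1\<^sup>2 / 6) * (LINT \<omega>|M. min (6 * (v \<bullet> \<xi> m \<omega>)\<^sup>2) (\<bar>1\<bar> * \<bar>v \<bullet> \<xi> m \<omega>\<bar> ^ 3))"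
    by (rule char_approx3') (auto simp: integrable_inner integrable_inner_sq mean_inner quadratic_xi)
  also have "(LINT \<omega>|M. min (6 * (v \<bullet> \<xi> m \<omega>)\<^sup>2) (\<bar>1\<bar> * \<bar>v \<bullet> \<xi> m \<omega>\<bar> ^ 3)) =
      (LINT \<omega>|M. min (6 * (v \<bullet> \<xi> 0 \<omega>)\<^sup>2) (\<bar>1\<bar> * \<bar>v \<bullet> \<xi> 0 \<omega>\<bar> ^ 3))"
    by (rule integral_xi) auto
  also have "\<dots> \<le> (LINT \<omega>|M. a\<^sup>2 * ?g (\<xi> 0 \<omega>))"
  proof (rule integral_mono[OF _ integrable_mult_right[OF ig]])
    show "integrable M (\<lambda>\<omega>. min (6 * (v \<bullet> \<xi> 0 \<omega>)\<^sup>2) (\<bar>1\<bar> * \<bar>v \<bullet> \<xi> 0 \<omega>\<bar> ^ 3))"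
      by (rule Bochner_Integration.integrable_bound[OF integrable_mult_right[OF integrable_inner_sq, of 6 v 0]]) auto
    fix \<omega>
    let ?x = "\<xi> 0 \<omega>"
    have vx: "\<bar>v \<bullet> ?x\<bar> \<le> a * norm ?x"
      using Cauchy_Schwarz_ineq2[of v ?x] mult_right_mono[OF v, of "norm ?x"] by simp
    have "(v \<bullet> ?x)\<^sup>2 \<le> (a * norm ?x)\<^sup>2" using power_mono[OF vx, of 2] by simp
    moreover have "\<bar>v \<bullet> ?x\<bar> ^ 3 \<le> (a * norm ?x) ^ 3" by (rule power_mono[OF vx]) simp
    ultimately have "min (6 * (v \<bullet> ?x)\<^sup>2) (\<bar>1\<bar> * \<bar>v \<bullet> ?x\<bar> ^ 3) \<le> min (6 * (a * norm ?x)\<^sup>2) ((a * norm ?x) ^ 3)"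
      by (intro min.mono) auto
    also have "\<dots> = a\<^sup>2 * ?g ?x"
      using a by (simp add: mult_min_right power_mult_distrib power2_eq_square power3_eq_cube mult_ac)
    finally show "min (6 * (v \<bullet> ?x)\<^sup>2) (\<bar>1\<bar> * \<bar>v \<bullet> ?x\<bar> ^ 3) \<le> a\<^sup>2 * ?g ?x" .
  qed
  finally have 1: "norm (char (distr M borel (\<lambda>\<omega>. v \<bullet> \<xi> m \<omega>)) 1 - complex_of_real (1 - quadratic v / 2))
      \<le> a\<^sup>2 / 6 * (LINT \<omega>|M. ?g (\<xi> 0 \<omega>))" by simp
  have "quadratic v \<le> a\<^sup>2 * mean_square"
    using quadratic_le[of v] mult_right_mono[OF power_mono[OF v, of 2] mean_square_nonneg] by simp
  then have "(quadratic v / 2)\<^sup>2 \<le> (a\<^sup>2 * mean_square)\<^sup>2"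
    using quadratic_nonneg[of v] by (intro power_mono) auto
  then have "\<bar>exp (- (quadratic v / 2)) - (1 - quadratic v / 2)\<bar> \<le> (a\<^sup>2 * mean_square)\<^sup>2"
    using exp_minus_approx[of "quadratic v / 2"] quadratic_nonneg[of v] by simp
  then have 2: "norm (complex_of_real (1 - quadratic v / 2) - complex_of_real (exp (- (quadratic v / 2)))) \<le> (a\<^sup>2 * mean_square)\<^sup>2"
    by (metis norm_minus_commute norm_of_real of_real_diff)
  show ?thesis using norm_triangle_le[of "char (distr M borel (\<lambda>\<omega>. v \<bullet> \<xi> m \<omega>)) 1 - complex_of_real (1 - quadratic v / 2)"
      "complex_of_real (1 - quadratic v / 2) - complex_of_real (exp (- (quadratic v / 2)))"] 1 2 by simp
qed

text \<open>Central limit theorem for triangular arrays. The weights vary with \<open>m\<close>, so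
  the product of characteristic functions is compared factor by factor with a product of Gaussian
  factors; all factors lie in the unit disc, hence the errors only add up.\<close>

lemma cf_convergence_array:
  assumes v: "\<And>n m. m \<in> {1..n} \<Longrightarrow> norm (v n m) \<le> C / sqrt (real n)" and C: "0 \<le> C"
    and lim: "(\<lambda>n. \<Sum>m=1..n. quadratic (v n m)) \<longlonglongrightarrow> s"
  shows "(\<lambda>n. LINT \<omega>|M. cis (\<Sum>m=1..n. v n m \<bullet> \<xi> m \<omega>)) \<longlonglongrightarrow> complex_of_real (exp (- s / 2))"
proof -
  let ?\<phi> = "\<lambda>n m. char (distr M borel (\<lambda>\<omega>. v n m \<bullet> \<xi> m \<omega>)) 1"
  let ?e = "\<lambda>n m. complex_of_real (exp (- (quadratic (v n m) / 2)))"
  define \<epsilon> where "\<epsilon> n = (LINT \<omega>|M. min (6 * (norm (\<xi> 0 \<omega>))\<^sup>2) (C / sqrt (real n) * norm (\<xi> 0 \<omega>) ^ 3))" for n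
  have lhs: "(LINT \<omega>|M. cis (\<Sum>m=1..n. v n m \<bullet> \<xi> m \<omega>)) = (\<Prod>m=1..n. ?\<phi> n m)" for n
  proof -
    have "(LINT \<omega>|M. cis (\<Sum>m=1..n. v n m \<bullet> \<xi> m \<omega>)) = char (distr M borel (\<lambda>\<omega>. \<Sum>m=1..n. v n m \<bullet> \<xi> m \<omega>)) 1"
      unfolding char_def by (subst integral_distr) (auto simp: cis_conv_exp)
    also have "\<dots> = (\<Prod>m=1..n. ?\<phi> n m)" by (rule char_distr_sum[OF indep_inner])
    finally show ?thesis .
  qed
  have bound: "norm ((\<Prod>m=1..n. ?\<phi> n m) - (\<Prod>m=1..n. ?e n m)) \<le> C\<^sup>2 / 6 * \<epsilon> n + (C\<^sup>2 * mean_square)\<^sup>2 / real n"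
    if n: "n > 0" for n
  proof -
    have "norm ((\<Prod>m=1..n. ?\<phi> n m) - (\<Prod>m=1..n. ?e n m)) \<le> (\<Sum>m=1..n. norm (?\<phi> n m - ?e n m))"
    proof (rule norm_prod_diff)
      fix m
      interpret D: real_distribution "distr M borel (\<lambda>\<omega>. v n m \<bullet> \<xi> m \<omega>)"
        by (rule real_distribution_distr) simp
      show "norm (?\<phi> n m) \<le> 1" by (rule D.cmod_char_le_1)
      show "norm (?e n m) \<le> 1" using quadratic_nonneg by simp
    qed
    \<comment> \<open>With \<open>a = C / sqrt (real n)\<close> each of the \<open>n\<close> errors
      is of order \<open>\<epsilon> n / n + 1 / n\<^sup>2\<close>.\<close>
    also have "\<dots> \<le> (\<Sum>m=1..n. (C / sqrt (real n))\<^sup>2 / 6 * \<epsilon> n + ((C / sqrt (real n))\<^sup>2 * mean_square)\<^sup>2)"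
      unfolding \<epsilon>_def by (intro sum_mono char_inner_approx v) (use C in auto)
    also have "\<dots> = C\<^sup>2 / 6 * \<epsilon> n + (C\<^sup>2 * mean_square)\<^sup>2 / real n"
      using n by (simp add: power_divide field_simps power2_eq_square)
    finally show ?thesis .
  qed
  have "\<epsilon> \<longlonglongrightarrow> (LINT \<omega>|M. 0)"
    unfolding \<epsilon>_def
  proof (rule integral_dominated_convergence[where w = "\<lambda>\<omega>. 6 * (norm (\<xi> 0 \<omega>))\<^sup>2"])
    show "integrable M (\<lambda>\<omega>. 6 * (norm (\<xi> 0 \<omega>))\<^sup>2)" by (rule integrable_mult_right[OF square_integrable])
    show "AE \<omega> in M. (\<lambda>n. min (6 * (norm (\<xi> 0 \<omega>))\<^sup>2) (C / sqrt (real n) * norm (\<xi> 0 \<omega>) ^ 3)) \<longlonglongrightarrow> 0"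
    proof (rule AE_I2)
      fix \<omega>
      have "(\<lambda>n. C / sqrt (real n) * norm (\<xi> 0 \<omega>) ^ 3) \<longlonglongrightarrow> 0 * norm (\<xi> 0 \<omega>) ^ 3"
        by (intro tendsto_mult_right tendsto_divide_0[OF tendsto_const] filterlim_at_top_imp_at_infinity
            filterlim_compose[OF sqrt_at_top filterlim_real_sequentially])
      from tendsto_min[OF tendsto_const[of "6 * (norm (\<xi> 0 \<omega>))\<^sup>2"] this]
      show "(\<lambda>n. min (6 * (norm (\<xi> 0 \<omega>))\<^sup>2) (C / sqrt (real n) * norm (\<xi> 0 \<omega>) ^ 3)) \<longlonglongrightarrow> 0"
        by simp
    qed
    show "AE \<omega> in M. norm (min (6 * (norm (\<xi> 0 \<omega>))\<^sup>2) (C / sqrt (real n) * norm (\<xi> 0 \<omega>) ^ 3))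
        \<le> 6 * (norm (\<xi> 0 \<omega>))\<^sup>2" for n
      using C by (intro AE_I2) (simp add: abs_of_nonneg)
  qed auto
  then have "(\<lambda>n. C\<^sup>2 / 6 * \<epsilon> n + (C\<^sup>2 * mean_square)\<^sup>2 / real n) \<longlonglongrightarrow> C\<^sup>2 / 6 * 0 + 0"
    by (intro tendsto_add tendsto_mult_left lim_const_over_n) simp
  then have "(\<lambda>n. (\<Prod>m=1..n. ?\<phi> n m) - (\<Prod>m=1..n. ?e n m)) \<longlonglongrightarrow> 0"
    by (intro Lim_null_comparison[OF eventually_mono[OF eventually_gt_at_top[of 0] bound]]) auto
  moreover have "(\<lambda>n. \<Prod>m=1..n. ?e n m) \<longlonglongrightarrow> complex_of_real (exp (- s / 2))"
  proof -
    have "(\<Prod>m=1..n. ?e n m) = complex_of_real (exp (- (\<Sum>m=1..n. quadratic (v n m)) / 2))" for n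
      by (simp add: exp_sum[symmetric] sum_negf sum_divide_distrib flip: of_real_prod)
    moreover have "(\<lambda>n. complex_of_real (exp (- (\<Sum>m=1..n. quadratic (v n m)) / 2))) \<longlonglongrightarrow> complex_of_real (exp (- s / 2))"
      by (intro tendsto_intros lim) simp
    ultimately show ?thesis by simp
  qed
  ultimately show ?thesis unfolding lhs by (rule Lim_transform[rotated])
qed

end

section \<open>Gaussian sequences with a prescribed covariance\<close>

definition positive_semidefinite :: "(nat \<Rightarrow> nat \<Rightarrow> real) \<Rightarrow> bool" where
  "positive_semidefinite K \<longleftrightarrow> (\<forall>i j. K i j = K j i) \<and>
     (\<forall>A u. finite A \<longrightarrow> 0 \<le> (\<Sum>i\<in>A. \<Sum>j\<in>A. u i * u j * K i j))"

text \<open>For a zero pivot \<open>K k k\<close>, division by zero leaves \<open>K\<close>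
  unchanged; this is the right elimination, since column \<open>k\<close> then vanishes
  (\<open>positive_semidefinite_null\<close>).\<close>

definition schur_complement :: "nat \<Rightarrow> (nat \<Rightarrow> nat \<Rightarrow> real) \<Rightarrow> nat \<Rightarrow> nat \<Rightarrow> real" where
  "schur_complement k K i j = K i j - K i k * K j k / K k k"

lemma positive_semidefinite_diag: "positive_semidefinite K \<Longrightarrow> 0 \<le> K i i"
  unfolding positive_semidefinite_def by (elim conjE allE[of _ "{i}"] allE[of _ "\<lambda>_. 1"]) simp

lemma positive_semidefinite_null:
  assumes "positive_semidefinite K" "K k k = 0" shows "K i k = 0"
proof (cases "i = k")
  case False
  have sym: "K k i = K i k" using assms(1) by (auto simp: positive_semidefinite_def)
  have quad: "0 \<le> K i i + 2 * t * K i k" for t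
  proof -
    have "0 \<le> (\<Sum>a\<in>{i,k}. \<Sum>b\<in>{i,k}. (if a = i then 1 else t) * (if b = i then 1 else t) * K a b)"
      using assms(1) unfolding positive_semidefinite_def
      by (elim conjE allE[of _ "{i,k}"] allE[of _ "\<lambda>a. if a = i then 1 else t"]) simp
    then show ?thesis using False assms(2) sym by simp
  qed
  show ?thesis
  proof (rule ccontr)
    assume "K i k \<noteq> 0"
    \<comment> \<open>This \<open>t\<close> makes the quantity in \<open>quad\<close>, which is
      affine in \<open>t\<close>, equal to -1.\<close>
    then show False using quad[of "- (K i i + 1) / (2 * K i k)"] by (simp add: field_simps)
  qed
qed (use assms in simp)

text \<open>Completing the square: the form of the Schur complement at \<open>u\<close> is the form
  of \<open>K\<close> at \<open>u\<close> shifted along the basis vector \<open>k\<close> by the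
  minimising amount.\<close>

lemma positive_semidefinite_schur:
  assumes "positive_semidefinite K" shows "positive_semidefinite (schur_complement k K)"
proof (cases "K k k = 0")
  case True
  then have "schur_complement k K = K" by (simp add: schur_complement_def fun_eq_iff)
  then show ?thesis using assms by simp
next
  case False
  have sym: "K i j = K j i" for i j using assms by (simp add: positive_semidefinite_def)
  have "0 \<le> (\<Sum>i\<in>A. \<Sum>j\<in>A. u i * u j * schur_complement k K i j)" if A: "finite A" for A u
  proof -
    define B where "B = insert k A"
    define c where "c = (\<Sum>i\<in>A. u i * K i k) / K k k"
    \<comment> \<open>The two conditionals are independent because \<open>k\<close> may or may not
      belong to \<open>A\<close>.\<close>
    define w where "w i = (if i \<in> A then u i else 0) - (if i = k then c else 0)" for i
    have B: "finite B" using A by (simp add: B_def)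
    have w: "(\<Sum>i\<in>B. w i * f i) = (\<Sum>i\<in>A. u i * f i) - c * f k" for f
    proof -
      have "(\<Sum>i\<in>B. w i * f i) = (\<Sum>i\<in>B. (if i \<in> A then u i * f i else 0) - (if i = k then c * f k else 0))"
        by (rule sum.cong) (auto simp: w_def algebra_simps)
      also have "\<dots> = (\<Sum>i\<in>B. if i \<in> A then u i * f i else 0) - c * f k"
        using B by (subst sum_subtractf) (simp add: B_def)
      also have "(\<Sum>i\<in>B. if i \<in> A then u i * f i else 0) = (\<Sum>i\<in>A. u i * f i)"
        using B by (intro sum.mono_neutral_cong_right) (auto simp: B_def)
      finally show ?thesis .
    qed
    have "0 \<le> (\<Sum>i\<in>B. \<Sum>j\<in>B. w i * w j * K i j)"
      using assms B by (simp add: positive_semidefinite_def)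
    also have "\<dots> = (\<Sum>i\<in>B. w i * (\<Sum>j\<in>B. w j * K i j))"
      by (simp add: sum_distrib_left mult.assoc)
    also have "\<dots> = (\<Sum>i\<in>A. u i * ((\<Sum>j\<in>A. u j * K i j) - c * K i k)) - c * ((\<Sum>j\<in>A. u j * K k j) - c * K k k)"
      unfolding w by simp
    also have "(\<Sum>j\<in>A. u j * K k j) - c * K k k = 0"
    proof -
      have "(\<Sum>j\<in>A. u j * K k j) = (\<Sum>j\<in>A. u j * K j k)"
        by (intro sum.cong refl arg_cong2[where f = "(*)"] sym)
      then show ?thesis using False by (simp add: c_def)
    qed
    also have "(\<Sum>i\<in>A. u i * ((\<Sum>j\<in>A. u j * K i j) - c * K i k)) - c * 0 =
        (\<Sum>i\<in>A. \<Sum>j\<in>A. u i * u j * K i j) - c * (\<Sum>i\<in>A. u i * K i k)"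
      by (simp add: right_diff_distrib sum_subtractf sum_distrib_left mult_ac)
    also have "c * (\<Sum>i\<in>A. u i * K i k) = (\<Sum>i\<in>A. \<Sum>j\<in>A. (u i * K i k) * (u j * K j k)) / K k k"
      unfolding c_def by (simp add: sum_product)
    also have "(\<Sum>i\<in>A. \<Sum>j\<in>A. u i * u j * K i j) - \<dots> = (\<Sum>i\<in>A. \<Sum>j\<in>A. u i * u j * schur_complement k K i j)"
      by (simp add: schur_complement_def right_diff_distrib sum_subtractf sum_divide_distrib mult_ac)
    finally show ?thesis .
  qed
  moreover have "schur_complement k K i j = schur_complement k K j i" for i j
    by (simp add: schur_complement_def sym[of i j] mult.commute)
  ultimately show ?thesis unfolding positive_semidefinite_def by blast
qed

primrec schur_iterate :: "(nat \<Rightarrow> nat \<Rightarrow> real) \<Rightarrow> nat \<Rightarrow> nat \<Rightarrow> nat \<Rightarrow> real" where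
  "schur_iterate K 0 = K"
| "schur_iterate K (Suc n) = schur_complement n (schur_iterate K n)"

text \<open>Eliminating the indices one after another removes a rank-one term each time, and these
  terms are the columns of \<open>c\<close>. Once index \<open>i\<close> is eliminated its row is
  zero, so each entry of the infinite matrix is a finite sum. A zero pivot contributes a zero
  column.\<close>

lemma cholesky:
  assumes K: "positive_semidefinite K"
  obtains c :: "nat \<Rightarrow> nat \<Rightarrow> real" where "\<And>i j m. i < m \<Longrightarrow> K i j = (\<Sum>n<m. c i n * c j n)"
proof -
  let ?S = "schur_iterate K"
  have psd: "positive_semidefinite (?S n)" for n
    by (induction n) (simp_all add: K positive_semidefinite_schur)
  have sym: "?S n i j = ?S n j i" for n i j using psd[of n] by (simp add: positive_semidefinite_def)
  \<comment> \<open>Elimination of index \<open>n\<close> annihilates row \<open>n\<close>, and rows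
    that are already zero stay zero.\<close>
  have zero: "i < n \<Longrightarrow> ?S n i j = 0" for i n j
  proof (induction n arbitrary: j)
    case (Suc n)
    show ?case
    proof (cases "i = n")
      case True
      show ?thesis
        using positive_semidefinite_null[OF psd, of n n j] sym[of n n j] True
        by (cases "?S n n n = 0") (simp_all add: schur_complement_def)
    next
      case False
      then show ?thesis using Suc by (simp add: schur_complement_def)
    qed
  qed simp
  define c where "c i n = ?S n i n / sqrt (?S n n n)" for i n
  have step: "?S n i j = ?S (Suc n) i j + c i n * c j n" for n i j
  proof -
    have "c i n * c j n = ?S n i n * ?S n j n / ?S n n n"
      using positive_semidefinite_diag[OF psd, of n n] by (simp add: c_def)
    then show ?thesis by (simp add: schur_complement_def)
  qed
  have sum: "?S m i j + (\<Sum>n<m. c i n * c j n) = K i j" for i j m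
    by (induction m) (use step in auto)
  have "K i j = (\<Sum>n<m. c i n * c j n)" if "i < m" for i j m
    using sum[of m i j, symmetric] unfolding zero[OF that] by simp
  then show ?thesis by (rule that)
qed

section \<open>Independent standard normal variables and centred normal laws\<close>

abbreviation noise_space :: "(nat \<Rightarrow> real) measure" where
  "noise_space \<equiv> PiM UNIV (\<lambda>_. std_normal_distribution)"

lemma prob_space_noise: "prob_space noise_space"
  by (intro prob_space_PiM prob_space_normal_density) simp

lemma indep_noise: "prob_space.indep_vars noise_space (\<lambda>_. borel) (\<lambda>n \<omega>. \<omega> n) UNIV"
proof -
  interpret product_prob_space "\<lambda>_ :: nat. std_normal_distribution" UNIV
    by (intro product_prob_spaceI prob_space_normal_density) simp
  have "indep_vars (\<lambda>_. std_normal_distribution) (\<lambda>n \<omega>. \<omega> n) UNIV"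
    by (subst indep_vars_iff_distr_eq_PiM') (simp_all add: PiM_component restrict_UNIV distr_id[unfolded id_def])
  from indep_vars_compose2[OF this, of "\<lambda>_ x. x" "\<lambda>_. borel"] show ?thesis by simp
qed

lemma distr_noise: "distr noise_space borel (\<lambda>\<omega>. \<omega> n) = std_normal_distribution"
proof -
  interpret product_prob_space "\<lambda>_ :: nat. std_normal_distribution" UNIV
    by (intro product_prob_spaceI prob_space_normal_density) simp
  have "distr noise_space borel (\<lambda>\<omega>. \<omega> n) = distr noise_space std_normal_distribution (\<lambda>\<omega>. \<omega> n)"
    by (rule distr_cong) auto
  then show ?thesis using PiM_component[of n] by simp
qed

text \<open>Scaling a standard normal variable covers the point mass at \<open>s = 0\<close> as
  well, so characteristic function and moments need no case distinction later.\<close>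

lemma normal_law_eq_distr:
  assumes "0 \<le> s" shows "normal_law 0 s = distr std_normal_distribution borel (\<lambda>x. s * x)"
proof (cases "s = 0")
  case True
  interpret prob_space std_normal_distribution by (rule prob_space_normal_density) simp
  show ?thesis using True by (simp add: normal_law_def)
next
  case False
  interpret prob_space std_normal_distribution by (rule prob_space_normal_density) simp
  have "distributed std_normal_distribution lborel (\<lambda>x. x) std_normal_density"
    by (auto simp: distributed_def intro!: measure_eqI simp: emeasure_distr)
  from normal_density_affine[OF this, of s 0] False assms
  have "distr std_normal_distribution lborel (\<lambda>x. s * x) = density lborel (normal_density 0 s)"
    by (simp add: distributed_def)
  moreover have "distr std_normal_distribution borel (\<lambda>x. s * x) = distr std_normal_distribution lborel (\<lambda>x. s * x)"
    by (rule distr_cong) auto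
  ultimately show ?thesis using False by (simp add: normal_law_def)
qed

lemma real_distribution_normal_law: "0 \<le> s \<Longrightarrow> real_distribution (normal_law 0 s)"
  by (subst normal_law_eq_distr)
    (simp_all add: prob_space.real_distribution_distr prob_space_normal_density)

lemma char_normal_law:
  assumes "0 \<le> s" shows "char (normal_law 0 s) t = complex_of_real (exp (- (s * t)\<^sup>2 / 2))"
proof -
  have "char (normal_law 0 s) t = char std_normal_distribution (s * t)"
    unfolding normal_law_eq_distr[OF assms] char_def by (subst integral_distr) (auto simp: mult_ac)
  then show ?thesis by (simp add: char_std_normal_distribution)
qed

lemma normal_law_moments:
  assumes "0 \<le> s"
  shows "integrable (normal_law 0 s) (\<lambda>x. x)" "(LINT x|normal_law 0 s. x) = 0"
    "integrable (normal_law 0 s) (\<lambda>x. x\<^sup>2)" "(LINT x|normal_law 0 s. x\<^sup>2) = s\<^sup>2"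
proof -
  let ?N = std_normal_distribution
  note eq = normal_law_eq_distr[OF assms]
  have m: "(\<lambda>x. s * x) \<in> ?N \<rightarrow>\<^sub>M borel" by simp
  have i1: "integrable ?N (\<lambda>x. x)" and i2: "integrable ?N (\<lambda>x. x\<^sup>2)"
    using integrable_std_normal_distribution_moment[of 1] integrable_std_normal_distribution_moment[of 2]
    by (simp_all only: power_one_right)
  have e1: "(LINT x|?N. x) = 0"
    using integral_std_normal_distribution_moment_odd[OF odd_one] by (simp only: power_one_right)
  have e2: "(LINT x|?N. x\<^sup>2) = 1"
    using std_normal_distribution_even_moments(1)[of 1] by (simp add: fact_numeral)
  show "integrable (normal_law 0 s) (\<lambda>x. x)"
    unfolding eq by (subst integrable_distr_eq[OF m]) (simp_all add: i1)
  show "integrable (normal_law 0 s) (\<lambda>x. x\<^sup>2)"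
    unfolding eq by (subst integrable_distr_eq[OF m]) (simp_all add: i2 power_mult_distrib)
  show "(LINT x|normal_law 0 s. x) = 0"
    unfolding eq by (subst integral_distr[OF m]) (simp_all add: e1)
  show "(LINT x|normal_law 0 s. x\<^sup>2) = s\<^sup>2"
    unfolding eq by (subst integral_distr[OF m]) (simp_all add: e2 power_mult_distrib)
qed

lemma (in prob_space) normal_law_variable:
  assumes X: "X \<in> borel_measurable M" and s: "0 \<le> s" and d: "distr M borel X = normal_law 0 s"
  shows "integrable M X" "expectation X = 0" "integrable M (\<lambda>\<omega>. (X \<omega>)\<^sup>2)" "expectation (\<lambda>\<omega>. (X \<omega>)\<^sup>2) = s\<^sup>2"
proof -
  note m = normal_law_moments[OF s, folded d]
  show "integrable M X" using m(1) by (subst (asm) integrable_distr_eq[OF X]) simp_all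
  show "expectation X = 0" using m(2) by (subst (asm) integral_distr[OF X]) simp_all
  show "integrable M (\<lambda>\<omega>. (X \<omega>)\<^sup>2)" using m(3) by (subst (asm) integrable_distr_eq[OF X]) simp_all
  show "expectation (\<lambda>\<omega>. (X \<omega>)\<^sup>2) = s\<^sup>2" using m(4) by (subst (asm) integral_distr[OF X]) simp_all
qed

lemma (in prob_space) normal_law_by_char:
  assumes X: "X \<in> borel_measurable M" and s: "0 \<le> s"
    and c: "\<And>t. (LINT \<omega>|M. cis (t * X \<omega>)) = complex_of_real (exp (- (s * t)\<^sup>2 / 2))"
  shows "distr M borel X = normal_law 0 s"
proof (rule Levy_uniqueness[OF real_distribution_distr[OF X] real_distribution_normal_law[OF s]])
  have "char (distr M borel X) t = (LINT \<omega>|M. cis (t * X \<omega>))" for t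
    unfolding char_def using X by (subst integral_distr) (auto simp: cis_conv_exp)
  then show "char (distr M borel X) = char (normal_law 0 s)"
    by (simp add: fun_eq_iff c char_normal_law[OF s])
qed

lemma (in prob_space) char_of_normal_law:
  assumes X: "X \<in> borel_measurable M" and s: "0 \<le> s" and d: "distr M borel X = normal_law 0 s"
  shows "(LINT \<omega>|M. cis (t * X \<omega>)) = complex_of_real (exp (- (s * t)\<^sup>2 / 2))"
proof -
  have "char (distr M borel X) t = (LINT \<omega>|M. cis (t * X \<omega>))"
    unfolding char_def using X by (subst integral_distr) (auto simp: cis_conv_exp)
  then show ?thesis by (simp add: d char_normal_law[OF s])
qed

lemma distr_noise_sum:
  "distr noise_space borel (\<lambda>\<omega>. \<Sum>n<m. b n * \<omega> n) = normal_law 0 (sqrt (\<Sum>n<m. (b n)\<^sup>2))"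
proof -
  interpret prob_space noise_space by (rule prob_space_noise)
  have [measurable]: "(\<lambda>\<omega>. \<omega> n) \<in> borel_measurable noise_space" for n
    using indep_noise unfolding indep_vars_def2 by simp
  show ?thesis
  proof (rule normal_law_by_char)
    fix t
    have ind: "indep_vars (\<lambda>_. borel) (\<lambda>n \<omega>. b n * \<omega> n) {..<m}"
      by (rule indep_vars_compose2[OF indep_vars_subset[OF indep_noise]]) auto
    have "(LINT \<omega>|noise_space. cis (t * (\<Sum>n<m. b n * \<omega> n))) = char (distr noise_space borel (\<lambda>\<omega>. \<Sum>n<m. b n * \<omega> n)) t"
      unfolding char_def by (subst integral_distr) (auto simp: cis_conv_exp)
    also have "\<dots> = (\<Prod>n<m. char (distr noise_space borel (\<lambda>\<omega>. b n * \<omega> n)) t)"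
      by (rule char_distr_sum[OF ind])
    also have "\<dots> = (\<Prod>n<m. complex_of_real (exp (- (b n * t)\<^sup>2 / 2)))"
    proof (rule prod.cong[OF refl])
      fix n
      have "char (distr noise_space borel (\<lambda>\<omega>. b n * \<omega> n)) t = char (distr noise_space borel (\<lambda>\<omega>. \<omega> n)) (b n * t)"
        unfolding char_def by (subst (1 2) integral_distr) (auto simp: mult_ac)
      then show "char (distr noise_space borel (\<lambda>\<omega>. b n * \<omega> n)) t = complex_of_real (exp (- (b n * t)\<^sup>2 / 2))"
        by (simp add: distr_noise char_std_normal_distribution)
    qed
    also have "\<dots> = complex_of_real (exp (\<Sum>n<m. - (b n * t)\<^sup>2 / 2))"
      by (simp add: exp_sum)
    also have "(\<Sum>n<m. - (b n * t)\<^sup>2 / 2) = - (sqrt (\<Sum>n<m. (b n)\<^sup>2) * t)\<^sup>2 / 2"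
      by (simp add: power_mult_distrib sum_nonneg sum_negf sum_distrib_right sum_divide_distrib)
    finally show "(LINT \<omega>|noise_space. cis (t * (\<Sum>n<m. b n * \<omega> n)))
      = complex_of_real (exp (- (sqrt (\<Sum>n<m. (b n)\<^sup>2) * t)\<^sup>2 / 2))" .
  qed (auto simp: sum_nonneg)
qed

text \<open>Apply the Cholesky factor to independent standard normal variables; its triangular shape
  makes every \<open>X i\<close> a finite sum. Variables of variance 0 vanish at every
  \<open>\<omega>\<close>, not just almost surely, so that the paths built from them start exactly
  at 0.\<close>

lemma gaussian_sequence:
  assumes K: "positive_semidefinite K"
  obtains X :: "nat \<Rightarrow> (nat \<Rightarrow> real) \<Rightarrow> real"
  where "\<And>i. X i \<in> borel_measurable noise_space" "\<And>i \<omega>. K i i = 0 \<Longrightarrow> X i \<omega> = 0"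
    "\<And>A u. finite A \<Longrightarrow> distr noise_space borel (\<lambda>\<omega>. \<Sum>i\<in>A. u i * X i \<omega>) =
       normal_law 0 (sqrt (\<Sum>i\<in>A. \<Sum>j\<in>A. u i * u j * K i j))"
proof -
  interpret prob_space noise_space by (rule prob_space_noise)
  have [measurable]: "(\<lambda>\<omega>. \<omega> n) \<in> borel_measurable noise_space" for n
    using indep_noise unfolding indep_vars_def2 by simp
  obtain c where c: "\<And>i j m. i < m \<Longrightarrow> K i j = (\<Sum>n<m. c i n * c j n)"
    using cholesky[OF K] by blast
  define X where "X i \<omega> = (\<Sum>n<Suc i. c i n * \<omega> n)" for i and \<omega> :: "nat \<Rightarrow> real"
  \<comment> \<open>Compare the factorisation of \<open>K i i\<close> truncated at
    \<open>Suc n\<close> and at \<open>n\<close>: both are valid once \<open>i < n\<close>, so the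
    extra square is 0.\<close>
  have c0: "c i n = 0" if "i < n" for i n
  proof -
    have "c i n * c i n = K i i - K i i"
      using c[of i "Suc n" i] c[of i n i] that by simp
    then show ?thesis by simp
  qed
  have X_eq: "X i \<omega> = (\<Sum>n<m. c i n * \<omega> n)" if "i < m" for i m \<omega>
    unfolding X_def using that c0 by (intro sum.mono_neutral_left) auto
  show ?thesis
  proof (rule that[of X])
    show "X i \<in> borel_measurable noise_space" for i unfolding X_def by measurable
    show "X i \<omega> = 0" if "K i i = 0" for i \<omega>
    proof -
      have "(\<Sum>n<Suc i. c i n * c i n) = 0" using c[of i "Suc i" i] that by simp
      then have "\<forall>n\<in>{..<Suc i}. c i n * c i n = 0" by (subst (asm) sum_nonneg_eq_0_iff) auto
      then show ?thesis by (auto simp: X_def)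
    qed
    fix A :: "nat set" and u :: "nat \<Rightarrow> real" assume A: "finite A"
    obtain m where m: "\<And>i. i \<in> A \<Longrightarrow> i < m" using A by (metis finite_nat_set_iff_bounded)
    define b where "b n = (\<Sum>i\<in>A. u i * c i n)" for n
    have "(\<Sum>i\<in>A. u i * X i \<omega>) = (\<Sum>n<m. b n * \<omega> n)" for \<omega>
    proof -
      have "(\<Sum>i\<in>A. u i * X i \<omega>) = (\<Sum>i\<in>A. \<Sum>n<m. u i * c i n * \<omega> n)"
        by (rule sum.cong) (auto simp: X_eq[OF m] sum_distrib_left mult.assoc)
      also have "\<dots> = (\<Sum>n<m. b n * \<omega> n)"
        by (subst sum.swap) (simp add: b_def sum_distrib_right)
      finally show ?thesis .
    qed
    moreover have "(\<Sum>n<m. (b n)\<^sup>2) = (\<Sum>i\<in>A. \<Sum>j\<in>A. u i * u j * K i j)"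
    proof -
      have "(\<Sum>n<m. (b n)\<^sup>2) = (\<Sum>n<m. \<Sum>i\<in>A. \<Sum>j\<in>A. u i * u j * (c i n * c j n))"
        by (simp add: b_def power2_eq_square sum_product mult_ac)
      also have "\<dots> = (\<Sum>i\<in>A. \<Sum>j\<in>A. \<Sum>n<m. u i * u j * (c i n * c j n))"
        by (subst sum.swap) (subst (2) sum.swap, rule refl)
      also have "\<dots> = (\<Sum>i\<in>A. \<Sum>j\<in>A. u i * u j * K i j)"
        by (intro sum.cong refl) (simp add: c[OF m] sum_distrib_left)
      finally show ?thesis .
    qed
    ultimately show "distr noise_space borel (\<lambda>\<omega>. \<Sum>i\<in>A. u i * X i \<omega>) =
       normal_law 0 (sqrt (\<Sum>i\<in>A. \<Sum>j\<in>A. u i * u j * K i j))"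
      using distr_noise_sum[of b m] by simp
  qed
qed

section \<open>The centre of mass as a weighted sum\<close>

text \<open>Step \<open>m\<close> occurs in the \<open>k - m + 1\<close> partial sums from index
  \<open>m\<close> to \<open>k\<close>. The value 0 for \<open>m > k\<close> lets centres of mass at
  different times be written over one common range of steps.\<close>

definition cm_weight :: "nat \<Rightarrow> nat \<Rightarrow> real" where
  "cm_weight k m = (if 1 \<le> m \<and> m \<le> k then (real k - real m + 1) / real k else 0)"

lemma cm_weight_bounds: "0 \<le> cm_weight k m" "cm_weight k m \<le> 1"
  by (auto simp: cm_weight_def field_simps)

lemma cm_weight_0 [simp]: "cm_weight 0 m = 0"
  by (simp add: cm_weight_def)

lemma sum_walk: "(\<Sum>i=1..k. walk \<xi> i \<omega>) = (\<Sum>m=1..k. (real k - real m + 1) *\<^sub>R \<xi> m \<omega>)"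
proof (induction k)
  case (Suc k)
  have "(\<Sum>m=1..Suc k. (real (Suc k) - real m + 1) *\<^sub>R \<xi> m \<omega>) =
      (\<Sum>m=1..k. (real k - real m + 1) *\<^sub>R \<xi> m \<omega> + \<xi> m \<omega>) + \<xi> (Suc k) \<omega>"
  proof -
    have "(real (Suc k) - real m + 1) *\<^sub>R \<xi> m \<omega> = (real k - real m + 1) *\<^sub>R \<xi> m \<omega> + \<xi> m \<omega>" for m
    proof -
      have "real (Suc k) - real m + 1 = (real k - real m + 1) + 1" by simp
      then show ?thesis by (simp only: scaleR_left_distrib scaleR_one)
    qed
    then show ?thesis by simp
  qed
  then show ?case using Suc by (simp add: walk_def sum.distrib)
qed simp

lemma centre_of_mass_eq_weighted_sum:
  assumes "k \<le> K"
  shows "centre_of_mass \<xi> k \<omega> = (\<Sum>m=1..K. cm_weight k m *\<^sub>R \<xi> m \<omega>)"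
proof -
  have "centre_of_mass \<xi> k \<omega> = (\<Sum>m=1..k. cm_weight k m *\<^sub>R \<xi> m \<omega>)"
    unfolding centre_of_mass_def sum_walk by (auto simp: scaleR_sum_right cm_weight_def intro!: sum.cong)
  also have "\<dots> = (\<Sum>m=1..K. cm_weight k m *\<^sub>R \<xi> m \<omega>)"
    using assms by (intro sum.mono_neutral_left) (auto simp: cm_weight_def)
  finally show ?thesis .
qed

lemma centre_of_mass_0 [simp]: "centre_of_mass \<xi> 0 \<omega> = 0"
  by (simp add: centre_of_mass_def)

text \<open>For an old step the change is \<open>(m - 1) / (k * (k + 1))\<close> in absolute value;
  the new step \<open>m = Suc k\<close> enters with weight exactly
  \<open>1 / (k + 1)\<close>.\<close>

lemma cm_weight_increment:
  assumes "1 \<le> m" "m \<le> Suc k"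
  shows "\<bar>cm_weight (Suc k) m - cm_weight k m\<bar> \<le> 1 / real (Suc k)"
proof (cases "m = Suc k")
  case False
  then have m: "m \<le> k" "k > 0" using assms by auto
  have "cm_weight (Suc k) m - cm_weight k m = (real m - 1) / (real k * real (Suc k))"
    using assms m by (simp add: cm_weight_def field_simps)
  moreover have "(real m - 1) / (real k * real (Suc k)) \<le> real k / (real k * real (Suc k))"
    using m by (intro divide_right_mono) auto
  moreover have "0 \<le> (real m - 1) / (real k * real (Suc k))"
    using assms by simp
  ultimately show ?thesis using m by simp
qed (simp add: cm_weight_def)

lemma sum_shifted_products:
  fixes x y :: real
  shows "6 * (\<Sum>m=1..a. (x - real m) * (y - real m)) =
    6 * real a * x * y - 3 * (x + y) * real a * (real a + 1) + real a * (real a + 1) * (2 * real a + 1)"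
  by (induction a) (simp_all add: algebra_simps)

lemma sum_cm_weight_products:
  assumes "0 < a" "a \<le> b" "a \<le> K"
  shows "(\<Sum>m=1..K. cm_weight a m * cm_weight b m) = (real a + 1) * (3 * real b - real a + 1) / (6 * real b)"
proof -
  have "(\<Sum>m=1..K. cm_weight a m * cm_weight b m) = (\<Sum>m=1..a. cm_weight a m * cm_weight b m)"
    using assms by (intro sum.mono_neutral_right) (auto simp: cm_weight_def)
  also have "\<dots> = (\<Sum>m=1..a. (real a + 1 - real m) * (real b + 1 - real m)) / (real a * real b)"
    unfolding sum_divide_distrib using assms by (intro sum.cong) (auto simp: cm_weight_def algebra_simps)
  also have "(\<Sum>m=1..a. (real a + 1 - real m) * (real b + 1 - real m)) = real a * (real a + 1) * (3 * real b - real a + 1) / 6"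
    using sum_shifted_products[of "real a + 1" "real b + 1" a] by (simp add: algebra_simps)
  finally show ?thesis using assms by simp
qed

text \<open>For \<open>0 < s\<close> and \<open>s \<le> t\<close> this is the integral of
  \<open>(1 - u / s) * (1 - u / t)\<close> over \<open>u\<close> from 0 to \<open>s\<close>, the
  covariance of the running averages of a standard Brownian motion. At \<open>s = t = 0\<close>
  division by zero gives the required 0.\<close>

definition kappa :: "real \<Rightarrow> real \<Rightarrow> real" where
  "kappa s t = min s t * (3 * max s t - min s t) / (6 * max s t)"

lemma kappa_sym: "kappa s t = kappa t s"
  by (simp add: kappa_def min.commute max.commute)

lemma limit_covariance_eq_kappa:
  assumes "0 \<le> s" "0 \<le> t" shows "limit_covariance \<Sigma> s t = kappa s t *\<^sub>R \<Sigma>"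
  using assms by (auto simp: limit_covariance_def kappa_def min_def max_def)

lemma tendsto_floor_div: "(\<lambda>n. real (nat \<lfloor>real n * t\<rfloor>) / real n) \<longlonglongrightarrow> t" if "0 \<le> t"
proof (rule tendsto_sandwich)
  show "(\<lambda>n. t - 1 / real n) \<longlonglongrightarrow> t"
    using tendsto_diff[OF tendsto_const lim_1_over_n] by simp
  show "\<forall>\<^sub>F n in sequentially. t - 1 / real n \<le> real (nat \<lfloor>real n * t\<rfloor>) / real n"
    using eventually_gt_at_top[of 0]
  proof eventually_elim
    case (elim n)
    have "real n * t - 1 \<le> real (nat \<lfloor>real n * t\<rfloor>)" using that by linarith
    then have "(real n * t - 1) / real n \<le> real (nat \<lfloor>real n * t\<rfloor>) / real n" by (rule divide_right_mono) simp
    then show ?case using elim by (simp add: diff_divide_distrib)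
  qed
  show "\<forall>\<^sub>F n in sequentially. real (nat \<lfloor>real n * t\<rfloor>) / real n \<le> t"
    using eventually_gt_at_top[of 0]
  proof eventually_elim
    case (elim n)
    have "real (nat \<lfloor>real n * t\<rfloor>) \<le> real n * t" using that by (simp add: of_nat_floor)
    then show ?case using elim by (simp add: field_simps)
  qed
qed simp

lemma tendsto_cm_weight_products:
  assumes "0 \<le> s" "s \<le> 1" "0 \<le> t" "t \<le> 1"
  shows "(\<lambda>n. (\<Sum>m=1..n. cm_weight (nat \<lfloor>real n * s\<rfloor>) m * cm_weight (nat \<lfloor>real n * t\<rfloor>) m) / real n) \<longlonglongrightarrow> kappa s t"
proof -
  have *: "(\<lambda>n. (\<Sum>m=1..n. cm_weight (nat \<lfloor>real n * s\<rfloor>) m * cm_weight (nat \<lfloor>real n * t\<rfloor>) m) / real n) \<longlonglongrightarrow> kappa s t"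
    if st: "0 \<le> s" "s \<le> t" "t \<le> 1" for s t
  proof (cases "s = 0")
    case True
    then show ?thesis using st by (simp add: kappa_def)
  next
    case False
    then have s: "0 < s" using st by simp
    let ?a = "\<lambda>n. nat \<lfloor>real n * s\<rfloor>" and ?b = "\<lambda>n. nat \<lfloor>real n * t\<rfloor>"
    have a: "(\<lambda>n. real (?a n) / real n) \<longlonglongrightarrow> s" and b: "(\<lambda>n. real (?b n) / real n) \<longlonglongrightarrow> t"
      using tendsto_floor_div st by auto
    have "(\<lambda>n. (real (?a n) / real n + 1 / real n) * (3 * (real (?b n) / real n) - real (?a n) / real n + 1 / real n)
        / (6 * (real (?b n) / real n))) \<longlonglongrightarrow> (s + 0) * (3 * t - s + 0) / (6 * t)"
      by (intro tendsto_intros a b lim_1_over_n) (use s st in simp)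
    moreover have "\<forall>\<^sub>F n in sequentially. (real (?a n) / real n + 1 / real n) * (3 * (real (?b n) / real n) - real (?a n) / real n + 1 / real n)
        / (6 * (real (?b n) / real n)) = (\<Sum>m=1..n. cm_weight (?a n) m * cm_weight (?b n) m) / real n"
      \<comment> \<open>The closed formula needs a positive first index, which holds for large
        \<open>n\<close> because \<open>s > 0\<close>.\<close>
      using order_tendstoD(1)[OF a s] eventually_gt_at_top[of 0]
    proof eventually_elim
      case (elim n)
      have a0: "0 < ?a n" using elim(1) by (cases "?a n = 0") auto
      have ab: "?a n \<le> ?b n" using st by (intro nat_mono floor_mono mult_left_mono) auto
      have an: "?a n \<le> n" using st nat_floor_grid[of s n] by auto
      have eq: "(x / N + 1 / N) * (3 * (y / N) - x / N + 1 / N) / (6 * (y / N)) = (x + 1) * (3 * y - x + 1) / (6 * y) / N"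
        if "N > 0" "y > 0" for x y N :: real
        using that by (simp add: divide_simps)
      show ?case unfolding sum_cm_weight_products[OF a0 ab an]
      proof (rule eq)
        show "0 < real n" "0 < real (?b n)" using elim(2) a0 ab by linarith+
      qed
    qed
    ultimately have "(\<lambda>n. (\<Sum>m=1..n. cm_weight (?a n) m * cm_weight (?b n) m) / real n) \<longlonglongrightarrow> (s + 0) * (3 * t - s + 0) / (6 * t)"
      by (rule Lim_transform_eventually)
    then show ?thesis using st by (simp add: kappa_def min_def max_def)
  qed
  show ?thesis
  proof (cases "s \<le> t")
    case True then show ?thesis using *[of s t] assms by simp
  next
    case False then show ?thesis using *[of t s] assms by (simp add: kappa_sym[of s t] mult.commute)
  qed
qed

section \<open>Oscillation of the centre of mass\<close>

lemma inverse_sqrt_le: "1 / sqrt (real m + 1) \<le> 2 * (sqrt (real m + 1) - sqrt (real m))"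
proof -
  let ?x = "sqrt (real m + 1)" and ?y = "sqrt (real m)"
  have x: "?x > 0" by simp
  have "(?x - ?y) * (?x + ?y) = 1" by (simp add: algebra_simps)
  moreover have "(?x - ?y) * (?x + ?y) \<le> (?x - ?y) * (2 * ?x)"
    by (intro mult_left_mono) auto
  ultimately show ?thesis using x by (simp add: field_simps)
qed

lemma sum_inverse_sqrt_le:
  assumes "a \<le> b"
  shows "(\<Sum>m=a..<b. 1 / sqrt (real m + 1)) \<le> 2 * (sqrt (real b) - sqrt (real a))"
proof -
  have "(\<Sum>m=a..<b. 1 / sqrt (real m + 1)) \<le> (\<Sum>m=a..<b. 2 * (sqrt (real m + 1) - sqrt (real m)))"
    by (intro sum_mono inverse_sqrt_le)
  also have "\<dots> = 2 * (\<Sum>m=a..<b. sqrt (real (Suc m)) - sqrt (real m))"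
    by (simp add: sum_distrib_left add.commute)
  also have "(\<Sum>m=a..<b. sqrt (real (Suc m)) - sqrt (real m)) = sqrt (real b) - sqrt (real a)"
    using sum_Suc_diff'[OF assms, of "\<lambda>m. sqrt (real m)"] by simp
  finally show ?thesis .
qed

text \<open>The weight is a compromise. With mean squared increments of order
  \<open>1 / (m + 1)\<close> the sum has expectation of order \<open>sqrt n\<close>, while the
  reciprocal weights over any block add up to a multiple of the root of its length. Weight 1 would
  leave a factor \<open>log n\<close>.\<close>

definition weighted_variation :: "nat \<Rightarrow> (nat \<Rightarrow> 'v::real_normed_vector) \<Rightarrow> real" where
  "weighted_variation n g = (\<Sum>m<n. sqrt (real m + 1) * (norm (g (Suc m) - g m))\<^sup>2)"

text \<open>Cauchy-Schwarz after splitting off \<open>?r m\<close>, the fourth root of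
  \<open>m + 1\<close>. The random factor on the right does not depend on the block, so a single
  variable controls all blocks at once and stands in for a maximal inequality.\<close>

lemma increment_le_weighted_variation:
  assumes "a \<le> b" "b \<le> n"
  shows "(norm (g b - g a))\<^sup>2 \<le> 2 * sqrt (real (b - a)) * weighted_variation n g"
proof -
  let ?d = "\<lambda>m. norm (g (Suc m) - g m)" and ?r = "\<lambda>m. sqrt (sqrt (real m + 1))"
  have "g b - g a = (\<Sum>m=a..<b. g (Suc m) - g m)"
    using sum_Suc_diff'[OF assms(1), of g] by simp
  then have "norm (g b - g a) \<le> (\<Sum>m=a..<b. ?d m)" by (simp add: norm_sum)
  then have "(norm (g b - g a))\<^sup>2 \<le> (\<Sum>m=a..<b. ?d m)\<^sup>2" by (rule power_mono) simp
  also have "(\<Sum>m=a..<b. ?d m) = (\<Sum>m=a..<b. (1 / ?r m) * (?r m * ?d m))"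
    by (intro sum.cong) auto
  also have "\<dots>\<^sup>2 \<le> (\<Sum>m=a..<b. (1 / ?r m)\<^sup>2) * (\<Sum>m=a..<b. (?r m * ?d m)\<^sup>2)"
    by (rule Cauchy_Schwarz_ineq_sum)
  also have "(\<Sum>m=a..<b. (1 / ?r m)\<^sup>2) = (\<Sum>m=a..<b. 1 / sqrt (real m + 1))"
    by (simp add: power_divide)
  also have "(\<Sum>m=a..<b. (?r m * ?d m)\<^sup>2) = (\<Sum>m=a..<b. sqrt (real m + 1) * (?d m)\<^sup>2)"
    by (simp add: power_mult_distrib)
  also have "(\<Sum>m=a..<b. 1 / sqrt (real m + 1)) * (\<Sum>m=a..<b. sqrt (real m + 1) * (?d m)\<^sup>2)
      \<le> (2 * sqrt (real (b - a))) * weighted_variation n g"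
  proof (rule mult_mono)
    \<comment> \<open>Subadditivity of the root removes the dependence on the position of the
      block.\<close>
    have "sqrt (real b) \<le> sqrt (real (b - a)) + sqrt (real a)"
      using sqrt_add_le_add_sqrt[of "real (b - a)" "real a"] assms by (simp add: of_nat_diff)
    then have "2 * (sqrt (real b) - sqrt (real a)) \<le> 2 * sqrt (real (b - a))" by simp
    then show "(\<Sum>m=a..<b. 1 / sqrt (real m + 1)) \<le> 2 * sqrt (real (b - a))"
      by (rule order_trans[OF sum_inverse_sqrt_le[OF assms(1)]])
    show "(\<Sum>m=a..<b. sqrt (real m + 1) * (?d m)\<^sup>2) \<le> weighted_variation n g"
      unfolding weighted_variation_def using assms by (intro sum_mono2) auto
  qed (auto intro: sum_nonneg)
  finally show ?thesis .
qed

text \<open>Nonnegativity of the variance. A majorant \<open>W\<close> of the square is allowed, so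
  \<open>X\<close> can be a difference of function values while \<open>W\<close> stems from a bound
  on a distance.\<close>

lemma (in prob_space) abs_expectation_le_sqrt:
  assumes X [measurable]: "X \<in> borel_measurable M" and W: "integrable M W" and le: "\<And>\<omega>. (X \<omega>)\<^sup>2 \<le> W \<omega>"
  shows "integrable M X" "\<bar>expectation X\<bar> \<le> sqrt (expectation W)"
proof -
  have nonneg: "0 \<le> W \<omega>" for \<omega> using le[of \<omega>] zero_le_power2 order_trans by blast
  have X2: "integrable M (\<lambda>\<omega>. (X \<omega>)\<^sup>2)"
    by (rule Bochner_Integration.integrable_bound[OF W]) (auto simp: le nonneg)
  show X1: "integrable M X" by (rule square_integrable_imp_integrable[OF X X2])
  have "(expectation X)\<^sup>2 \<le> expectation (\<lambda>\<omega>. (X \<omega>)\<^sup>2)"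
    using variance_eq[OF X1 X2] variance_positive[of X] by simp
  also have "\<dots> \<le> expectation W" by (rule integral_mono[OF X2 W le])
  finally show "\<bar>expectation X\<bar> \<le> sqrt (expectation W)" by (metis real_sqrt_abs real_sqrt_le_iff)
qed

context centred_iid
begin

lemma measurable_centre_of_mass [measurable]: "centre_of_mass \<xi> k \<in> borel_measurable M"
  unfolding centre_of_mass_eq_weighted_sum[OF order_refl, abs_def] by measurable

lemma measurable_centre_of_mass_path [measurable]: "centre_of_mass_path \<xi> n \<in> borel_measurable M"
  unfolding centre_of_mass_path_eq_step_path[abs_def] by (rule measurable_step_path) simp

lemma centre_of_mass_increment:
  shows "integrable M (\<lambda>\<omega>. (norm (centre_of_mass \<xi> (Suc k) \<omega> - centre_of_mass \<xi> k \<omega>))\<^sup>2)"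
    and "(LINT \<omega>|M. (norm (centre_of_mass \<xi> (Suc k) \<omega> - centre_of_mass \<xi> k \<omega>))\<^sup>2) \<le> mean_square / real (Suc k)"
proof -
  let ?c = "\<lambda>m. cm_weight (Suc k) m - cm_weight k m"
  have eq: "centre_of_mass \<xi> (Suc k) \<omega> - centre_of_mass \<xi> k \<omega> = (\<Sum>m\<in>{1..Suc k}. ?c m *\<^sub>R \<xi> m \<omega>)" for \<omega>
    unfolding centre_of_mass_eq_weighted_sum[of k "Suc k", OF le_SucI[OF order_refl]]
      centre_of_mass_eq_weighted_sum[of "Suc k" "Suc k", OF order_refl]
    by (simp only: scaleR_left_diff_distrib sum_subtractf)
  show "integrable M (\<lambda>\<omega>. (norm (centre_of_mass \<xi> (Suc k) \<omega> - centre_of_mass \<xi> k \<omega>))\<^sup>2)"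
    unfolding eq by (rule weighted_sum_sq) simp
  have "(\<Sum>m\<in>{1..Suc k}. (?c m)\<^sup>2) \<le> (\<Sum>m\<in>{1..Suc k}. (1 / real (Suc k))\<^sup>2)"
    using cm_weight_increment by (intro sum_mono) (auto simp: abs_le_square_iff[symmetric] simp del: of_nat_Suc)
  also have "\<dots> = 1 / real (Suc k)" by (simp add: power2_eq_square del: of_nat_Suc)
  finally have "(\<Sum>m\<in>{1..Suc k}. (?c m)\<^sup>2) * mean_square \<le> 1 / real (Suc k) * mean_square"
    by (rule mult_right_mono[OF _ mean_square_nonneg])
  then show "(LINT \<omega>|M. (norm (centre_of_mass \<xi> (Suc k) \<omega> - centre_of_mass \<xi> k \<omega>))\<^sup>2) \<le> mean_square / real (Suc k)"
    unfolding eq by (subst weighted_sum_sq) simp_all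
qed

lemma weighted_variation_centre_of_mass:
  shows "integrable M (\<lambda>\<omega>. weighted_variation n (\<lambda>k. centre_of_mass \<xi> k \<omega>))"
    and "(LINT \<omega>|M. weighted_variation n (\<lambda>k. centre_of_mass \<xi> k \<omega>)) \<le> 2 * mean_square * sqrt (real n)"
proof -
  show "integrable M (\<lambda>\<omega>. weighted_variation n (\<lambda>k. centre_of_mass \<xi> k \<omega>))"
    unfolding weighted_variation_def
    by (intro Bochner_Integration.integrable_sum integrable_mult_right centre_of_mass_increment)
  have "(LINT \<omega>|M. weighted_variation n (\<lambda>k. centre_of_mass \<xi> k \<omega>)) =
      (\<Sum>m<n. sqrt (real m + 1) * (LINT \<omega>|M. (norm (centre_of_mass \<xi> (Suc m) \<omega> - centre_of_mass \<xi> m \<omega>))\<^sup>2))"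
    unfolding weighted_variation_def
    by (subst Bochner_Integration.integral_sum) (auto intro!: centre_of_mass_increment)
  also have "\<dots> \<le> (\<Sum>m<n. sqrt (real m + 1) * (mean_square / real (Suc m)))"
    by (intro sum_mono mult_left_mono centre_of_mass_increment) simp
  also have "\<dots> = mean_square * (\<Sum>m=0..<n. 1 / sqrt (real m + 1))"
  proof -
    have "sqrt (real m + 1) * (mean_square / real (Suc m)) = mean_square * (1 / sqrt (real m + 1))" for m
    proof -
      have "real (Suc m) = sqrt (real m + 1) * sqrt (real m + 1)" by simp
      then show ?thesis by (simp add: field_simps)
    qed
    then show ?thesis by (simp only: sum_distrib_left atLeast0LessThan)
  qed
  also have "\<dots> \<le> mean_square * (2 * (sqrt (real n) - sqrt (real 0)))"
    by (intro mult_left_mono sum_inverse_sqrt_le mean_square_nonneg) simp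
  finally show "(LINT \<omega>|M. weighted_variation n (\<lambda>k. centre_of_mass \<xi> k \<omega>)) \<le> 2 * mean_square * sqrt (real n)"
    by (simp add: mult_ac)
qed

section \<open>Comparison of the process with its restriction to a coarse time grid\<close>

definition grid_path :: "nat \<Rightarrow> nat \<Rightarrow> 'a \<Rightarrow> 'd cadlag0" where
  "grid_path k n \<omega> = step_path k (\<lambda>j. (1 / sqrt (real n)) *\<^sub>R centre_of_mass \<xi> (nat \<lfloor>real n * (real j / real k)\<rfloor>) \<omega>)"

lemma measurable_grid_path [measurable]: "grid_path k n \<in> borel_measurable M"
  unfolding grid_path_def[abs_def] by (rule measurable_step_path) simp

text \<open>At time \<open>t\<close> the two paths show the centre of mass at indices
  \<open>?b\<close> and \<open>?a\<close>, which differ by at most \<open>n / k\<close> for the grid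
  cell plus 1 for rounding; then \<open>increment_le_weighted_variation\<close> applies uniformly in
  \<open>t\<close>.\<close>

lemma dist_grid_path:
  assumes n: "n > 0" and k: "k > 0"
  shows "(dist (centre_of_mass_path \<xi> n \<omega>) (grid_path k n \<omega>))\<^sup>2 \<le>
    2 * sqrt (real n / real k + 1) / real n * weighted_variation n (\<lambda>k. centre_of_mass \<xi> k \<omega>)"
    (is "_ \<le> ?W")
proof -
  let ?g = "\<lambda>k. centre_of_mass \<xi> k \<omega>"
  have wv: "0 \<le> weighted_variation n ?g" by (simp add: weighted_variation_def sum_nonneg)
  have "dist (centre_of_mass_path \<xi> n \<omega>) (grid_path k n \<omega>) \<le> sqrt ?W"
  proof (rule dist_le_uniform)
    fix t :: real assume t: "t \<in> {0..1}"
    let ?b = "nat \<lfloor>real n * t\<rfloor>" and ?j = "nat \<lfloor>real k * t\<rfloor>"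
    let ?a = "nat \<lfloor>real n * (real ?j / real k)\<rfloor>"
    have j: "real ?j \<le> real k * t" "real k * t \<le> real ?j + 1"
      using t by (simp_all add: of_nat_floor)
    have jk: "real ?j / real k \<le> t" "t \<le> real ?j / real k + 1 / real k"
      using j k by (simp_all add: field_simps)
    have ab: "?a \<le> ?b" using jk by (intro nat_mono floor_mono mult_left_mono) auto
    have bn: "?b \<le> n" using nat_floor_grid[OF t] .
    have "real n * t \<le> real n * (real ?j / real k) + real n / real k"
      using mult_left_mono[OF jk(2), of "real n"] by (simp add: algebra_simps)
    moreover have "real ?b \<le> real n * t" using t by (simp add: of_nat_floor)
    moreover have "real n * (real ?j / real k) \<le> real ?a + 1" by linarith
    ultimately have diff: "real (?b - ?a) \<le> real n / real k + 1" unfolding of_nat_diff[OF ab] by linarith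
    have eq: "path_of (centre_of_mass_path \<xi> n \<omega>) t - path_of (grid_path k n \<omega>) t
        = (1 / sqrt (real n)) *\<^sub>R (?g ?b - ?g ?a)"
    proof -
      have "path_of (grid_path k n \<omega>) t = (if ?j = 0 then 0 else (1 / sqrt (real n)) *\<^sub>R ?g ?a)"
        unfolding grid_path_def path_of_step_path by (rule restrict_apply'[OF t])
      \<comment> \<open>The zero that \<open>step_path\<close> inserts at index 0 is the true value
        there.\<close>
      moreover have "?g ?a = 0" if j0: "?j = 0"
      proof -
        have "?a = 0" unfolding j0 by simp
        then show ?thesis by (simp only: centre_of_mass_0)
      qed
      ultimately have "path_of (grid_path k n \<omega>) t = (1 / sqrt (real n)) *\<^sub>R ?g ?a"
        by (metis scaleR_zero_right)
      moreover have "path_of (centre_of_mass_path \<xi> n \<omega>) t = (1 / sqrt (real n)) *\<^sub>R ?g ?b"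
        unfolding path_of_centre_of_mass_path by (rule restrict_apply'[OF t])
      ultimately show ?thesis by (simp only: scaleR_right_diff_distrib)
    qed
    have "(norm ((1 / sqrt (real n)) *\<^sub>R (?g ?b - ?g ?a)))\<^sup>2 = (norm (?g ?b - ?g ?a))\<^sup>2 / real n"
      by (simp add: power_mult_distrib power_divide)
    also have "\<dots> \<le> (2 * sqrt (real (?b - ?a)) * weighted_variation n ?g) / real n"
      by (intro divide_right_mono increment_le_weighted_variation ab bn) simp
    also have "\<dots> \<le> (2 * sqrt (real n / real k + 1) * weighted_variation n ?g) / real n"
      using diff wv by (intro divide_right_mono mult_right_mono mult_left_mono) auto
    also have "\<dots> = ?W" by simp
    finally show "norm (path_of (centre_of_mass_path \<xi> n \<omega>) t - path_of (grid_path k n \<omega>) t) \<le> sqrt ?W"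
      unfolding eq by (rule real_le_rsqrt)
  qed
  then have "(dist (centre_of_mass_path \<xi> n \<omega>) (grid_path k n \<omega>))\<^sup>2 \<le> (sqrt ?W)\<^sup>2"
    by (rule power_mono) simp
  also have "\<dots> = ?W" using wv by simp
  finally show ?thesis .
qed

text \<open>The Lipschitz bound is squared pointwise before integration. The random distance between
  the two paths is never integrated, so its measurability does not come up.\<close>

lemma expectation_grid_path:
  fixes f :: "'d cadlag0 \<Rightarrow> real"
  assumes lip: "\<And>x y. \<bar>f x - f y\<bar> \<le> C * dist x y" and bnd: "\<And>x. \<bar>f x\<bar> \<le> B" and C: "0 \<le> C"
    and n: "n > 0" and k: "k > 0"
  shows "\<bar>(LINT \<omega>|M. f (centre_of_mass_path \<xi> n \<omega>)) - (LINT \<omega>|M. f (grid_path k n \<omega>))\<bar>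
    \<le> C * sqrt (4 * mean_square * sqrt (1 / real k + 1 / real n))"
proof -
  have fc: "continuous_on UNIV f" by (rule lipschitz_continuous_on[OF lip])
  let ?V = "\<lambda>\<omega>. weighted_variation n (\<lambda>k. centre_of_mass \<xi> k \<omega>)"
  let ?W = "\<lambda>\<omega>. C\<^sup>2 * (2 * sqrt (real n / real k + 1) / real n * ?V \<omega>)"
  have i: "integrable M (\<lambda>\<omega>. f (centre_of_mass_path \<xi> n \<omega>))" "integrable M (\<lambda>\<omega>. f (grid_path k n \<omega>))"
    by (rule integrable_continuous_bounded[OF fc bnd]; measurable)+
  have le: "(f (centre_of_mass_path \<xi> n \<omega>) - f (grid_path k n \<omega>))\<^sup>2 \<le> ?W \<omega>" for \<omega>
  proof -
    have "\<bar>f (centre_of_mass_path \<xi> n \<omega>) - f (grid_path k n \<omega>)\<bar>\<^sup>2 \<le>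
        (C * dist (centre_of_mass_path \<xi> n \<omega>) (grid_path k n \<omega>))\<^sup>2"
      by (intro power_mono lip) simp
    also have "\<dots> \<le> ?W \<omega>"
      unfolding power_mult_distrib by (intro mult_left_mono dist_grid_path n k) simp
    finally show ?thesis by simp
  qed
  have "\<bar>LINT \<omega>|M. f (centre_of_mass_path \<xi> n \<omega>) - f (grid_path k n \<omega>)\<bar> \<le> sqrt (LINT \<omega>|M. ?W \<omega>)"
    by (rule abs_expectation_le_sqrt[OF _ _ le])
      (use i weighted_variation_centre_of_mass in \<open>auto simp del: times_divide_eq_left\<close>)
  also have "(LINT \<omega>|M. ?W \<omega>) = C\<^sup>2 * (2 * sqrt (real n / real k + 1) / real n * (LINT \<omega>|M. ?V \<omega>))"
    by (simp only: integral_mult_right_zero)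
  also have "sqrt (C\<^sup>2 * (2 * sqrt (real n / real k + 1) / real n * (LINT \<omega>|M. ?V \<omega>)))
      \<le> sqrt (C\<^sup>2 * (2 * sqrt (real n / real k + 1) / real n * (2 * mean_square * sqrt (real n))))"
    by (intro real_sqrt_le_mono mult_left_mono weighted_variation_centre_of_mass) auto
  also have "2 * sqrt (real n / real k + 1) / real n * (2 * mean_square * sqrt (real n))
      = 4 * mean_square * sqrt (1 / real k + 1 / real n)"
  proof -
    have "1 / real k + 1 / real n = (real n / real k + 1) / real n" using n by (simp add: field_simps)
    then have "sqrt (1 / real k + 1 / real n) = sqrt (real n / real k + 1) / sqrt (real n)"
      by (simp only: real_sqrt_divide)
    moreover have "sqrt (real n) / real n = 1 / sqrt (real n)" using n by (simp add: sqrt_divide_self_eq inverse_eq_divide)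
    moreover have "2 * sqrt (real n / real k + 1) / real n * (2 * mean_square * sqrt (real n))
        = 4 * mean_square * (sqrt (real n / real k + 1) * (sqrt (real n) / real n))"
      by simp
    ultimately show ?thesis by simp
  qed
  also have "sqrt (C\<^sup>2 * (4 * mean_square * sqrt (1 / real k + 1 / real n))) = C * sqrt (4 * mean_square * sqrt (1 / real k + 1 / real n))"
    using C by (simp add: real_sqrt_mult)
  finally show ?thesis using i by simp
qed

section \<open>Finite-dimensional distributions of the centre of mass\<close>

text \<open>Times \<open>t p\<close> and coordinates \<open>k p\<close> share one index
  \<open>p\<close>, so a family of random vectors becomes a sequence of scalars, as the Cholesky
  construction and \<open>cf_convergence\<close> require.\<close>

definition fdd :: "(nat \<Rightarrow> real) \<Rightarrow> (nat \<Rightarrow> 'd) \<Rightarrow> nat \<Rightarrow> 'a \<Rightarrow> nat \<Rightarrow> real" where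
  "fdd t k n \<omega> p = (1 / sqrt (real n)) * centre_of_mass \<xi> (nat \<lfloor>real n * t p\<rfloor>) \<omega> $ k p"

text \<open>The coefficient of step \<open>m\<close> in the linear functional \<open>u\<close> of
  the scalars \<open>fdd\<close>: a functional of finitely many values of the process is a single
  weighted sum of the steps (\<open>linear_form_fdd\<close>).\<close>

definition fdd_weight :: "(nat \<Rightarrow> real) \<Rightarrow> (nat \<Rightarrow> 'd) \<Rightarrow> nat set \<Rightarrow> (nat \<Rightarrow> real) \<Rightarrow> nat \<Rightarrow> nat \<Rightarrow> real ^ 'd" where
  "fdd_weight t k A u n m = (\<Sum>p\<in>A. (u p * cm_weight (nat \<lfloor>real n * t p\<rfloor>) m / sqrt (real n)) *\<^sub>R axis (k p) 1)"

definition fdd_kernel :: "(nat \<Rightarrow> real) \<Rightarrow> (nat \<Rightarrow> 'd) \<Rightarrow> nat \<Rightarrow> nat \<Rightarrow> real" where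
  "fdd_kernel t k p r = kappa (t p) (t r) * \<Sigma> $ k p $ k r"

lemma measurable_fdd: "(\<lambda>\<omega>. fdd t k n \<omega> p) \<in> borel_measurable M"
proof -
  have "(\<lambda>\<omega>. centre_of_mass \<xi> j \<omega> $ k p) \<in> borel_measurable M" for j
    by (rule measurable_compose[OF measurable_centre_of_mass measurable_vec_nth])
  then show ?thesis unfolding fdd_def by (rule borel_measurable_times[OF borel_measurable_const])
qed

lemma linear_form_fdd:
  assumes "\<And>p. t p \<in> {0..1}"
  shows "linear_form A u (fdd t k n \<omega>) = (\<Sum>m=1..n. fdd_weight t k A u n m \<bullet> \<xi> m \<omega>)"
proof -
  have "fdd t k n \<omega> p = (\<Sum>m=1..n. cm_weight (nat \<lfloor>real n * t p\<rfloor>) m / sqrt (real n) * \<xi> m \<omega> $ k p)" for p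
    unfolding fdd_def centre_of_mass_eq_weighted_sum[OF nat_floor_grid[OF assms]]
    by (simp add: sum_distrib_left)
  then have "linear_form A u (fdd t k n \<omega>) =
      (\<Sum>p\<in>A. \<Sum>m=1..n. u p * cm_weight (nat \<lfloor>real n * t p\<rfloor>) m / sqrt (real n) * \<xi> m \<omega> $ k p)"
    by (simp add: linear_form_def sum_distrib_left mult.assoc)
  also have "\<dots> = (\<Sum>m=1..n. fdd_weight t k A u n m \<bullet> \<xi> m \<omega>)"
    by (subst sum.swap) (simp add: fdd_weight_def inner_sum_left inner_axis')
  finally show ?thesis .
qed

lemma norm_fdd_weight: "norm (fdd_weight t k A u n m) \<le> (\<Sum>p\<in>A. \<bar>u p\<bar>) / sqrt (real n)"
proof -
  have "norm (fdd_weight t k A u n m) \<le> (\<Sum>p\<in>A. \<bar>u p\<bar> / sqrt (real n))"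
    unfolding fdd_weight_def
  proof (rule order_trans[OF norm_sum sum_mono])
    fix p
    have "\<bar>u p\<bar> * cm_weight (nat \<lfloor>real n * t p\<rfloor>) m \<le> \<bar>u p\<bar> * 1"
      by (intro mult_left_mono cm_weight_bounds) simp
    then show "norm ((u p * cm_weight (nat \<lfloor>real n * t p\<rfloor>) m / sqrt (real n)) *\<^sub>R axis (k p) (1 :: real)) \<le> \<bar>u p\<bar> / sqrt (real n)"
      using cm_weight_bounds(1) by (simp add: abs_mult norm_axis_1 divide_right_mono)
  qed
  then show ?thesis by (simp add: sum_divide_distrib)
qed

lemma fdd_variance:
  assumes t: "\<And>p. t p \<in> {0..1}" and A: "finite A"
  shows "(\<lambda>n. \<Sum>m=1..n. quadratic (fdd_weight t k A u n m)) \<longlonglongrightarrow>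
    (\<Sum>p\<in>A. \<Sum>r\<in>A. u p * u r * fdd_kernel t k p r)"
proof -
  let ?w = "\<lambda>n p. cm_weight (nat \<lfloor>real n * t p\<rfloor>)"
  have eq: "(\<Sum>m=1..n. quadratic (fdd_weight t k A u n m)) =
      (\<Sum>p\<in>A. \<Sum>r\<in>A. u p * u r * ((\<Sum>m=1..n. ?w n p m * ?w n r m) / real n * \<Sigma> $ k p $ k r))" for n
  proof -
    have "(\<Sum>m=1..n. quadratic (fdd_weight t k A u n m)) =
      (\<Sum>m=1..n. \<Sum>p\<in>A. \<Sum>r\<in>A. u p * u r * (?w n p m * ?w n r m / real n * \<Sigma> $ k p $ k r))"
      unfolding fdd_weight_def quadratic_sum[OF A]
    proof (intro sum.cong refl)
      fix m p r
      have "sqrt (real n) * sqrt (real n) = real n" by simp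
      then show "u p * ?w n p m / sqrt (real n) * (u r * ?w n r m / sqrt (real n)) * \<Sigma> $ k p $ k r
        = u p * u r * (?w n p m * ?w n r m / real n * \<Sigma> $ k p $ k r)"
        by (simp add: mult_ac)
    qed
    also have "\<dots> = (\<Sum>p\<in>A. \<Sum>r\<in>A. \<Sum>m=1..n. u p * u r * (?w n p m * ?w n r m / real n * \<Sigma> $ k p $ k r))"
      by (subst sum.swap) (subst (2) sum.swap, rule refl)
    also have "\<dots> = (\<Sum>p\<in>A. \<Sum>r\<in>A. u p * u r * ((\<Sum>m=1..n. ?w n p m * ?w n r m) / real n * \<Sigma> $ k p $ k r))"
      by (intro sum.cong refl) (simp add: sum_distrib_left sum_distrib_right sum_divide_distrib)
    finally show ?thesis .
  qed
  show ?thesis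
    unfolding eq fdd_kernel_def
    by (intro tendsto_sum tendsto_mult_left tendsto_mult_right tendsto_cm_weight_products) (use t in auto)
qed

lemma positive_semidefinite_fdd_kernel:
  assumes "\<And>p. t p \<in> {0..1}"
  shows "positive_semidefinite (fdd_kernel t k)"
  unfolding positive_semidefinite_def
proof (intro conjI allI impI)
  show "fdd_kernel t k p r = fdd_kernel t k r p" for p r
    using covariance_sym[of "k p" "k r"] by (simp add: fdd_kernel_def kappa_sym[of "t p"])
  show "0 \<le> (\<Sum>p\<in>A. \<Sum>r\<in>A. u p * u r * fdd_kernel t k p r)" if "finite A" for A u
    by (rule LIMSEQ_le_const[OF fdd_variance[OF assms that]]) (auto intro!: sum_nonneg quadratic_nonneg)
qed

lemma fdd_cf:
  assumes t: "\<And>p. t p \<in> {0..1}" and A: "finite A"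
  shows "(\<lambda>n. LINT \<omega>|M. cis (linear_form A u (fdd t k n \<omega>))) \<longlonglongrightarrow>
    complex_of_real (exp (- (\<Sum>p\<in>A. \<Sum>r\<in>A. u p * u r * fdd_kernel t k p r) / 2))"
  unfolding linear_form_fdd[OF t]
  by (rule cf_convergence_array[OF norm_fdd_weight _ fdd_variance[OF t A]]) (simp add: sum_nonneg)

text \<open>The weights are at most \<open>1 / sqrt n\<close> for \<open>n\<close> steps, so the
  bound is uniform in \<open>n\<close>, as \<open>lipschitz_convergence\<close> demands.\<close>

lemma fdd_second_moment:
  assumes t: "\<And>p. t p \<in> {0..1}"
  shows "integrable M (\<lambda>\<omega>. (fdd t k n \<omega> p)\<^sup>2)" "(LINT \<omega>|M. (fdd t k n \<omega> p)\<^sup>2) \<le> mean_square"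
proof -
  have eq: "fdd t k n \<omega> p = (\<Sum>m\<in>{1..n}. fdd_weight t k {p} (\<lambda>_. 1) n m \<bullet> \<xi> m \<omega>)" for \<omega>
    using linear_form_fdd[OF t, where A = "{p}" and u = "\<lambda>_. 1" and k = k and n = n and \<omega> = \<omega>] by (simp add: linear_form_def)
  show "integrable M (\<lambda>\<omega>. (fdd t k n \<omega> p)\<^sup>2)"
    unfolding eq by (rule sum_inner_sq) simp
  have "(LINT \<omega>|M. (fdd t k n \<omega> p)\<^sup>2) = (\<Sum>m\<in>{1..n}. quadratic (fdd_weight t k {p} (\<lambda>_. 1) n m))"
    unfolding eq by (rule sum_inner_sq) simp
  also have "\<dots> \<le> (\<Sum>m\<in>{1..n}. (1 / sqrt (real n))\<^sup>2 * mean_square)"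
    using norm_fdd_weight[where A = "{p}" and u = "\<lambda>_. 1" and t = t and k = k and n = n]
    by (intro sum_mono order_trans[OF quadratic_le] mult_right_mono power_mono mean_square_nonneg) auto
  also have "\<dots> \<le> mean_square" using mean_square_nonneg by (simp add: power_divide)
  finally show "(LINT \<omega>|M. (fdd t k n \<omega> p)\<^sup>2) \<le> mean_square" .
qed

end

section \<open>Uniform limits of paths\<close>

text \<open>The Skorokhod metric used here is not complete, so the Cauchy property is exploited in
  supremum norm: the Weierstrass test gives a uniform limit, and uniform limits preserve one-sided
  limits.\<close>

lemma cadlag0_limit:
  fixes z :: "nat \<Rightarrow> 'd::finite cadlag0"
  assumes D: "summable D"
    and le: "\<And>J t. t \<in> {0..1} \<Longrightarrow> norm (path_of (z (Suc J)) t - path_of (z J) t) \<le> D J"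
  obtains x where "z \<longlonglongrightarrow> x" "\<And>t. t \<in> {0..1} \<Longrightarrow> (\<lambda>J. path_of (z J) t) \<longlonglongrightarrow> path_of x t"
proof -
  define g where "g = (\<lambda>t\<in>{0..1}. path_of (z 0) t + (\<Sum>i. path_of (z (Suc i)) t - path_of (z i) t))"
  have u: "uniform_limit {0..1} (\<lambda>J. path_of (z J)) g sequentially"
  proof -
    have "uniform_limit {0..1} (\<lambda>J t. \<Sum>i<J. path_of (z (Suc i)) t - path_of (z i) t)
        (\<lambda>t. \<Sum>i. path_of (z (Suc i)) t - path_of (z i) t) sequentially"
      by (rule Weierstrass_m_test[OF le D])
    moreover have "uniform_limit {0..1} (\<lambda>J :: nat. path_of (z 0)) (path_of (z 0)) sequentially"
      by (rule uniform_limit_const)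
    ultimately have "uniform_limit {0..1} (\<lambda>J t. path_of (z 0) t + (\<Sum>i<J. path_of (z (Suc i)) t - path_of (z i) t))
        (\<lambda>t. path_of (z 0) t + (\<Sum>i. path_of (z (Suc i)) t - path_of (z i) t)) sequentially"
      by (rule uniform_limit_add[rotated])
    moreover have "path_of (z 0) t + (\<Sum>i<J. path_of (z (Suc i)) t - path_of (z i) t) = path_of (z J) t" for J t
      using sum_lessThan_telescope[of "\<lambda>i. path_of (z i) t" J] by simp
    ultimately show ?thesis
      by (subst uniform_limit_cong'[where g = "\<lambda>J t. path_of (z 0) t + (\<Sum>i<J. path_of (z (Suc i)) t - path_of (z i) t)"
            and i = "\<lambda>t. path_of (z 0) t + (\<Sum>i. path_of (z (Suc i)) t - path_of (z i) t)"])
        (simp_all add: g_def)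
  qed
  have pt: "(\<lambda>J. path_of (z J) t) \<longlonglongrightarrow> g t" if "t \<in> {0..1}" for t
    by (rule tendsto_uniform_limitI[OF u that])
  have "cadlag g" unfolding cadlag_def
  proof (intro conjI ballI)
    fix t :: real assume t: "t \<in> {0..<1}"
    show "(g \<longlongrightarrow> g t) (at_right t)"
    proof (rule swap_uniform_limit'[OF _ pt u])
      show "\<forall>\<^sub>F J in sequentially. (path_of (z J) \<longlongrightarrow> path_of (z J) t) (at_right t)"
      proof (rule always_eventually, rule allI)
        fix J show "(path_of (z J) \<longlongrightarrow> path_of (z J) t) (at_right t)"
          using path_props(2)[of "z J"] t unfolding cadlag_def by blast
      qed
      show "\<forall>\<^sub>F s in at_right t. s \<in> {0..1}"
        by (rule eventually_mono[OF eventually_at_right_real[of t 1]]) (use t in auto)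
    qed (use t in auto)
  next
    fix t :: real assume t: "t \<in> {0<..1}"
    have "\<exists>l. (path_of (z J) \<longlongrightarrow> l) (at_left t)" for J
      using path_props(2)[of "z J"] t unfolding cadlag_def by blast
    then obtain L where L: "\<And>J. (path_of (z J) \<longlongrightarrow> L J) (at_left t)" by metis
    have ev: "\<forall>\<^sub>F s in at_left t. s \<in> {0..1}"
      by (rule eventually_mono[OF eventually_at_left_real[of 0 t]]) (use t in auto)
    \<comment> \<open>The left limits inherit the summable bound and hence converge, which permits
      interchanging the two limits.\<close>
    have "norm (L (Suc J) - L J) \<le> D J" for J
      by (rule tendsto_upperbound[OF tendsto_norm[OF tendsto_diff[OF L L]]])
        (use le in \<open>auto intro: eventually_mono[OF ev]\<close>)
    then have "summable (\<lambda>J. L (Suc J) - L J)"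
      by (intro summable_comparison_test'[OF D]) auto
    from summable_LIMSEQ[OF this] have "(\<lambda>J. L J - L 0) \<longlonglongrightarrow> (\<Sum>J. L (Suc J) - L J)"
      by (simp only: sum_lessThan_telescope)
    from tendsto_add[OF this tendsto_const[of "L 0"]] have "L \<longlonglongrightarrow> (\<Sum>J. L (Suc J) - L J) + L 0" by simp
    from swap_uniform_limit'[OF always_eventually this u ev] L
    have "(g \<longlongrightarrow> (\<Sum>J. L (Suc J) - L J) + L 0) (at_left t)" by simp
    then show "\<exists>l. (g \<longlongrightarrow> l) (at_left t)" by (rule exI)
  qed
  moreover have "g 0 = 0"
    using pt[of 0] by (simp add: path_props(3) LIMSEQ_const_iff)
  ultimately have x: "path_of (Abs_cadlag0 g) = g"
    by (intro Abs_cadlag0_inverse) (auto simp: g_def)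
  have "z \<longlonglongrightarrow> Abs_cadlag0 g"
  proof (rule tendstoI)
    fix e :: real assume e: "e > 0"
    from uniform_limitD[OF u, of "e / 2"] e
    have "\<forall>\<^sub>F J in sequentially. \<forall>t\<in>{0..1}. dist (path_of (z J) t) (g t) < e / 2" by simp
    then show "\<forall>\<^sub>F J in sequentially. dist (z J) (Abs_cadlag0 g) < e"
    proof eventually_elim
      case (elim J)
      have "dist (z J) (Abs_cadlag0 g) \<le> e / 2"
        by (rule dist_le_uniform) (use elim in \<open>auto simp: x dist_norm less_imp_le\<close>)
      then show ?case using e by simp
    qed
  qed
  then show ?thesis by (rule that) (simp add: x pt)
qed

lemma summable_iff_ennreal:
  assumes "\<And>n. 0 \<le> f n"
  shows "summable f \<longleftrightarrow> (\<Sum>n. ennreal (f n)) \<noteq> top"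
  using summable_suminf_not_top[of f] ennreal_suminf_neq_top[of f] assms by blast

text \<open>By monotone convergence the total has finite expectation, so it is finite almost
  surely.\<close>

lemma (in prob_space) AE_summable:
  fixes f :: "nat \<Rightarrow> 'a \<Rightarrow> real"
  assumes f: "\<And>n. integrable M (f n)" "\<And>n \<omega>. 0 \<le> f n \<omega>" and c: "\<And>n. expectation (f n) \<le> c n" "summable c"
  shows "AE \<omega> in M. summable (\<lambda>n. f n \<omega>)"
proof -
  have c0: "0 \<le> c n" for n
  proof -
    have "0 \<le> expectation (f n)" by (rule Bochner_Integration.integral_nonneg) (rule f(2))
    then show ?thesis using c(1)[of n] by (rule order_trans)
  qed
  have [measurable]: "f n \<in> borel_measurable M" for n using f(1) by auto
  have "(\<integral>\<^sup>+\<omega>. (\<Sum>n. ennreal (f n \<omega>)) \<partial>M) = (\<Sum>n. \<integral>\<^sup>+\<omega>. ennreal (f n \<omega>) \<partial>M)"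
    by (rule nn_integral_suminf) simp
  also have "\<dots> = (\<Sum>n. ennreal (expectation (f n)))"
    using f by (intro suminf_cong nn_integral_eq_integral) auto
  also have "\<dots> \<le> (\<Sum>n. ennreal (c n))"
    by (intro suminf_le ennreal_leI c summableI)
  also have "\<dots> < top"
    using ennreal_suminf_neq_top[OF c(2) c0] by (simp add: less_top)
  finally have "(\<integral>\<^sup>+\<omega>. (\<Sum>n. ennreal (f n \<omega>)) \<partial>M) \<noteq> \<infinity>" by simp
  then have "AE \<omega> in M. (\<Sum>n. ennreal (f n \<omega>)) \<noteq> \<infinity>"
    by (intro nn_integral_PInf_AE) auto
  then show ?thesis
  proof eventually_elim
    case (elim \<omega>)
    then show ?case unfolding summable_iff_ennreal[of "\<lambda>n. f n \<omega>", OF f(2)] by simp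
  qed
qed

section \<open>The limit process\<close>

text \<open>A sequence index encodes a pair of a rational time and a coordinate; the clamping to the unit
  interval only affects codes that are never used.\<close>

definition code :: "rat \<Rightarrow> 'd::finite \<Rightarrow> nat" where
  "code q i = prod_encode (to_nat q, to_nat i)"

definition code_time :: "nat \<Rightarrow> real" where
  "code_time p = max 0 (min 1 (real_of_rat (from_nat (fst (prod_decode p)))))"

definition code_coord :: "nat \<Rightarrow> 'd::finite" where
  "code_coord p = from_nat (snd (prod_decode p))"

lemma code_inj: "code q i = code r k \<longleftrightarrow> q = r \<and> i = k"
  by (simp add: code_def)

lemma code_time_range: "code_time p \<in> {0..1}"
  by (auto simp: code_time_def)

lemma code_time_code: "0 \<le> q \<Longrightarrow> q \<le> 1 \<Longrightarrow> code_time (code q i) = real_of_rat q"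
  by (simp add: code_time_def code_def)

lemma code_coord_code [simp]: "code_coord (code q i) = i"
  by (simp add: code_coord_def code_def)

text \<open>Rational, hence a legitimate argument of \<open>code\<close>. By
  \<open>dyadic_Suc\<close> a point keeps its code on finer levels, so all levels share one Gaussian
  family.\<close>

definition dyadic :: "nat \<Rightarrow> nat \<Rightarrow> rat" where
  "dyadic J j = of_nat j / 2 ^ J"

lemma dyadic_Suc: "dyadic (Suc J) (2 * j) = dyadic J j"
  by (simp add: dyadic_def)

lemma dyadic_range: "j \<le> 2 ^ J \<Longrightarrow> 0 \<le> dyadic J j \<and> dyadic J j \<le> 1"
proof -
  assume "j \<le> 2 ^ J"
  then have "(of_nat j :: rat) \<le> of_nat (2 ^ J)" by (simp only: of_nat_le_iff)
  then show ?thesis by (simp add: dyadic_def divide_le_eq)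
qed

lemma of_rat_dyadic: "real_of_rat (dyadic J j) = real j / 2 ^ J"
  by (simp add: dyadic_def of_rat_divide of_rat_power)

lemma dyadic_inj: "dyadic J j = dyadic J l \<longleftrightarrow> j = l"
  by (simp add: dyadic_def)

lemma sum_collapse:
  fixes c f :: "_ \<Rightarrow> real"
  assumes "finite I"
  shows "(\<Sum>a\<in>I. c a * f (\<phi> a)) = (\<Sum>p\<in>\<phi> ` I. (\<Sum>a\<in>{a\<in>I. \<phi> a = p}. c a) * f p)"
  by (subst sum.image_gen[OF assms, of _ \<phi>]) (simp add: sum_distrib_right)

lemma kappa_increment:
  assumes "0 \<le> r" "r \<le> s" "0 < s"
  shows "kappa s s + kappa r r - 2 * kappa s r = (s - r)\<^sup>2 / (3 * s)"
proof -
  have "kappa s s = s / 3" using assms by (simp add: kappa_def)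
  moreover have "kappa r r = r / 3" by (cases "r = 0") (simp_all add: kappa_def)
  moreover have "kappa s r = r * (3 * s - r) / (6 * s)" using assms by (simp add: kappa_def min_def max_def)
  ultimately show ?thesis
    using assms by (simp add: field_simps power2_eq_square)
qed

locale gaussian_limit = centred_iid M \<xi> \<Sigma>
  for M :: "'a measure" and \<xi> :: "nat \<Rightarrow> 'a \<Rightarrow> real ^ 'd::finite" and \<Sigma> +
  fixes X :: "nat \<Rightarrow> (nat \<Rightarrow> real) \<Rightarrow> real"
  assumes X_meas [measurable]: "\<And>p. X p \<in> borel_measurable noise_space"
    and X_null: "\<And>p \<omega>. fdd_kernel code_time code_coord p p = 0 \<Longrightarrow> X p \<omega> = 0"
    and X_law: "\<And>A u. finite A \<Longrightarrow> distr noise_space borel (\<lambda>\<omega>. \<Sum>p\<in>A. u p * X p \<omega>) =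
       normal_law 0 (sqrt (\<Sum>p\<in>A. \<Sum>r\<in>A. u p * u r * fdd_kernel code_time code_coord p r))"
begin

sublocale noise: prob_space noise_space by (rule prob_space_noise)

text \<open>\<open>X_law\<close> speaks of sums over sets of indices, while \<open>\<phi>\<close>
  may repeat an index: distinct times can round to the same dyadic point. Coefficients belonging to
  equal indices are collected first.\<close>

lemma X_family:
  assumes I: "finite I"
  shows "distr noise_space borel (\<lambda>\<omega>. \<Sum>a\<in>I. c a * X (\<phi> a) \<omega>) =
      normal_law 0 (sqrt (\<Sum>a\<in>I. \<Sum>b\<in>I. c a * c b * fdd_kernel code_time code_coord (\<phi> a) (\<phi> b)))"
    and "0 \<le> (\<Sum>a\<in>I. \<Sum>b\<in>I. c a * c b * fdd_kernel code_time code_coord (\<phi> a) (\<phi> b))"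
proof -
  let ?K = "fdd_kernel code_time code_coord :: nat \<Rightarrow> nat \<Rightarrow> real"
  define U where "U p = (\<Sum>a\<in>{a\<in>I. \<phi> a = p}. c a)" for p
  have K: "(\<Sum>a\<in>I. \<Sum>b\<in>I. c a * c b * ?K (\<phi> a) (\<phi> b)) = (\<Sum>p\<in>\<phi> ` I. \<Sum>r\<in>\<phi> ` I. U p * U r * ?K p r)"
  proof -
    have "(\<Sum>a\<in>I. \<Sum>b\<in>I. c a * c b * ?K (\<phi> a) (\<phi> b)) = (\<Sum>a\<in>I. c a * (\<Sum>b\<in>I. c b * ?K (\<phi> a) (\<phi> b)))"
      by (simp add: sum_distrib_left mult.assoc)
    also have "\<dots> = (\<Sum>a\<in>I. c a * (\<Sum>r\<in>\<phi> ` I. U r * ?K (\<phi> a) r))"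
      unfolding U_def by (subst sum_collapse[OF I, of c "?K _"]) (rule refl)
    also have "\<dots> = (\<Sum>p\<in>\<phi> ` I. U p * (\<Sum>r\<in>\<phi> ` I. U r * ?K p r))"
      unfolding U_def by (rule sum_collapse[OF I])
    finally show ?thesis by (simp add: sum_distrib_left mult.assoc)
  qed
  have "(\<Sum>a\<in>I. c a * X (\<phi> a) \<omega>) = (\<Sum>p\<in>\<phi> ` I. U p * X p \<omega>)" for \<omega>
    unfolding U_def by (rule sum_collapse[OF I, of c "\<lambda>p. X p \<omega>"])
  then show "distr noise_space borel (\<lambda>\<omega>. \<Sum>a\<in>I. c a * X (\<phi> a) \<omega>) =
      normal_law 0 (sqrt (\<Sum>a\<in>I. \<Sum>b\<in>I. c a * c b * ?K (\<phi> a) (\<phi> b)))"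
    unfolding K using X_law[of "\<phi> ` I" U] I by simp
  show "0 \<le> (\<Sum>a\<in>I. \<Sum>b\<in>I. c a * c b * ?K (\<phi> a) (\<phi> b))"
    unfolding K using positive_semidefinite_fdd_kernel[OF code_time_range] I
    by (auto simp: positive_semidefinite_def)
qed

definition V :: "rat \<Rightarrow> (nat \<Rightarrow> real) \<Rightarrow> real ^ 'd" where
  "V q \<omega> = (\<chi> i. X (code q i) \<omega>)"

lemma V_nth [simp]: "V q \<omega> $ i = X (code q i) \<omega>"
  by (simp add: V_def)

lemma V_meas [measurable]: "V q \<in> borel_measurable noise_space"
proof -
  have eq: "V q = (\<lambda>\<omega>. \<Sum>i\<in>UNIV. X (code q i) \<omega> *\<^sub>R axis i 1)"
    using basis_expansion[of "V q _"] by (intro ext) (simp add: scalar_mult_eq_scaleR)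
  show ?thesis unfolding eq by measurable
qed

lemma V_0: "V 0 \<omega> = 0"
  using X_null by (simp add: vec_eq_iff fdd_kernel_def code_time_code kappa_def)

definition form :: "real ^ 'd \<Rightarrow> real ^ 'd \<Rightarrow> real" where
  "form u v = (\<Sum>i\<in>UNIV. \<Sum>j\<in>UNIV. u $ i * v $ j * \<Sigma> $ i $ j)"

lemma form_axis: "form (axis i a) (axis j b) = a * b * \<Sigma> $ i $ j"
proof -
  have ax: "(\<Sum>k\<in>UNIV. axis l c $ k * f k) = c * f l" for l :: 'd and c :: real and f
    using inner_axis'[of l c "\<chi> k. f k"] by (simp add: inner_vec_def)
  have "form (axis i a) (axis j b) = (\<Sum>k\<in>UNIV. axis i a $ k * (\<Sum>l\<in>UNIV. axis j b $ l * \<Sigma> $ k $ l))"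
    unfolding form_def by (simp only: sum_distrib_left mult.assoc)
  then show ?thesis by (simp only: ax mult.assoc)
qed

lemma V_family:
  assumes I: "finite I" and q: "\<And>a. a \<in> I \<Longrightarrow> 0 \<le> q a \<and> q a \<le> 1"
  shows "distr noise_space borel (\<lambda>\<omega>. \<Sum>a\<in>I. u a \<bullet> V (q a) \<omega>) =
      normal_law 0 (sqrt (\<Sum>a\<in>I. \<Sum>b\<in>I. kappa (real_of_rat (q a)) (real_of_rat (q b)) * form (u a) (u b)))"
    and "0 \<le> (\<Sum>a\<in>I. \<Sum>b\<in>I. kappa (real_of_rat (q a)) (real_of_rat (q b)) * form (u a) (u b))"
proof -
  let ?J = "I \<times> (UNIV :: 'd set)"
  let ?c = "\<lambda>(a, i). u a $ i" and ?\<phi> = "\<lambda>(a, i). code (q a) i"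
  let ?K = "fdd_kernel code_time code_coord :: nat \<Rightarrow> nat \<Rightarrow> real"
  have "(\<Sum>x\<in>?J. \<Sum>y\<in>?J. ?c x * ?c y * ?K (?\<phi> x) (?\<phi> y)) =
      (\<Sum>a\<in>I. \<Sum>i\<in>UNIV. \<Sum>b\<in>I. \<Sum>j\<in>UNIV. u a $ i * u b $ j * ?K (code (q a) i) (code (q b) j))"
    by (simp add: sum.cartesian_product')
  also have "\<dots> = (\<Sum>a\<in>I. \<Sum>b\<in>I. \<Sum>i\<in>UNIV. \<Sum>j\<in>UNIV. u a $ i * u b $ j * ?K (code (q a) i) (code (q b) j))"
    by (intro sum.cong refl sum.swap)
  also have "\<dots> = (\<Sum>a\<in>I. \<Sum>b\<in>I. kappa (real_of_rat (q a)) (real_of_rat (q b)) * form (u a) (u b))"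
    unfolding form_def fdd_kernel_def sum_distrib_left
    by (intro sum.cong refl) (simp add: q code_time_code)
  finally have K: "(\<Sum>x\<in>?J. \<Sum>y\<in>?J. ?c x * ?c y * ?K (?\<phi> x) (?\<phi> y)) =
      (\<Sum>a\<in>I. \<Sum>b\<in>I. kappa (real_of_rat (q a)) (real_of_rat (q b)) * form (u a) (u b))" .
  have S: "(\<Sum>a\<in>I. u a \<bullet> V (q a) \<omega>) = (\<Sum>x\<in>?J. ?c x * X (?\<phi> x) \<omega>)" for \<omega>
    by (simp add: inner_vec_def sum.cartesian_product')
  have J: "finite ?J" using I by simp
  show "distr noise_space borel (\<lambda>\<omega>. \<Sum>a\<in>I. u a \<bullet> V (q a) \<omega>) =
      normal_law 0 (sqrt (\<Sum>a\<in>I. \<Sum>b\<in>I. kappa (real_of_rat (q a)) (real_of_rat (q b)) * form (u a) (u b)))"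
    using X_family(1)[OF J, of ?c ?\<phi>] unfolding K S .
  show "0 \<le> (\<Sum>a\<in>I. \<Sum>b\<in>I. kappa (real_of_rat (q a)) (real_of_rat (q b)) * form (u a) (u b))"
    using X_family(2)[OF J, of ?c ?\<phi>] unfolding K .
qed

lemma trace_covariance: "(\<Sum>i\<in>UNIV. \<Sigma> $ i $ i) = mean_square"
proof -
  have "(\<Sum>i\<in>UNIV. \<Sigma> $ i $ i) = (LINT \<omega>|M. (\<Sum>i\<in>UNIV. \<xi> 0 \<omega> $ i * \<xi> 0 \<omega> $ i))"
    unfolding covariance_nth by (simp add: integrable_nth_mult)
  also have "\<dots> = mean_square"
    by (simp add: mean_square_def norm_vec_def L2_set_def sum_nonneg power2_eq_square)
  finally show ?thesis .
qed

text \<open>Each coordinate of the increment is centred normal with the variance from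
  \<open>kappa_increment\<close>; summing over coordinates turns the diagonal of
  \<open>\<Sigma>\<close> into its trace \<open>mean_square\<close>.\<close>

lemma V_increment:
  assumes "0 \<le> r" "r \<le> s" "0 < s" "s \<le> 1"
  shows "integrable noise_space (\<lambda>\<omega>. (norm (V s \<omega> - V r \<omega>))\<^sup>2)"
    and "(LINT \<omega>|noise_space. (norm (V s \<omega> - V r \<omega>))\<^sup>2) = (real_of_rat (s - r))\<^sup>2 / (3 * real_of_rat s) * mean_square"
proof -
  have c: "integrable noise_space (\<lambda>\<omega>. ((V s \<omega> - V r \<omega>) $ i)\<^sup>2) \<and>
      (LINT \<omega>|noise_space. ((V s \<omega> - V r \<omega>) $ i)\<^sup>2) = (real_of_rat (s - r))\<^sup>2 / (3 * real_of_rat s) * \<Sigma> $ i $ i" for i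
  proof -
    \<comment> \<open>The difference is a family indexed by \<open>bool\<close> with coefficients 1
      and -1, so that \<open>V_family\<close> applies.\<close>
    let ?u = "\<lambda>b. if b then axis i 1 else axis i (- 1 :: real)" and ?q = "\<lambda>b. if b then s else r"
    have q: "0 \<le> ?q b \<and> ?q b \<le> 1" for b using assms by auto
    have eq: "(\<Sum>b\<in>UNIV. ?u b \<bullet> V (?q b) \<omega>) = (V s \<omega> - V r \<omega>) $ i" for \<omega>
      by (simp add: UNIV_bool inner_axis')
    have "(\<Sum>a\<in>UNIV. \<Sum>b\<in>UNIV. kappa (real_of_rat (?q a)) (real_of_rat (?q b)) * form (?u a) (?u b))
        = (kappa (real_of_rat s) (real_of_rat s) + kappa (real_of_rat r) (real_of_rat r) - 2 * kappa (real_of_rat s) (real_of_rat r)) * \<Sigma> $ i $ i"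
      by (simp add: UNIV_bool form_axis kappa_sym[of "real_of_rat r" "real_of_rat s"] algebra_simps)
    also have "\<dots> = (real_of_rat (s - r))\<^sup>2 / (3 * real_of_rat s) * \<Sigma> $ i $ i"
      using assms by (subst kappa_increment) (auto simp: of_rat_less_eq of_rat_diff)
    finally have v: "(\<Sum>a\<in>UNIV. \<Sum>b\<in>UNIV. kappa (real_of_rat (?q a)) (real_of_rat (?q b)) * form (?u a) (?u b))
        = (real_of_rat (s - r))\<^sup>2 / (3 * real_of_rat s) * \<Sigma> $ i $ i" .
    note law = V_family[where I = "UNIV :: bool set" and q = ?q and u = ?u, OF finite q, unfolded eq v]
    have m: "(\<lambda>\<omega>. (V s \<omega> - V r \<omega>) $ i) \<in> borel_measurable noise_space"
      by (rule measurable_compose[OF _ measurable_vec_nth]) simp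
    show ?thesis
      using noise.normal_law_variable(3,4)[OF m _ law(1)] law(2) by simp
  qed
  have n: "(norm (V s \<omega> - V r \<omega>))\<^sup>2 = (\<Sum>i\<in>UNIV. ((V s \<omega> - V r \<omega>) $ i)\<^sup>2)" for \<omega>
    by (simp add: norm_vec_def L2_set_def sum_nonneg)
  show "integrable noise_space (\<lambda>\<omega>. (norm (V s \<omega> - V r \<omega>))\<^sup>2)"
    unfolding n using c by (intro Bochner_Integration.integrable_sum) blast
  have "(LINT \<omega>|noise_space. (norm (V s \<omega> - V r \<omega>))\<^sup>2) = (\<Sum>i\<in>UNIV. LINT \<omega>|noise_space. ((V s \<omega> - V r \<omega>) $ i)\<^sup>2)"
    unfolding n using c by (intro Bochner_Integration.integral_sum) blast
  also have "\<dots> = (real_of_rat (s - r))\<^sup>2 / (3 * real_of_rat s) * mean_square"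
    unfolding trace_covariance[symmetric] sum_distrib_left using c by (intro sum.cong) blast+
  finally show "(LINT \<omega>|noise_space. (norm (V s \<omega> - V r \<omega>))\<^sup>2) = (real_of_rat (s - r))\<^sup>2 / (3 * real_of_rat s) * mean_square" .
qed

section \<open>Almost sure convergence of the dyadic step paths\<close>

definition Z :: "nat \<Rightarrow> (nat \<Rightarrow> real) \<Rightarrow> 'd cadlag0" where
  "Z J \<omega> = step_path (2 ^ J) (\<lambda>j. V (dyadic J j) \<omega>)"

text \<open>Stands in for the maximum over the new, odd-numbered points of level
  \<open>Suc J\<close>; the larger Euclidean norm has a second moment that is a plain sum of
  variances.\<close>

definition oscillation :: "nat \<Rightarrow> (nat \<Rightarrow> real) \<Rightarrow> real" where
  "oscillation J \<omega> = sqrt (\<Sum>j<2^J. (norm (V (dyadic (Suc J) (2 * j + 1)) \<omega> - V (dyadic (Suc J) (2 * j)) \<omega>))\<^sup>2)"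

lemma path_of_Z:
  assumes "t \<in> {0..1}"
  shows "path_of (Z J \<omega>) t = V (dyadic J (nat \<lfloor>2 ^ J * t\<rfloor>)) \<omega>"
proof -
  have "V (dyadic J 0) \<omega> = 0" using V_0 by (simp add: dyadic_def)
  then have "(if j = 0 then 0 else V (dyadic J j) \<omega>) = V (dyadic J j) \<omega>" for j by simp
  moreover have "path_of (Z J \<omega>) t = (if nat \<lfloor>real (2 ^ J) * t\<rfloor> = 0 then 0 else V (dyadic J (nat \<lfloor>real (2 ^ J) * t\<rfloor>)) \<omega>)"
    unfolding Z_def path_of_step_path by (rule restrict_apply'[OF assms])
  ultimately show ?thesis by (simp only: of_nat_power of_nat_numeral)
qed

text \<open>A dyadic cell \<open>j\<close> splits into the cells \<open>2 * j\<close> and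
  \<open>2 * j + 1\<close>. On the first the path keeps its value, on the second it moves by one of
  the increments in \<open>oscillation\<close>.\<close>

lemma Z_increment:
  assumes t: "t \<in> {0..1}"
  shows "norm (path_of (Z (Suc J) \<omega>) t - path_of (Z J \<omega>) t) \<le> oscillation J \<omega>"
proof -
  define j where "j = nat \<lfloor>2 ^ J * t\<rfloor>"
  define l where "l = nat \<lfloor>2 ^ Suc J * t\<rfloor>"
  have j: "real j \<le> 2 ^ J * t" "2 ^ J * t < real j + 1" unfolding j_def using t by (simp_all add: of_nat_floor)
  have l: "real l \<le> 2 ^ Suc J * t" "2 ^ Suc J * t < real l + 1" unfolding l_def using t by (simp_all add: of_nat_floor)
  have lj: "l = 2 * j \<or> l = 2 * j + 1" using j l by simp linarith
  have nonneg: "0 \<le> oscillation J \<omega>" by (simp add: oscillation_def sum_nonneg)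
  have p: "path_of (Z (Suc J) \<omega>) t - path_of (Z J \<omega>) t = V (dyadic (Suc J) l) \<omega> - V (dyadic (Suc J) (2 * j)) \<omega>"
    unfolding path_of_Z[OF t] dyadic_Suc l_def j_def by simp
  show ?thesis
  proof (cases "l = 2 * j")
    case True
    then show ?thesis unfolding p using nonneg by simp
  next
    case False
    then have l1: "l = 2 * j + 1" using lj by simp
    \<comment> \<open>The range \<open>j < 2 ^ J\<close> is needed in the odd case only;
      \<open>t = 1\<close>, where \<open>j = 2 ^ J\<close>, falls into the even case.\<close>
    have "2 ^ Suc J * t \<le> 2 ^ Suc J * 1" by (rule mult_left_mono) (use t in auto)
    then have "real l \<le> 2 ^ Suc J * 1" by (rule order_trans[OF l(1)])
    then have "real l \<le> real (2 ^ Suc J)" by simp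
    then have "l \<le> 2 ^ Suc J" by (simp only: of_nat_le_iff)
    then have "j < 2 ^ J" using l1 by simp
    then have "(norm (V (dyadic (Suc J) (2 * j + 1)) \<omega> - V (dyadic (Suc J) (2 * j)) \<omega>))\<^sup>2 \<le>
        (\<Sum>j<2^J. (norm (V (dyadic (Suc J) (2 * j + 1)) \<omega> - V (dyadic (Suc J) (2 * j)) \<omega>))\<^sup>2)"
      by (intro member_le_sum) auto
    then show ?thesis unfolding p l1 oscillation_def by (rule real_le_rsqrt)
  qed
qed

text \<open>The \<open>j\<close>-th new increment has second moment
  \<open>mean_square / (3 * 2 ^ Suc J * (2 * j + 1))\<close>. The sum over \<open>j\<close> is
  bounded by \<open>mean_square\<close> times the \<open>J\<close>-th power of
  \<open>1 / sqrt 2\<close>, and the root gives the geometric ratio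
  \<open>sqrt (1 / sqrt 2)\<close>.\<close>

lemma oscillation_expectation:
  shows "integrable noise_space (oscillation J)"
    and "(LINT \<omega>|noise_space. oscillation J \<omega>) \<le> sqrt mean_square * sqrt (1 / sqrt 2) ^ J"
proof -
  let ?S = "\<lambda>\<omega>. \<Sum>j<2^J. (norm (V (dyadic (Suc J) (2 * j + 1)) \<omega> - V (dyadic (Suc J) (2 * j)) \<omega>))\<^sup>2"
  have r: "0 \<le> dyadic (Suc J) (2 * j)" "dyadic (Suc J) (2 * j) \<le> dyadic (Suc J) (2 * j + 1)"
    "0 < dyadic (Suc J) (2 * j + 1)" "dyadic (Suc J) (2 * j + 1) \<le> 1" if "j < 2 ^ J" for j
  proof -
    show "dyadic (Suc J) (2 * j) \<le> dyadic (Suc J) (2 * j + 1)"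
      unfolding dyadic_def by (rule divide_right_mono) simp_all
  qed (use that dyadic_range[of "2 * j + 1" "Suc J"] in \<open>simp_all add: dyadic_def\<close>)
  have iS: "integrable noise_space ?S"
    by (intro Bochner_Integration.integrable_sum V_increment(1) r) auto
  have "(LINT \<omega>|noise_space. ?S \<omega>) = (\<Sum>j<2^J. LINT \<omega>|noise_space.
      (norm (V (dyadic (Suc J) (2 * j + 1)) \<omega> - V (dyadic (Suc J) (2 * j)) \<omega>))\<^sup>2)"
    by (intro Bochner_Integration.integral_sum V_increment(1) r) auto
  also have "\<dots> \<le> (\<Sum>j<2^J. mean_square / 2 ^ Suc J * (1 / sqrt (real j + 1)))"
  proof (rule sum_mono)
    fix j :: nat assume "j \<in> {..<2 ^ J}"
    then have j: "j < 2 ^ J" by simp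
    have "dyadic (Suc J) (2 * j + 1) - dyadic (Suc J) (2 * j) = dyadic (Suc J) 1"
      unfolding dyadic_def diff_divide_distrib[symmetric] by simp
    then have "(LINT \<omega>|noise_space. (norm (V (dyadic (Suc J) (2 * j + 1)) \<omega> - V (dyadic (Suc J) (2 * j)) \<omega>))\<^sup>2)
      = (1 / 2 ^ Suc J)\<^sup>2 / (3 * (real (2 * j + 1) / 2 ^ Suc J)) * mean_square"
      unfolding V_increment(2)[OF r[OF j]] by (simp only: of_rat_dyadic of_nat_1)
    also have "\<dots> = mean_square / 2 ^ Suc J * (1 / (3 * (2 * real j + 1)))"
      by (simp add: power2_eq_square field_simps)
    \<comment> \<open>Weaker than the harmonic decay at hand, but it allows
      \<open>sum_inverse_sqrt_le\<close> to be reused and still leaves a geometric rate in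
      \<open>J\<close>.\<close>
    also have "\<dots> \<le> mean_square / 2 ^ Suc J * (1 / sqrt (real j + 1))"
    proof (intro mult_left_mono divide_left_mono)
      have "sqrt (real j + 1) \<le> real j + 1" using sqrt_le_D[of "real j + 1"] by (simp add: real_sqrt_le_iff' real_le_lsqrt power2_eq_square)
      then show "sqrt (real j + 1) \<le> 3 * (2 * real j + 1)" by simp
    qed (use mean_square_nonneg in auto)
    finally show "(LINT \<omega>|noise_space. (norm (V (dyadic (Suc J) (2 * j + 1)) \<omega> - V (dyadic (Suc J) (2 * j)) \<omega>))\<^sup>2)
      \<le> mean_square / 2 ^ Suc J * (1 / sqrt (real j + 1))" .
  qed
  also have "\<dots> = mean_square / 2 ^ Suc J * (\<Sum>j=0..<2^J. 1 / sqrt (real j + 1))"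
    by (simp only: sum_distrib_left atLeast0LessThan)
  also have "\<dots> \<le> mean_square / 2 ^ Suc J * (2 * (sqrt (real (2 ^ J)) - sqrt (real 0)))"
    by (intro mult_left_mono sum_inverse_sqrt_le) (use mean_square_nonneg in auto)
  also have "\<dots> = mean_square * (1 / sqrt 2) ^ J"
  proof -
    have "(2::real) ^ J = sqrt 2 ^ J * sqrt 2 ^ J" by (simp add: power_mult_distrib[symmetric])
    then show ?thesis by (simp add: real_sqrt_power power_divide)
  qed
  finally have ES: "(LINT \<omega>|noise_space. ?S \<omega>) \<le> mean_square * (1 / sqrt 2) ^ J" .
  have m: "oscillation J \<in> borel_measurable noise_space" unfolding oscillation_def by measurable
  have sq: "(oscillation J \<omega>)\<^sup>2 \<le> ?S \<omega>" for \<omega> by (simp add: oscillation_def sum_nonneg)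
  note e = noise.abs_expectation_le_sqrt[OF m iS sq]
  show "integrable noise_space (oscillation J)" by (rule e)
  have "(LINT \<omega>|noise_space. oscillation J \<omega>) \<le> sqrt (LINT \<omega>|noise_space. ?S \<omega>)" using e(2) by linarith
  also have "\<dots> \<le> sqrt (mean_square * (1 / sqrt 2) ^ J)" by (rule real_sqrt_le_mono[OF ES])
  also have "\<dots> = sqrt mean_square * sqrt (1 / sqrt 2) ^ J" by (simp only: real_sqrt_mult real_sqrt_power)
  finally show "(LINT \<omega>|noise_space. oscillation J \<omega>) \<le> sqrt mean_square * sqrt (1 / sqrt 2) ^ J" .
qed

lemma oscillation_nonneg: "0 \<le> oscillation J \<omega>"
  by (simp add: oscillation_def sum_nonneg)

lemma AE_summable_oscillation: "AE \<omega> in noise_space. summable (\<lambda>J. oscillation J \<omega>)"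
proof (rule noise.AE_summable[OF oscillation_expectation(1) oscillation_nonneg oscillation_expectation(2)])
  have "sqrt (1 / sqrt 2) < 1" by simp
  then show "summable (\<lambda>J. sqrt mean_square * sqrt (1 / sqrt 2) ^ J)"
    by (intro summable_mult summable_geometric) simp
qed

text \<open>Off the event of summability the path is set to zero, here \<open>step_path 0\<close>,
  so that \<open>limit_path\<close> is a pointwise limit of measurable maps at every
  \<open>\<omega>\<close>.\<close>

definition limit_path :: "(nat \<Rightarrow> real) \<Rightarrow> 'd cadlag0" where
  "limit_path \<omega> = (if summable (\<lambda>J. oscillation J \<omega>) then lim (\<lambda>J. Z J \<omega>) else step_path 0 (\<lambda>_. 0))"

lemma Z_tendsto:
  assumes "summable (\<lambda>J. oscillation J \<omega>)"
  shows "(\<lambda>J. Z J \<omega>) \<longlonglongrightarrow> limit_path \<omega>"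
    and "t \<in> {0..1} \<Longrightarrow> (\<lambda>J. path_of (Z J \<omega>) t) \<longlonglongrightarrow> path_of (limit_path \<omega>) t"
proof -
  obtain x where x: "(\<lambda>J. Z J \<omega>) \<longlonglongrightarrow> x" "\<And>t. t \<in> {0..1} \<Longrightarrow> (\<lambda>J. path_of (Z J \<omega>) t) \<longlonglongrightarrow> path_of x t"
    using cadlag0_limit[OF assms, of "\<lambda>J. Z J \<omega>"] Z_increment by blast
  have "limit_path \<omega> = x" using assms limI[OF x(1)] by (simp add: limit_path_def)
  then show "(\<lambda>J. Z J \<omega>) \<longlonglongrightarrow> limit_path \<omega>"
    "t \<in> {0..1} \<Longrightarrow> (\<lambda>J. path_of (Z J \<omega>) t) \<longlonglongrightarrow> path_of (limit_path \<omega>) t"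
    using x by simp_all
qed

lemma Z_meas [measurable]: "Z J \<in> borel_measurable noise_space"
  unfolding Z_def by (rule measurable_step_path) simp

lemma measurable_good: "{\<omega> \<in> space noise_space. summable (\<lambda>J. oscillation J \<omega>)} \<in> sets noise_space"
proof -
  have [measurable]: "oscillation J \<in> borel_measurable noise_space" for J
    using oscillation_expectation(1) by (rule borel_measurable_integrable)
  show ?thesis
    unfolding summable_iff_ennreal[OF oscillation_nonneg] by measurable
qed

lemma limit_path_meas: "limit_path \<in> borel_measurable noise_space"
proof (rule borel_measurable_LIMSEQ_metric)
  fix J
  show "(\<lambda>\<omega>. if summable (\<lambda>J. oscillation J \<omega>) then Z J \<omega> else step_path 0 (\<lambda>_. 0)) \<in> borel_measurable noise_space"
    by (rule measurable_If[OF _ _ measurable_good]) simp_all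
next
  fix \<omega>
  show "(\<lambda>J. if summable (\<lambda>J. oscillation J \<omega>) then Z J \<omega> else step_path 0 (\<lambda>_. 0)) \<longlonglongrightarrow> limit_path \<omega>"
    using Z_tendsto(1)[of \<omega>] by (cases "summable (\<lambda>J. oscillation J \<omega>)") (auto simp: limit_path_def)
qed

text \<open>Derived from the values of \<open>Z J\<close> and not from
  \<open>limit_path_meas\<close>, because evaluation at an interior time is not continuous for the
  Skorokhod metric.\<close>

lemma limit_path_coordinate_meas:
  assumes t: "t \<in> {0..1}" shows "(\<lambda>\<omega>. path_of (limit_path \<omega>) t) \<in> borel_measurable noise_space"
proof (rule borel_measurable_LIMSEQ_metric)
  fix J
  show "(\<lambda>\<omega>. if summable (\<lambda>J. oscillation J \<omega>) then path_of (Z J \<omega>) t else 0) \<in> borel_measurable noise_space"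
    unfolding path_of_Z[OF t] by (rule measurable_If[OF _ _ measurable_good]) simp_all
next
  fix \<omega>
  show "(\<lambda>J. if summable (\<lambda>J. oscillation J \<omega>) then path_of (Z J \<omega>) t else 0) \<longlonglongrightarrow> path_of (limit_path \<omega>) t"
    using Z_tendsto(2)[of \<omega> t] t
    by (cases "summable (\<lambda>J. oscillation J \<omega>)") (auto simp: limit_path_def path_of_step_path)
qed

end

section \<open>The final sigma-algebra\<close>

text \<open>Pushing a measure forward to the largest possible sigma-algebra makes every coordinate of a
  random path measurable at once, without relating the coordinates to the Borel sets of the
  Skorokhod topology.\<close>

definition final_algebra :: "'a measure \<Rightarrow> ('a \<Rightarrow> 'b) \<Rightarrow> 'b measure" where
  "final_algebra M f = sigma UNIV {A. f -` A \<inter> space M \<in> sets M}"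

definition final_distr :: "'a measure \<Rightarrow> ('a \<Rightarrow> 'b) \<Rightarrow> 'b measure" where
  "final_distr M f = distr M (final_algebra M f) f"

lemma sets_final_algebra:
  fixes f :: "'a \<Rightarrow> 'b"
  shows "sets (final_algebra M f) = {A. f -` A \<inter> space M \<in> sets M}"
proof -
  have "sigma_algebra UNIV {A. f -` A \<inter> space M \<in> sets M}"
  proof (rule sigma_algebra_iff2[THEN iffD2], intro conjI ballI allI impI)
    fix A assume "A \<in> {A. f -` A \<inter> space M \<in> sets M}"
    then have "space M - (f -` A \<inter> space M) \<in> sets M" by blast
    moreover have "space M - (f -` A \<inter> space M) = f -` (UNIV - A) \<inter> space M" by blast
    ultimately show "UNIV - A \<in> {A. f -` A \<inter> space M \<in> sets M}" by simp
  next
    fix A :: "nat \<Rightarrow> 'b set" assume "range A \<subseteq> {A. f -` A \<inter> space M \<in> sets M}"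
    then have "(\<Union>i. f -` A i \<inter> space M) \<in> sets M" by (intro sets.countable_UN) auto
    moreover have "(\<Union>i. f -` A i \<inter> space M) = f -` (\<Union>i. A i) \<inter> space M" by blast
    ultimately show "(\<Union>i. A i) \<in> {A. f -` A \<inter> space M \<in> sets M}" by simp
  qed auto
  then show ?thesis
    unfolding final_algebra_def by (rule sigma_algebra.sets_measure_of_eq)
qed

lemma space_final_algebra [simp]: "space (final_algebra M f) = UNIV"
  by (simp add: final_algebra_def)

lemma measurable_final_algebra: "f \<in> measurable M (final_algebra M f)"
  by (rule measurableI) (auto simp: sets_final_algebra)

lemma measurable_from_final_algebra:
  fixes f :: "'a \<Rightarrow> 'b" and g :: "'b \<Rightarrow> 'c::topological_space"
  assumes "(\<lambda>\<omega>. g (f \<omega>)) \<in> borel_measurable M"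
  shows "g \<in> borel_measurable (final_algebra M f)"
proof (rule measurableI)
  fix A :: "'c set" assume "A \<in> sets borel"
  with assms have "(\<lambda>\<omega>. g (f \<omega>)) -` A \<inter> space M \<in> sets M" by (rule measurable_sets)
  then show "g -` A \<inter> space (final_algebra M f) \<in> sets (final_algebra M f)"
    by (simp add: sets_final_algebra vimage_def)
qed simp

lemma measurable_final_distr:
  assumes "(\<lambda>\<omega>. g (f \<omega>)) \<in> borel_measurable M"
  shows "g \<in> borel_measurable (final_distr M f)"
  unfolding final_distr_def using measurable_from_final_algebra[where f = f and g = g, OF assms] by simp

lemma distr_final_distr:
  assumes "(\<lambda>\<omega>. g (f \<omega>)) \<in> borel_measurable M"
  shows "distr (final_distr M f) borel g = distr M borel (\<lambda>\<omega>. g (f \<omega>))"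
  unfolding final_distr_def
  by (subst distr_distr[OF measurable_from_final_algebra[where f = f and g = g, OF assms] measurable_final_algebra]) (simp add: comp_def)

lemma integral_final_distr:
  fixes g :: "'b \<Rightarrow> 'c::{banach, second_countable_topology}"
  assumes "(\<lambda>\<omega>. g (f \<omega>)) \<in> borel_measurable M"
  shows "(LINT x|final_distr M f. g x) = (LINT \<omega>|M. g (f \<omega>))"
  unfolding final_distr_def
  by (rule integral_distr[OF measurable_final_algebra measurable_from_final_algebra[where f = f and g = g, OF assms]])

section \<open>The limit process is Gaussian\<close>

text \<open>The denominator of \<open>kappa\<close> vanishes at the origin, so the axes are treated
  separately; there both sides are 0. Elsewhere \<open>kappa\<close> is continuous.\<close>

lemma tendsto_kappa_floor:
  assumes "s \<in> {0..1}" "t \<in> {0..1}"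
  shows "(\<lambda>J. kappa (real (nat \<lfloor>2 ^ J * s\<rfloor>) / 2 ^ J) (real (nat \<lfloor>2 ^ J * t\<rfloor>) / 2 ^ J)) \<longlonglongrightarrow> kappa s t"
proof (cases "s = 0 \<or> t = 0")
  case True
  have "kappa 0 r = 0" "kappa r 0 = 0" if "0 \<le> r" for r using that by (auto simp: kappa_def)
  then show ?thesis using True assms by auto
next
  case False
  have lim: "(\<lambda>J. real (nat \<lfloor>2 ^ J * r\<rfloor>) / 2 ^ J) \<longlonglongrightarrow> r" if "0 \<le> r" for r :: real
  proof -
    have "strict_mono (\<lambda>J. 2 ^ J :: nat)" by (rule strict_monoI) simp
    from LIMSEQ_subseq_LIMSEQ[OF tendsto_floor_div[OF that] this] show ?thesis by (simp add: comp_def)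
  qed
  show ?thesis unfolding kappa_def
    by (intro tendsto_intros tendsto_min tendsto_max lim) (use False assms in auto)
qed

context gaussian_limit
begin

text \<open>The dyadic approximations converge almost surely and have centred normal laws; their
  characteristic functions converge by dominated convergence on one side and by convergence of the
  variances on the other. A degenerate limit variance is included.\<close>

lemma limit_law:
  assumes I: "finite I" and \<tau>: "\<And>a. \<tau> a \<in> {0..1}"
  shows "distr noise_space borel (\<lambda>\<omega>. \<Sum>a\<in>I. u a \<bullet> path_of (limit_path \<omega>) (\<tau> a)) =
      normal_law 0 (sqrt (\<Sum>a\<in>I. \<Sum>b\<in>I. kappa (\<tau> a) (\<tau> b) * form (u a) (u b)))"
    and "0 \<le> (\<Sum>a\<in>I. \<Sum>b\<in>I. kappa (\<tau> a) (\<tau> b) * form (u a) (u b))"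
proof -
  define j where "j J a = nat \<lfloor>2 ^ J * \<tau> a\<rfloor>" for J a
  define S where "S J = (\<Sum>a\<in>I. \<Sum>b\<in>I. kappa (real (j J a) / 2 ^ J) (real (j J b) / 2 ^ J) * form (u a) (u b))" for J
  let ?S = "\<Sum>a\<in>I. \<Sum>b\<in>I. kappa (\<tau> a) (\<tau> b) * form (u a) (u b)"
  let ?W = "\<lambda>\<omega>. \<Sum>a\<in>I. u a \<bullet> path_of (limit_path \<omega>) (\<tau> a)"
  let ?WJ = "\<lambda>J \<omega>. \<Sum>a\<in>I. u a \<bullet> V (dyadic J (j J a)) \<omega>"
  have q: "0 \<le> dyadic J (j J a) \<and> dyadic J (j J a) \<le> 1" for J a
    using dyadic_range[of "j J a" J] nat_floor_grid[OF \<tau>, of "2 ^ J" a] by (simp add: j_def)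
  have law: "distr noise_space borel (?WJ J) = normal_law 0 (sqrt (S J))" and S0: "0 \<le> S J" for J
    using V_family[where q = "\<lambda>a. dyadic J (j J a)" and u = u, OF I q] unfolding of_rat_dyadic S_def by auto
  have lim: "S \<longlonglongrightarrow> ?S"
    unfolding S_def j_def by (intro tendsto_sum tendsto_mult_right tendsto_kappa_floor \<tau>)
  show S: "0 \<le> ?S" by (rule LIMSEQ_le_const[OF lim]) (auto intro: S0)
  have Wm: "?W \<in> borel_measurable noise_space"
    by (intro borel_measurable_sum borel_measurable_inner borel_measurable_const limit_path_coordinate_meas \<tau>)
  have WJm: "?WJ J \<in> borel_measurable noise_space" for J by measurable
  have conv: "AE \<omega> in noise_space. (\<lambda>J. ?WJ J \<omega>) \<longlonglongrightarrow> ?W \<omega>"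
    using AE_summable_oscillation
  proof eventually_elim
    case (elim \<omega>)
    have "(\<lambda>J. V (dyadic J (j J a)) \<omega>) \<longlonglongrightarrow> path_of (limit_path \<omega>) (\<tau> a)" for a
      using Z_tendsto(2)[OF elim \<tau>[of a]] unfolding path_of_Z[OF \<tau>] j_def .
    then show ?case by (intro tendsto_sum tendsto_inner tendsto_const)
  qed
  show "distr noise_space borel ?W = normal_law 0 (sqrt ?S)"
  proof (rule noise.normal_law_by_char[OF Wm])
    fix t
    have "(\<lambda>J. LINT \<omega>|noise_space. cis (t * ?WJ J \<omega>)) \<longlonglongrightarrow> (LINT \<omega>|noise_space. cis (t * ?W \<omega>))"
    proof (rule integral_dominated_convergence[where w = "\<lambda>_. 1"])
      have c: "cis \<in> borel_measurable borel"
        by (intro borel_measurable_continuous_onI continuous_on_cis continuous_on_id)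
      show "(\<lambda>\<omega>. cis (t * ?W \<omega>)) \<in> borel_measurable noise_space"
        by (rule measurable_compose[OF borel_measurable_times[OF borel_measurable_const Wm] c])
      show "(\<lambda>\<omega>. cis (t * ?WJ J \<omega>)) \<in> borel_measurable noise_space" for J
        by (rule measurable_compose[OF borel_measurable_times[OF borel_measurable_const WJm] c])
      show "AE \<omega> in noise_space. (\<lambda>J. cis (t * ?WJ J \<omega>)) \<longlonglongrightarrow> cis (t * ?W \<omega>)"
        using conv by eventually_elim (intro tendsto_cis tendsto_mult_left)
    qed simp_all
    moreover have "(\<lambda>J. LINT \<omega>|noise_space. cis (t * ?WJ J \<omega>)) \<longlonglongrightarrow> complex_of_real (exp (- (sqrt ?S * t)\<^sup>2 / 2))"
      unfolding noise.char_of_normal_law[OF WJm real_sqrt_ge_zero[OF S0] law]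
      by (intro tendsto_intros lim) simp
    ultimately show "(LINT \<omega>|noise_space. cis (t * ?W \<omega>)) = complex_of_real (exp (- (sqrt ?S * t)\<^sup>2 / 2))"
      by (rule LIMSEQ_unique)
  qed (simp add: S)
qed

lemma limit_path_nth_meas:
  assumes "t \<in> {0..1}" shows "(\<lambda>\<omega>. path_of (limit_path \<omega>) t $ i) \<in> borel_measurable noise_space"
  by (rule measurable_compose[OF limit_path_coordinate_meas[OF assms] measurable_vec_nth])

lemma limit_path_mean:
  assumes t: "t \<in> {0..1}" shows "(LINT \<omega>|noise_space. path_of (limit_path \<omega>) t) = 0"
proof -
  have c: "integrable noise_space (\<lambda>\<omega>. path_of (limit_path \<omega>) t $ i) \<and>
      (LINT \<omega>|noise_space. path_of (limit_path \<omega>) t $ i) = 0" for i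
  proof -
    note l = limit_law[where I = "{()}" and \<tau> = "\<lambda>_. t" and u = "\<lambda>_. axis i 1", OF finite t]
    show ?thesis
      using noise.normal_law_variable(1,2)[OF limit_path_nth_meas[OF t] real_sqrt_ge_zero[OF l(2)]] l(1)
      by (simp add: inner_axis')
  qed
  then show ?thesis by (subst vec_eq_iff) (simp add: integral_vec_nth)
qed

text \<open>Polarisation: only laws of linear combinations are known, so the product is recovered
  from the squares of the sum and of the difference.\<close>

lemma limit_path_second_moment:
  assumes s: "s \<in> {0..1}" and t: "t \<in> {0..1}"
  shows "integrable noise_space (\<lambda>\<omega>. path_of (limit_path \<omega>) s $ i * path_of (limit_path \<omega>) t $ k)"
    and "(LINT \<omega>|noise_space. path_of (limit_path \<omega>) s $ i * path_of (limit_path \<omega>) t $ k) = kappa s t * \<Sigma> $ i $ k"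
proof -
  let ?a = "\<lambda>\<omega>. path_of (limit_path \<omega>) s $ i" and ?b = "\<lambda>\<omega>. path_of (limit_path \<omega>) t $ k"
  have sq: "integrable noise_space (\<lambda>\<omega>. (?a \<omega> + c * ?b \<omega>)\<^sup>2) \<and>
      (LINT \<omega>|noise_space. (?a \<omega> + c * ?b \<omega>)\<^sup>2) =
        kappa s s * \<Sigma> $ i $ i + 2 * c * (kappa s t * \<Sigma> $ i $ k) + c\<^sup>2 * (kappa t t * \<Sigma> $ k $ k)" for c
  proof -
    let ?\<tau> = "\<lambda>b. if b then s else t" and ?u = "\<lambda>b. if b then axis i 1 else axis k c :: real ^ 'd"
    have \<tau>: "?\<tau> b \<in> {0..1}" for b using s t by auto
    note l = limit_law[where I = "UNIV :: bool set" and \<tau> = ?\<tau> and u = ?u, OF finite \<tau>]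
    have W: "(\<Sum>b\<in>UNIV. ?u b \<bullet> path_of (limit_path \<omega>) (?\<tau> b)) = ?a \<omega> + c * ?b \<omega>" for \<omega>
      by (simp add: UNIV_bool inner_axis')
    have S: "(\<Sum>a\<in>UNIV. \<Sum>b\<in>UNIV. kappa (?\<tau> a) (?\<tau> b) * form (?u a) (?u b)) =
        kappa s s * \<Sigma> $ i $ i + 2 * c * (kappa s t * \<Sigma> $ i $ k) + c\<^sup>2 * (kappa t t * \<Sigma> $ k $ k)"
      by (simp add: UNIV_bool form_axis kappa_sym[of t s] covariance_sym[of k i] power2_eq_square algebra_simps)
    have m: "(\<lambda>\<omega>. ?a \<omega> + c * ?b \<omega>) \<in> borel_measurable noise_space"
      by (intro borel_measurable_add borel_measurable_times borel_measurable_const limit_path_nth_meas s t)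
    note l' = l[unfolded W S]
    show ?thesis
      using noise.normal_law_variable(3,4)[OF m real_sqrt_ge_zero[OF l'(2)] l'(1)] l'(2) by simp
  qed
  have eq: "?a \<omega> * ?b \<omega> = ((?a \<omega> + 1 * ?b \<omega>)\<^sup>2 - (?a \<omega> + (- 1) * ?b \<omega>)\<^sup>2) / 4" for \<omega>
    by (simp add: power2_eq_square algebra_simps)
  show "integrable noise_space (\<lambda>\<omega>. ?a \<omega> * ?b \<omega>)"
    unfolding eq using sq[of 1] sq[of "- 1"] by (intro integrable_divide_zero Bochner_Integration.integrable_diff) blast+
  show "(LINT \<omega>|noise_space. ?a \<omega> * ?b \<omega>) = kappa s t * \<Sigma> $ i $ k"
    unfolding eq integral_divide_zero
    using sq[of 1] sq[of "- 1"] by (subst Bochner_Integration.integral_diff) auto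
qed

abbreviation limit_measure :: "'d cadlag0 measure" where
  "limit_measure \<equiv> final_distr noise_space limit_path"

lemma outer_meas:
  assumes s: "s \<in> {0..1}" and t: "t \<in> {0..1}"
  shows "(\<lambda>\<omega>. outer (path_of (limit_path \<omega>) s) (path_of (limit_path \<omega>) t)) \<in> borel_measurable noise_space"
  by (intro borel_measurable_integrable integrable_vec) (simp add: limit_path_second_moment[OF s t])

lemma gaussian_process_limit:
  "gaussian_process limit_measure (\<lambda>t x. path_of x t) (\<lambda>_. 0) (limit_covariance \<Sigma>)"
  unfolding gaussian_process_def
proof (intro conjI allI impI ballI)
  show "prob_space limit_measure"
    unfolding final_distr_def by (rule noise.prob_space_distr[OF measurable_final_algebra])
  have m: "(\<lambda>\<omega>. path_of (limit_path \<omega>) t) \<in> borel_measurable noise_space" if "t \<in> {0..1}" for t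
    by (rule limit_path_coordinate_meas[OF that])
  show mean: "(LINT x|limit_measure. path_of x t) = 0" if t: "t \<in> {0..1}" for t
    using integral_final_distr[where f = limit_path and g = "\<lambda>x. path_of x t", OF m[OF t]] limit_path_mean[OF t] by simp
  show "covariance_matrix limit_measure (\<lambda>x. path_of x s) (\<lambda>x. path_of x t) = limit_covariance \<Sigma> s t"
    if s: "s \<in> {0..1}" and t: "t \<in> {0..1}" for s t
  proof -
    have "covariance_matrix limit_measure (\<lambda>x. path_of x s) (\<lambda>x. path_of x t) =
        (LINT x|limit_measure. outer (path_of x s) (path_of x t))"
      unfolding covariance_matrix_def mean[OF s] mean[OF t] by simp
    also have "\<dots> = (LINT \<omega>|noise_space. outer (path_of (limit_path \<omega>) s) (path_of (limit_path \<omega>) t))"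
      by (rule integral_final_distr[where f = limit_path and g = "\<lambda>x. outer (path_of x s) (path_of x t)", OF outer_meas[OF s t]])
    also have "\<dots> = kappa s t *\<^sub>R \<Sigma>"
    proof -
      let ?o = "\<lambda>\<omega>. outer (path_of (limit_path \<omega>) s) (path_of (limit_path \<omega>) t)"
      have i: "integrable noise_space (\<lambda>\<omega>. ?o \<omega> $ i $ k)" for i k
        unfolding outer_nth by (rule limit_path_second_moment[OF s t])
      have "(LINT \<omega>|noise_space. ?o \<omega>) $ i $ k = (LINT \<omega>|noise_space. ?o \<omega> $ i $ k)" for i k
        unfolding integral_vec_nth[where f = ?o, OF integrable_vec[OF i]] by (rule integral_vec_nth[OF i])
      then show ?thesis
        unfolding vec_eq_iff outer_nth limit_path_second_moment(2)[OF s t] by simp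
    qed
    also have "\<dots> = limit_covariance \<Sigma> s t"
      using s t by (simp add: limit_covariance_eq_kappa)
    finally show ?thesis .
  qed
  fix T :: "real set" assume T: "finite T" "T \<subseteq> {0..1}"
  show "multivariate_normal limit_measure T (\<lambda>t x. path_of x t)"
    unfolding multivariate_normal_def
  proof (intro conjI ballI allI)
    show "(\<lambda>x. path_of x t) \<in> borel_measurable limit_measure" if "t \<in> T" for t
      using that T by (intro measurable_final_distr m) auto
    fix u :: "real \<Rightarrow> real ^ 'd"
    \<comment> \<open>\<open>limit_law\<close> wants every \<open>\<tau> a\<close> in the unit
      interval, not only those with \<open>a\<close> in \<open>T\<close>.\<close>
    define \<tau> where "\<tau> t = (if t \<in> T then t else 0)" for t
    have \<tau>: "\<tau> t \<in> {0..1}" for t using T by (auto simp: \<tau>_def)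
    have eq: "(\<Sum>t\<in>T. u t \<bullet> path_of x t) = (\<Sum>t\<in>T. u t \<bullet> path_of x (\<tau> t))" for x :: "'d cadlag0"
      by (intro sum.cong) (auto simp: \<tau>_def)
    note l = limit_law[where I = T and \<tau> = \<tau> and u = u, OF T(1) \<tau>]
    have "(\<lambda>\<omega>. \<Sum>t\<in>T. u t \<bullet> path_of (limit_path \<omega>) (\<tau> t)) \<in> borel_measurable noise_space"
      by (intro borel_measurable_sum borel_measurable_inner borel_measurable_const m \<tau>)
    then have "distr limit_measure borel (\<lambda>x. \<Sum>t\<in>T. u t \<bullet> path_of x (\<tau> t)) =
        distr noise_space borel (\<lambda>\<omega>. \<Sum>t\<in>T. u t \<bullet> path_of (limit_path \<omega>) (\<tau> t))"
      by (rule distr_final_distr)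
    also note l(1)
    finally have "distr limit_measure borel (\<lambda>x. \<Sum>t\<in>T. u t \<bullet> path_of x t) =
        normal_law 0 (sqrt (\<Sum>a\<in>T. \<Sum>b\<in>T. kappa (\<tau> a) (\<tau> b) * form (u a) (u b)))"
      unfolding eq .
    with real_sqrt_ge_zero[OF l(2)]
    show "\<exists>m s. 0 \<le> s \<and> distr limit_measure borel (\<lambda>x. \<Sum>t\<in>T. u t \<bullet> path_of x t) = normal_law m s"
      by (intro exI conjI)
  qed
qed

section \<open>Weak convergence\<close>

text \<open>For fixed \<open>J\<close> both sides are the expectation of one function
  \<open>F\<close> of the finitely many scalars coded in \<open>A\<close>: the coordinates of the
  path at the dyadic points of level \<open>J\<close>. \<open>F\<close> is Lipschitz in these
  scalars, so \<open>cf_convergence\<close> applies.\<close>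

lemma grid_path_convergence:
  fixes f :: "'d cadlag0 \<Rightarrow> real"
  assumes lip: "\<And>x y. \<bar>f x - f y\<bar> \<le> C * dist x y" and bnd: "\<And>x. \<bar>f x\<bar> \<le> B" and C: "0 \<le> C"
  shows "(\<lambda>n. LINT \<omega>|M. f (grid_path (2 ^ J) n \<omega>)) \<longlonglongrightarrow> (LINT \<omega>|noise_space. f (Z J \<omega>))"
proof -
  let ?\<phi> = "\<lambda>(j, i :: 'd). code (dyadic J j) i"
  define A where "A = ?\<phi> ` ({..2 ^ J} \<times> UNIV)"
  define F where "F x = f (step_path (2 ^ J) (\<lambda>j. \<chi> i. x (code (dyadic J j) i)))" for x :: "nat \<Rightarrow> real"
  let ?K = "fdd_kernel code_time code_coord :: nat \<Rightarrow> nat \<Rightarrow> real"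
  have A: "finite A" by (simp add: A_def)
  have K0: "0 \<le> ?K p p" for p
    by (rule positive_semidefinite_diag[OF positive_semidefinite_fdd_kernel[OF code_time_range]])
  have Y2: "integrable noise_space (\<lambda>\<omega>. (X p \<omega>)\<^sup>2) \<and> (LINT \<omega>|noise_space. (X p \<omega>)\<^sup>2) = ?K p p" for p
    using noise.normal_law_variable(3,4)[OF X_meas real_sqrt_ge_zero[OF K0[of p]], of p] X_law[of "{p}" "\<lambda>_. 1"] K0[of p]
    by simp
  interpret cf_convergence M noise_space "fdd code_time code_coord" "\<lambda>\<omega> p. X p \<omega>" A
  proof
    show "finite A" by (rule A)
    show "(\<lambda>\<omega>. fdd code_time code_coord n \<omega> i) \<in> borel_measurable M" for n i by (rule measurable_fdd)
    show "(\<lambda>\<omega>. X i \<omega>) \<in> borel_measurable noise_space" for i by (rule X_meas)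
    fix u
    let ?S = "\<Sum>p\<in>A. \<Sum>r\<in>A. u p * u r * ?K p r"
    have S: "0 \<le> ?S"
      using positive_semidefinite_fdd_kernel[OF code_time_range] A by (auto simp: positive_semidefinite_def)
    have "(LINT \<omega>|noise_space. cis (1 * (\<Sum>p\<in>A. u p * X p \<omega>))) = complex_of_real (exp (- (sqrt ?S * 1)\<^sup>2 / 2))"
      by (rule noise.char_of_normal_law[OF _ real_sqrt_ge_zero[OF S] X_law[OF A]]) simp
    then have "(LINT \<omega>|noise_space. cis (linear_form A u (\<lambda>p. X p \<omega>))) = complex_of_real (exp (- ?S / 2))"
      using S by (simp add: linear_form_def)
    then show "(\<lambda>n. LINT \<omega>|M. cis (linear_form A u (fdd code_time code_coord n \<omega>))) \<longlonglongrightarrow>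
        (LINT \<omega>|noise_space. cis (linear_form A u (\<lambda>p. X p \<omega>)))"
      using fdd_cf[OF code_time_range A] by simp
  qed
  have "(\<lambda>n. LINT \<omega>|M. F (fdd code_time code_coord n \<omega>)) \<longlonglongrightarrow> (LINT \<omega>|noise_space. F (\<lambda>p. X p \<omega>))"
  proof (rule lipschitz_convergence)
    fix x y :: "nat \<Rightarrow> real"
    have "\<bar>F x - F y\<bar> \<le> C * (\<Sum>j\<le>2 ^ J. norm ((\<chi> i. x (code (dyadic J j) i)) - (\<chi> i. y (code (dyadic J j) (i :: 'd)))))"
      unfolding F_def by (rule order_trans[OF lip mult_left_mono[OF dist_step_path_le_sum C]])
    also have "\<dots> \<le> C * (\<Sum>j\<le>2 ^ J. \<Sum>i\<in>UNIV. \<bar>x (code (dyadic J j) i) - y (code (dyadic J j) (i :: 'd))\<bar>)"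
      by (intro mult_left_mono[OF sum_mono C] order_trans[OF norm_le_l1_cart]) simp
    also have "(\<Sum>j\<le>2 ^ J. \<Sum>i\<in>UNIV. \<bar>x (code (dyadic J j) i) - y (code (dyadic J j) (i :: 'd))\<bar>) = (\<Sum>p\<in>A. \<bar>x p - y p\<bar>)"
      unfolding A_def
      by (subst sum.reindex) (auto simp: inj_on_def code_inj dyadic_inj sum.cartesian_product')
    finally show "\<bar>F x - F y\<bar> \<le> C * (\<Sum>p\<in>A. \<bar>x p - y p\<bar>)" .
  next
    show "\<bar>F x\<bar> \<le> B" for x unfolding F_def by (rule bnd)
    show "integrable M (\<lambda>\<omega>. (fdd code_time code_coord n \<omega> p)\<^sup>2)" for n p
      by (rule fdd_second_moment[OF code_time_range])
    \<comment> \<open>\<open>lipschitz_convergence\<close> asks for one constant on both sides; the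
      bound for the walk plus all limiting variances serves either.\<close>
    show "(LINT \<omega>|M. (fdd code_time code_coord n \<omega> p)\<^sup>2) \<le> mean_square + (\<Sum>p\<in>A. ?K p p)" for n p
      using fdd_second_moment(2)[OF code_time_range] K0 by (intro order_trans[OF _ le_add_same_cancel1[THEN iffD2]] sum_nonneg)
    show "integrable noise_space (\<lambda>\<omega>. (X p \<omega>)\<^sup>2)" for p using Y2 by blast
    show "(LINT \<omega>|noise_space. (X p \<omega>)\<^sup>2) \<le> mean_square + (\<Sum>p\<in>A. ?K p p)" if "p \<in> A" for p
      using Y2[of p] member_le_sum[OF that, of "\<lambda>p. ?K p p"] K0 A mean_square_nonneg by (simp add: add_increasing)
  qed (rule C)
  moreover have "F (fdd code_time code_coord n \<omega>) = f (grid_path (2 ^ J) n \<omega>)" for n \<omega>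
    unfolding F_def grid_path_def
  proof (intro arg_cong[of _ _ f] step_path_cong)
    fix j :: nat assume "j \<le> 2 ^ J"
    then have "code_time (code (dyadic J j) i) = real j / real (2 ^ J)" for i :: 'd
      using dyadic_range[of j J] by (simp add: code_time_code of_rat_dyadic)
    then show "(\<chi> i. fdd code_time code_coord n \<omega> (code (dyadic J j) i)) =
        (1 / sqrt (real n)) *\<^sub>R centre_of_mass \<xi> (nat \<lfloor>real n * (real j / real (2 ^ J))\<rfloor>) \<omega>"
      by (simp add: vec_eq_iff fdd_def del: of_nat_power)
  qed
  moreover have "F (\<lambda>p. X p \<omega>) = f (Z J \<omega>)" for \<omega>
    by (simp add: F_def Z_def V_def)
  ultimately show ?thesis by simp
qed

text \<open>Three-term comparison through \<open>grid_path\<close> and \<open>Z J\<close>. The error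
  of the first term is small only for large \<open>J\<close> and \<open>n\<close> together, so
  \<open>J\<close> is fixed before \<open>n\<close> grows.\<close>

lemma lipschitz_path_convergence:
  fixes f :: "'d cadlag0 \<Rightarrow> real"
  assumes lip: "\<And>x y. \<bar>f x - f y\<bar> \<le> C * dist x y" and bnd: "\<And>x. \<bar>f x\<bar> \<le> B" and C: "0 \<le> C"
  shows "(\<lambda>n. LINT \<omega>|M. f (centre_of_mass_path \<xi> n \<omega>)) \<longlonglongrightarrow> (LINT \<omega>|noise_space. f (limit_path \<omega>))"
proof (rule tendstoI)
  fix e :: real assume e: "e > 0"
  have fc: "continuous_on UNIV f" by (rule lipschitz_continuous_on[OF lip])
  note fm = borel_measurable_continuous_onI[OF fc]
  have "(\<lambda>J. LINT \<omega>|noise_space. f (Z J \<omega>)) \<longlonglongrightarrow> (LINT \<omega>|noise_space. f (limit_path \<omega>))"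
  proof (rule integral_dominated_convergence[where w = "\<lambda>_. B"])
    show "AE \<omega> in noise_space. (\<lambda>J. f (Z J \<omega>)) \<longlonglongrightarrow> f (limit_path \<omega>)"
      using AE_summable_oscillation
    proof eventually_elim
      case (elim \<omega>)
      then show ?case
        using continuous_on_tendsto_compose[OF fc Z_tendsto(1)[OF elim]] by simp
    qed
    show "(\<lambda>\<omega>. f (limit_path \<omega>)) \<in> borel_measurable noise_space"
      by (rule measurable_compose[OF limit_path_meas fm])
    show "(\<lambda>\<omega>. f (Z J \<omega>)) \<in> borel_measurable noise_space" for J
      by (rule measurable_compose[OF Z_meas fm])
  qed (simp_all add: bnd)
  then have 1: "\<forall>\<^sub>F J in sequentially. dist (LINT \<omega>|noise_space. f (Z J \<omega>)) (LINT \<omega>|noise_space. f (limit_path \<omega>)) < e / 3"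
    by (rule tendstoD) (use e in simp)
  \<comment> \<open>The summand 0 is the limit of \<open>1 / real n\<close>: \<open>J\<close> is
    chosen to make the limiting error less than \<open>e / 3\<close>, after which large
    \<open>n\<close> keeps it so.\<close>
  have "(\<lambda>J. C * sqrt (4 * mean_square * sqrt ((1 / 2) ^ J + 0))) \<longlonglongrightarrow> C * sqrt (4 * mean_square * sqrt (0 + 0))"
    by (intro tendsto_intros LIMSEQ_power_zero) simp
  then have 2: "\<forall>\<^sub>F J in sequentially. C * sqrt (4 * mean_square * sqrt ((1 / 2) ^ J + 0)) < e / 3"
    by (rule order_tendstoD) (use e in simp)
  obtain J where J: "dist (LINT \<omega>|noise_space. f (Z J \<omega>)) (LINT \<omega>|noise_space. f (limit_path \<omega>)) < e / 3"
    "C * sqrt (4 * mean_square * sqrt ((1 / 2) ^ J + 0)) < e / 3"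
    using eventually_happens[OF eventually_conj[OF 1 2]] by auto
  have "(\<lambda>n. C * sqrt (4 * mean_square * sqrt ((1 / 2) ^ J + 1 / real n))) \<longlonglongrightarrow>
      C * sqrt (4 * mean_square * sqrt ((1 / 2) ^ J + 0))"
    by (intro tendsto_intros lim_1_over_n)
  then have "\<forall>\<^sub>F n in sequentially. C * sqrt (4 * mean_square * sqrt ((1 / 2) ^ J + 1 / real n)) < e / 3"
    using J(2) by (rule order_tendstoD)
  moreover have "\<forall>\<^sub>F n in sequentially. dist (LINT \<omega>|M. f (grid_path (2 ^ J) n \<omega>)) (LINT \<omega>|noise_space. f (Z J \<omega>)) < e / 3"
    by (rule tendstoD[OF grid_path_convergence[OF lip bnd C]]) (use e in simp)
  ultimately show "\<forall>\<^sub>F n in sequentially.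
      dist (LINT \<omega>|M. f (centre_of_mass_path \<xi> n \<omega>)) (LINT \<omega>|noise_space. f (limit_path \<omega>)) < e"
    using eventually_gt_at_top[of 0]
  proof eventually_elim
    case (elim n)
    have "\<bar>(LINT \<omega>|M. f (centre_of_mass_path \<xi> n \<omega>)) - (LINT \<omega>|M. f (grid_path (2 ^ J) n \<omega>))\<bar>
        \<le> C * sqrt (4 * mean_square * sqrt (1 / real (2 ^ J) + 1 / real n))"
      by (rule expectation_grid_path[OF lip bnd C elim(3)]) simp
    also have "1 / real (2 ^ J) = (1 / 2) ^ J" by (simp add: power_one_over)
    finally show ?case using elim(1,2) J(1) unfolding dist_real_def by linarith
  qed
qed

lemma weakly_converges_limit:
  "weakly_converges M (centre_of_mass_path \<xi>) limit_measure (\<lambda>x. x)"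
proof (rule weakly_converges_lipschitz)
  show "prob_space M" by unfold_locales
  show "prob_space limit_measure"
    unfolding final_distr_def by (rule noise.prob_space_distr[OF measurable_final_algebra])
  \<comment> \<open>On the final sigma-algebra, Borel measurability of the identity amounts to that
    of \<open>limit_path\<close>.\<close>
  show "(\<lambda>x. x) \<in> borel_measurable limit_measure"
    by (rule measurable_final_distr[OF limit_path_meas])
  fix f :: "'d cadlag0 \<Rightarrow> real" and C B
  assume lip: "\<And>x y. \<bar>f x - f y\<bar> \<le> C * dist x y" and bnd: "\<And>x. \<bar>f x\<bar> \<le> B"
  have lip': "\<bar>f x - f y\<bar> \<le> max C 0 * dist x y" for x y
    by (rule order_trans[OF lip mult_right_mono]) auto
  have "(LINT x|limit_measure. f x) = (LINT \<omega>|noise_space. f (limit_path \<omega>))"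
    by (rule integral_final_distr[where f = limit_path and g = f, OF measurable_compose[OF limit_path_meas
          borel_measurable_continuous_onI[OF lipschitz_continuous_on[OF lip]]]])
  then show "(\<lambda>n. LINT \<omega>|M. f (centre_of_mass_path \<xi> n \<omega>)) \<longlonglongrightarrow> (LINT x|limit_measure. f x)"
    using lipschitz_path_convergence[OF lip' bnd] by simp
qed (rule measurable_centre_of_mass_path)

end

theorem theorem7p9:
  fixes M :: "'a measure" and \<xi> :: "nat \<Rightarrow> 'a \<Rightarrow> real ^ 'd::finite" and \<Sigma> :: "real ^ 'd ^ 'd"
  assumes "prob_space M"
    and "prob_space.indep_vars M (\<lambda>_. borel) \<xi> UNIV"
    and "\<And>i. distr M borel (\<xi> i) = distr M borel (\<xi> 0)"
    and "integrable M (\<lambda>\<omega>. norm (\<xi> 0 \<omega>))"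
    and "(LINT \<omega>|M. \<xi> 0 \<omega>) = 0"
    and "integrable M (\<lambda>\<omega>. (norm (\<xi> 0 \<omega>))\<^sup>2)"
    and "\<Sigma> = (LINT \<omega>|M. outer (\<xi> 0 \<omega>) (\<xi> 0 \<omega>))"
  shows "\<exists>(N :: 'd cadlag0 measure) (X :: 'd cadlag0 \<Rightarrow> 'd cadlag0).
           gaussian_process N (\<lambda>t \<omega>. path_of (X \<omega>) t) (\<lambda>_. 0) (limit_covariance \<Sigma>) \<and>
           weakly_converges M (centre_of_mass_path \<xi>) N X"
proof -
  interpret centred_iid M \<xi> \<Sigma>
    by (intro centred_iid.intro centred_iid_axioms.intro assms)
  show ?thesis
  \<comment> \<open>One Gaussian sequence serves all codes at once, that is, all rational times and
    all coordinates; it supplies the \<open>X\<close> that \<open>gaussian_limit\<close>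
    fixes.\<close>
  proof (rule gaussian_sequence[OF positive_semidefinite_fdd_kernel[OF code_time_range]])
    fix X :: "nat \<Rightarrow> (nat \<Rightarrow> real) \<Rightarrow> real"
    assume "\<And>p. X p \<in> borel_measurable noise_space"
      "\<And>p \<omega>. fdd_kernel code_time code_coord p p = 0 \<Longrightarrow> X p \<omega> = 0"
      "\<And>A u. finite A \<Longrightarrow> distr noise_space borel (\<lambda>\<omega>. \<Sum>p\<in>A. u p * X p \<omega>) =
         normal_law 0 (sqrt (\<Sum>p\<in>A. \<Sum>r\<in>A. u p * u r * fdd_kernel code_time code_coord p r))"
    then interpret gaussian_limit M \<xi> \<Sigma> X
      by (intro gaussian_limit.intro gaussian_limit_axioms.intro centred_iid_axioms)
    show ?thesis
      by (intro exI[of _ limit_measure] exI[of _ "\<lambda>x. x"] conjI gaussian_process_limit weakly_converges_limit)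
  qed
qed

end
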